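(* Let $c>0$ and $\nu>-1$, and let $$Q_N(\zeta)=-\tfrac1N\log\Bigl[K_\nu\bigl(\tfrac{N^2|\zeta|}{c^2}\bigr)\cdot|\zeta|^\nu\Bigr]-\Bigl(\tfrac N{c^2}-1\Bigr)\operatorname{Re}\zeta,\qquad\zeta\in\mathbb{C},$$ where $K_\nu$ is the modified Bessel function of the second kind. Let $\{\zeta_j\}_1^N$ be a random sample from the Gibbs measure associated with $Q_N$ (at $\beta=1$), with $1$-point function $\mathbf{R}_N$, and rescale about the origin by $$z=\bigl(\tfrac Nc\bigr)^2\zeta,\qquad R_N(z)=\bigl(\tfrac cN\bigr)^4\,\mathbf{R}_N(\zeta).$$ Then $R_N\to R$ as $N\to\infty$, uniformly on compact subsets of $\mathbb{C}\setminus(-\infty,0]$, where $$R(z)=\tfrac12\,K_\nu(|z|)\,e^{\operatorname{Re}z}\int_0^{2c}s\,e^{-\frac12s^2}\,\bigl|J_\nu(s\,z^{1/2})\bigr|^2\,ds.$$ Here $J_\nu$ is the Bessel function of the first kind and $z^{1/2}$ is the principal branch, with branch cut along the negative real axis.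
   Context: $dA(\zeta)=\tfrac1\pi\,d\xi\,d\eta$ ($\zeta=\xi+i\eta$) is normalized Lebesgue measure on $\mathbb{C}$ and $dA_N=(dA)^{\otimes N}$. For a potential $Q_N$ put $H_N=\sum_{j\ne k}\log\frac1{|\zeta_j-\zeta_k|}+N\sum_{j=1}^NQ_N(\zeta_j)$. The Gibbs measure at $\beta=1$ is $d\mathbf{P}_N=\frac1{Z_N}e^{-H_N}\,dA_N$ on $\mathbb{C}^N$, with $Z_N$ the normalizing constant. The $1$-point function is $\mathbf{R}_N(\zeta)=\lim_{\varepsilon\to0}\varepsilon^{-2}\,\mathbf{E}_N[\#(\{\zeta_j\}_1^N\cap D(\zeta,\varepsilon))]$, where $D(\zeta,\varepsilon)$ is the open disc with center $\zeta$ and radius $\varepsilon$. *)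

theory Defs
  imports "HOL-Probability.Probability"
begin

section \<open>Bessel functions\<close>

text \<open>
  The reciprocal Gamma function \<open>rGamma\<close> is entire, so the series below also cover orders \<open>\<nu>\<close> for
  which some of the values \<open>\<Gamma>(k + \<nu> + 1)\<close> are poles. The powers \<open>powr\<close> are the principal ones;
  since \<open>0 powr a = 0\<close>, the values at the argument 0 are not meaningful in general.
\<close>

definition bessel_J :: "real \<Rightarrow> complex \<Rightarrow> complex" where
  "bessel_J \<nu> w = (w / 2) powr of_real \<nu> *
     (\<Sum>k. (-1) ^ k * rGamma (of_nat k + of_real \<nu> + 1) / fact k * (w / 2) ^ (2 * k))"

definition bessel_I :: "real \<Rightarrow> real \<Rightarrow> real" where
  "bessel_I \<nu> x = (x / 2) powr \<nu> *
     (\<Sum>k. rGamma (of_nat k + \<nu> + 1) / fact k * (x / 2) ^ (2 * k))"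

text \<open>For integer orders the quotient is of the form 0/0 and is replaced by its limit in the order.\<close>

definition bessel_K :: "real \<Rightarrow> real \<Rightarrow> real" where
  "bessel_K \<nu> x =
     (let q = (\<lambda>\<mu>. pi / 2 * (bessel_I (- \<mu>) x - bessel_I \<mu> x) / sin (\<mu> * pi))
      in if \<nu> \<in> \<int> then Lim (at \<nu>) q else q \<nu>)"

section \<open>Coulomb gas at inverse temperature 1\<close>

definition area_measure :: "complex measure" where
  "area_measure = density lborel (\<lambda>_. ennreal (1 / pi))"

text \<open>
  Configurations are functions \<open>\<zeta>\<close> on the index set \<open>{..<N}\<close>. As \<open>ln\<close> is real-valued, the energy
  is finite (instead of infinite) when two particles collide; this happens on a null set only.
\<close>

definition energy :: "nat \<Rightarrow> (complex \<Rightarrow> real) \<Rightarrow> (nat \<Rightarrow> complex) \<Rightarrow> real" where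
  "energy N Q \<zeta> =
     (\<Sum>j<N. \<Sum>k\<in>{..<N} - {j}. ln (1 / cmod (\<zeta> j - \<zeta> k))) + real N * (\<Sum>j<N. Q (\<zeta> j))"

definition config_measure :: "nat \<Rightarrow> (nat \<Rightarrow> complex) measure" where
  "config_measure N = PiM {..<N} (\<lambda>_. area_measure)"

definition partition_function :: "nat \<Rightarrow> (complex \<Rightarrow> real) \<Rightarrow> ennreal" where
  "partition_function N Q = (\<integral>\<^sup>+ \<zeta>. ennreal (exp (- energy N Q \<zeta>)) \<partial>config_measure N)"

definition gibbs_measure :: "nat \<Rightarrow> (complex \<Rightarrow> real) \<Rightarrow> (nat \<Rightarrow> complex) measure" where
  "gibbs_measure N Q = density (config_measure N)
     (\<lambda>\<zeta>. ennreal (exp (- energy N Q \<zeta>)) / partition_function N Q)"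

text \<open>Particles are counted with multiplicity; they are almost surely distinct.\<close>

definition one_point_function :: "nat \<Rightarrow> (complex \<Rightarrow> real) \<Rightarrow> complex \<Rightarrow> real" where
  "one_point_function N Q z = Lim (at_right 0)
     (\<lambda>\<epsilon>. (\<integral>\<zeta>. real (card {j \<in> {..<N}. \<zeta> j \<in> ball z \<epsilon>}) \<partial>gibbs_measure N Q) / \<epsilon>\<^sup>2)"

section \<open>The Bessel potential and the limiting density\<close>

text \<open>
  The value of the potential at the origin, where \<open>bessel_K\<close> is singular, is irrelevant for the
  Gibbs measure. The partition function may be infinite for finitely many \<open>N\<close> (roughly for
  \<open>2 * N \<le> c\<^sup>2\<close>).
\<close>

definition bessel_potential :: "real \<Rightarrow> real \<Rightarrow> nat \<Rightarrow> complex \<Rightarrow> real" where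
  "bessel_potential c \<nu> N \<zeta> =
     - (1 / real N) * ln (bessel_K \<nu> ((real N)\<^sup>2 * cmod \<zeta> / c\<^sup>2) * cmod \<zeta> powr \<nu>)
     - (real N / c\<^sup>2 - 1) * Re \<zeta>"

definition rescaled_one_point_function :: "real \<Rightarrow> real \<Rightarrow> nat \<Rightarrow> complex \<Rightarrow> real" where
  "rescaled_one_point_function c \<nu> N z =
     (c / real N) ^ 4 *
     one_point_function N (bessel_potential c \<nu> N) (of_real ((c / real N)\<^sup>2) * z)"

definition limit_density :: "real \<Rightarrow> real \<Rightarrow> complex \<Rightarrow> real" where
  "limit_density c \<nu> z = 1 / 2 * bessel_K \<nu> (cmod z) * exp (Re z) *
     (LBINT s:{0..2 * c}. s * exp (- s\<^sup>2 / 2) * (cmod (bessel_J \<nu> (of_real s * csqrt z)))\<^sup>2)"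

end

theory Submission
  imports Defs "Jordan_Normal_Form.Determinant" "HOL-Real_Asymp.Real_Asymp"
begin

text \<open>
  Put \<open>w = exp (- N Q)\<close>. The Gibbs weight is the squared modulus of a Vandermonde determinant times
  \<open>\<Prod>j. w (\<zeta>\<^sub>j)\<close>. Row operations replace the powers by polynomials \<open>p\<^sub>n\<close> of degree \<open>n\<close>, and if these
  are orthonormal for \<open>w\<close>, expanding the two determinants over permutations and integrating out the
  coordinates leaves only the diagonal terms. Hence the 1-point function is
  \<open>w (\<zeta>) * (\<Sum>n<N. \<bar>p\<^sub>n (\<zeta>)\<bar>\<^sup>2)\<close> (\<open>one_point_function_orthonormal\<close>).

  For the Bessel potential the \<open>p\<^sub>n\<close> are Laguerre polynomials. The reason is that
  \<open>r\<^sup>\<nu> K\<^sub>\<nu>(r) = 2\<^sup>\<nu>\<^sup>-\<^sup>1 \<integral> t\<^sup>\<nu>\<^sup>-\<^sup>1 exp (- t - r\<^sup>2 / (4 t)) dt\<close>, the integral being over \<open>t > 0\<close>, makes the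
  weight a mixture of Gaussians. A Gaussian tilted by \<open>exp (\<alpha> Re z)\<close> is a translated Gaussian, so
  its moments are finite sums, and integrating over \<open>t\<close> turns these into Gamma values
  (\<open>bessel_weight_moment\<close>). Pairing the Laguerre polynomial of degree \<open>n\<close> with the conjugate of \<open>z\<^sup>m\<close> then gives
  the \<open>n\<close>-th finite difference of a polynomial of degree \<open>m\<close>: it vanishes for \<open>m < n\<close> and is
  explicit for \<open>m = n\<close> (\<open>laguerre_weighted_moment\<close>, \<open>laguerre_orthogonal\<close>).

  The integral representation itself (\<open>bessel_K_eq_integral\<close>) is proved in three steps. For
  \<open>0 < \<nu> < 1\<close> the integral and the combination of \<open>I\<^sub>\<nu>\<close> and \<open>I\<^sub>-\<^sub>\<nu>\<close> that defines \<open>K\<^sub>\<nu>\<close> solve the same linear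
  first-order system with the same values at 0. Both sides obey the same three-term recurrence in
  \<open>\<nu>\<close>, which gives all other orders that are not integers. Integer orders follow because the integral is
  continuous in the order.

  In the variable \<open>z\<close> the 1-point function becomes \<open>W(z) * (\<Sum>n<N. \<bar>L\<^sub>n(\<kappa> z)\<bar>\<^sup>2 / h\<^sub>n)\<close>
  (\<open>rescaled_one_point\<close>), where the tilt is \<open>\<alpha> = 1 - c\<^sup>2/N\<close> and \<open>\<kappa> = (1 - \<alpha>\<^sup>2) / (2 \<alpha>)\<close>, so that
  \<open>\<kappa> N\<close> tends to \<open>c\<^sup>2\<close>. The sum is the integral over \<open>0 < x < 1\<close> of a step function of \<open>n = \<lfloor>N x\<rfloor>\<close>. With
  the normalization chosen here, \<open>L\<^sub>n(\<kappa> z)\<close> is close to \<open>E(- c\<^sup>2 x z)\<close>, where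
  \<open>J\<^sub>\<nu>(w) = (w/2)\<^sup>\<nu> E(- w\<^sup>2/4)\<close>; the error is explicit and uniform in \<open>x\<close> and in bounded \<open>z\<close>
  (\<open>laguerre_poly_close\<close>). The coefficients \<open>N / h\<^sub>n\<close> converge in \<open>L\<^sup>1\<close> to a multiple of
  \<open>x\<^sup>\<nu> exp (- 2 c\<^sup>2 x)\<close> by dominated convergence (\<open>step_profile_L1\<close>). Together this is uniform convergence on
  discs (\<open>laguerre_sum_uniform\<close>), and the substitution \<open>s = 2 c \<surd>x\<close> identifies the limit
  (\<open>limit_density_eq\<close>).
\<close>

section \<open>Determinantal structure of the Gibbs measure\<close>

text \<open>
  The determinant depends on the polynomials only through their leading coefficients. As a function
  of the last point it is a polynomial of degree at most \<open>n\<close> that vanishes at the \<open>n\<close> other points,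
  which determines it up to its leading coefficient, a smaller determinant of the same kind.
\<close>
lemma vandermonde_det:
  fixes p :: "nat \<Rightarrow> 'a::field poly" and x :: "nat \<Rightarrow> 'a"
  assumes deg: "\<And>i. degree (p i) \<le> i" and inj: "inj_on x {..<n}"
  shows "Determinant.det (Matrix.mat n n (\<lambda>(j, i). poly (p i) (x j))) =
           (\<Prod>j<n. coeff (p j) j * (\<Prod>k<j. x j - x k))"
  using inj
proof (induction n)
  case 0
  then show ?case by (simp add: Determinant.det_def)
next
  case (Suc n)
  \<comment> \<open>\<open>A t\<close> has the last point replaced by \<open>t\<close>; its determinant is the polynomial \<open>q\<close> in \<open>t\<close>.\<close>
  define A where "A = (\<lambda>t. Matrix.mat (Suc n) (Suc n) (\<lambda>(j, i). poly (p i) (if j = n then t else x j)))"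
  define q where "q = (\<Sum>i<Suc n. Polynomial.smult (cofactor (A 0) n i) (p i))"
  have Ac: "A t \<in> carrier_mat (Suc n) (Suc n)" for t by (simp add: A_def)
  have cof: "cofactor (A t) n i = cofactor (A 0) n i" if "i < Suc n" for t i
  proof -
    have "mat_delete (A t) n i = mat_delete (A 0) n i"
      by (rule eq_matI) (auto simp: mat_delete_def A_def)
    then show ?thesis by (simp add: cofactor_def)
  qed
  have det_q: "Determinant.det (A t) = poly q t" for t
  proof -
    have "Determinant.det (A t) = (\<Sum>i<Suc n. A t $$ (n, i) * cofactor (A t) n i)"
      by (rule laplace_expansion_row[OF Ac]) simp
    also have "\<dots> = (\<Sum>i<Suc n. poly (p i) t * cofactor (A 0) n i)"
      by (intro sum.cong refl arg_cong2[where f="(*)"] cof) (auto simp: A_def)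
    finally show ?thesis by (simp add: q_def poly_sum mult.commute)
  qed
  have inj': "inj_on x {..<n}" by (rule inj_on_subset[OF Suc.prems]) auto
  have lead: "cofactor (A 0) n n = (\<Prod>j<n. coeff (p j) j * (\<Prod>k<j. x j - x k))"
  proof -
    have "mat_delete (A 0) n n = Matrix.mat n n (\<lambda>(j, i). poly (p i) (x j))"
      by (rule eq_matI) (auto simp: mat_delete_def A_def)
    moreover have "Determinant.det (Matrix.mat n n (\<lambda>(j, i). poly (p i) (x j))) = (\<Prod>j<n. coeff (p j) j * (\<Prod>k<j. x j - x k))"
      by (rule Suc.IH[OF inj'])
    ultimately show ?thesis by (simp add: cofactor_def)
  qed
  have zero: "poly q (x j) = 0" if "j < n" for j
  proof -
    have "Determinant.det (A (x j)) = 0"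
      using that by (intro det_identical_rows[OF Ac, of j n]) (auto simp: A_def intro!: eq_vecI)
    then show ?thesis by (simp add: det_q)
  qed
  let ?c = "(\<Prod>j<n. coeff (p j) j * (\<Prod>k<j. x j - x k)) * coeff (p n) n"
  have q_eq: "q = Polynomial.smult ?c (\<Prod>k<n. [:- x k, 1:])"
  proof (rule poly_eqI_degree_lead_coeff[where A = "x ` {..<n}" and n = n])
    have degp: "degree (\<Prod>k<n. [:- x k, 1:]) = n"
      by (subst degree_prod_eq_sum_degree) auto
    have "lead_coeff (\<Prod>k<n. [:- x k, 1:]) = 1"
      by (simp add: lead_coeff_prod)
    then have l1: "coeff (\<Prod>k<n. [:- x k, 1:]) n = 1" by (simp only: degp)
    have "coeff q n = cofactor (A 0) n n * coeff (p n) n"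
    proof -
      have "coeff q n = (\<Sum>i<n. cofactor (A 0) n i * coeff (p i) n) + cofactor (A 0) n n * coeff (p n) n"
        by (simp add: q_def coeff_sum)
      also have "(\<Sum>i<n. cofactor (A 0) n i * coeff (p i) n) = 0"
      proof (intro sum.neutral ballI)
        fix i assume "i \<in> {..<n}"
        then have "degree (p i) < n" using deg[of i] by simp
        then show "cofactor (A 0) n i * coeff (p i) n = 0" by (simp add: coeff_eq_0)
      qed
      finally show ?thesis by simp
    qed
    then show "coeff q n = coeff (Polynomial.smult ?c (\<Prod>k<n. [:- x k, 1:])) n"
      by (simp add: l1 lead)
    show "n \<le> card (x ` {..<n})"
      using inj' by (simp add: card_image)
    show "degree q \<le> n" unfolding q_def
    proof (intro degree_sum_le)
      fix i assume "i \<in> {..<Suc n}"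
      then show "degree (Polynomial.smult (cofactor (A 0) n i) (p i)) \<le> n"
        using degree_smult_le[of "cofactor (A 0) n i" "p i"] deg[of i] by simp
    qed simp
    show "degree (Polynomial.smult ?c (\<Prod>k<n. [:- x k, 1:])) \<le> n"
      using degree_smult_le[of ?c "\<Prod>k<n. [:- x k, 1:]"] degp by simp
    fix z assume "z \<in> x ` {..<n}"
    then obtain j where j: "j < n" "z = x j" by auto
    then show "poly q z = poly (Polynomial.smult ?c (\<Prod>k<n. [:- x k, 1:])) z"
      using zero[of j] by (auto simp: poly_prod)
  qed
  have "A (x n) = Matrix.mat (Suc n) (Suc n) (\<lambda>(j, i). poly (p i) (x j))"
    by (rule eq_matI) (auto simp: A_def)
  then have "Determinant.det (Matrix.mat (Suc n) (Suc n) (\<lambda>(j, i). poly (p i) (x j))) = poly q (x n)"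
    using det_q[of "x n"] by simp
  also have "\<dots> = ?c * (\<Prod>k<n. x n - x k)"
    by (simp add: q_eq poly_prod)
  finally show ?case by (simp add: mult_ac)
qed

definition slater :: "(nat \<Rightarrow> 'a \<Rightarrow> complex) \<Rightarrow> nat \<Rightarrow> (nat \<Rightarrow> 'a) \<Rightarrow> complex" where
  "slater \<phi> N x = Determinant.det (Matrix.mat N N (\<lambda>(j, i). \<phi> i (x j)))"

text \<open>
  The value at \<open>j\<close> is forced, being the only element that the other values miss. This is why testing one
  coordinate against an arbitrary set still kills all terms off the diagonal in the expansion below.
\<close>
lemma permutes_eq_if_agree_elsewhere:
  fixes \<sigma> \<tau> :: "nat \<Rightarrow> nat"
  assumes "\<sigma> permutes {..<N}" "\<tau> permutes {..<N}" "\<And>i. i < N \<Longrightarrow> i \<noteq> j \<Longrightarrow> \<sigma> i = \<tau> i"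
  shows "\<sigma> = \<tau>"
proof
  fix i
  consider "i \<ge> N" | "i < N" "i \<noteq> j" | "i < N" "i = j" by linarith
  then show "\<sigma> i = \<tau> i"
  proof cases
    case 1
    then show ?thesis using assms by (simp add: permutes_def)
  next
    case 2
    then show ?thesis using assms by auto
  next
    case 3
    have "\<sigma> ` {..<N} = {..<N}" "\<tau> ` {..<N} = {..<N}" using assms by (auto simp: permutes_image)
    moreover have "\<sigma> ` ({..<N} - {j}) = \<tau> ` ({..<N} - {j})" using assms(3) by (auto simp: image_iff)
    moreover have "\<sigma> ` ({..<N} - {j}) = \<sigma> ` {..<N} - {\<sigma> j}" "\<tau> ` ({..<N} - {j}) = \<tau> ` {..<N} - {\<tau> j}"
      using assms(1,2) 3 by (auto simp: image_set_diff permutes_inj)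
    ultimately have "{..<N} - {\<sigma> j} = {..<N} - {\<tau> j}" by simp
    moreover have "\<sigma> j < N" "\<tau> j < N" using assms 3 by (metis lessThan_iff permutes_in_image)+
    ultimately show ?thesis using 3 by blast
  qed
qed

text \<open>
  A determinant of orthonormal functions: all integrals of its squared modulus against
  functions of single coordinates reduce to one-dimensional integrals.
\<close>
context
  fixes M :: "'a measure" and \<phi> :: "nat \<Rightarrow> 'a \<Rightarrow> complex" and N :: nat
  assumes sf: "sigma_finite_measure M"
    and int: "\<And>m n. m < N \<Longrightarrow> n < N \<Longrightarrow> integrable M (\<lambda>x. \<phi> m x * cnj (\<phi> n x))"
    and orth: "\<And>m n. m < N \<Longrightarrow> n < N \<Longrightarrow> (LINT x|M. \<phi> m x * cnj (\<phi> n x)) = of_bool (m = n)"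
begin

lemma norm_slater_sq:
  "complex_of_real ((cmod (slater \<phi> N x))\<^sup>2) = (\<Sum>\<sigma> | \<sigma> permutes {..<N}. \<Sum>\<tau> | \<tau> permutes {..<N}.
      of_int (sign \<sigma>) * of_int (sign \<tau>) * (\<Prod>j<N. \<phi> (\<sigma> j) (x j) * cnj (\<phi> (\<tau> j) (x j))))"
proof -
  have D: "slater \<phi> N x = (\<Sum>\<sigma> | \<sigma> permutes {..<N}. of_int (sign \<sigma>) * (\<Prod>j<N. \<phi> (\<sigma> j) (x j)))"
    unfolding slater_def Determinant.det_def
    by (auto simp: lessThan_atLeast0 permutes_in_image intro!: sum.cong prod.cong)
  have "complex_of_real ((cmod (slater \<phi> N x))\<^sup>2) = slater \<phi> N x * cnj (slater \<phi> N x)"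
    by (metis complex_norm_square)
  also have "\<dots> = (\<Sum>\<sigma> | \<sigma> permutes {..<N}. \<Sum>\<tau> | \<tau> permutes {..<N}.
      (of_int (sign \<sigma>) * (\<Prod>j<N. \<phi> (\<sigma> j) (x j))) * (of_int (sign \<tau>) * (\<Prod>j<N. cnj (\<phi> (\<tau> j) (x j)))))"
    unfolding D by (simp add: sum_product cnj_sum cnj_prod)
  also have "\<dots> = (\<Sum>\<sigma> | \<sigma> permutes {..<N}. \<Sum>\<tau> | \<tau> permutes {..<N}.
      of_int (sign \<sigma>) * of_int (sign \<tau>) * (\<Prod>j<N. \<phi> (\<sigma> j) (x j) * cnj (\<phi> (\<tau> j) (x j))))"
    by (simp add: prod.distrib mult_ac)
  finally show ?thesis .
qed

text \<open>
  After both determinants are expanded, each term is a product of functions of single coordinates, so that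
  Fubini's theorem applies term by term. The test functions \<open>g j\<close> are bounded only in order to
  inherit integrability from the orthonormality relations.
\<close>
lemma slater_weighted_integral:
  assumes g: "\<And>i. i < N \<Longrightarrow> g i \<in> borel_measurable M" "\<And>i x. \<bar>g i x :: real\<bar> \<le> 1"
  shows "integrable (PiM {..<N} (\<lambda>_. M)) (\<lambda>x. complex_of_real ((\<Prod>j<N. g j (x j)) * (cmod (slater \<phi> N x))\<^sup>2))" (is ?I)
    and "(LINT x|PiM {..<N} (\<lambda>_. M). complex_of_real ((\<Prod>j<N. g j (x j)) * (cmod (slater \<phi> N x))\<^sup>2)) =
     (\<Sum>\<sigma> | \<sigma> permutes {..<N}. \<Sum>\<tau> | \<tau> permutes {..<N}. of_int (sign \<sigma>) * of_int (sign \<tau>) *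
        (\<Prod>j<N. LINT x|M. g j x * (\<phi> (\<sigma> j) x * cnj (\<phi> (\<tau> j) x))))" (is ?E)
proof -
  interpret product_sigma_finite "\<lambda>_. M"
    using sf by (simp add: product_sigma_finite_def)
  have ii: "integrable M (\<lambda>x. g j x * (\<phi> (\<sigma> j) x * cnj (\<phi> (\<tau> j) x)))"
    if "\<sigma> permutes {..<N}" "\<tau> permutes {..<N}" "j < N" for \<sigma> \<tau> j
  proof (rule Bochner_Integration.integrable_bound[OF int[of "\<sigma> j" "\<tau> j"]])
    have *: "\<sigma> j < N" "\<tau> j < N" using that by (metis lessThan_iff permutes_in_image)+
    then show "\<sigma> j < N" "\<tau> j < N" .
    show "(\<lambda>x. g j x * (\<phi> (\<sigma> j) x * cnj (\<phi> (\<tau> j) x))) \<in> borel_measurable M"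
      using borel_measurable_integrable[OF int[OF *]] g(1)[OF that(3)] by measurable
    show "AE x in M. norm (g j x * (\<phi> (\<sigma> j) x * cnj (\<phi> (\<tau> j) x))) \<le> norm (\<phi> (\<sigma> j) x * cnj (\<phi> (\<tau> j) x))"
      using g(2)[of j] by (intro AE_I2) (simp add: norm_mult mult_left_le_one_le)
  qed
  have eq: "complex_of_real ((\<Prod>j<N. g j (x j)) * (cmod (slater \<phi> N x))\<^sup>2) =
    (\<Sum>\<sigma> | \<sigma> permutes {..<N}. \<Sum>\<tau> | \<tau> permutes {..<N}. of_int (sign \<sigma>) * of_int (sign \<tau>) *
        (\<Prod>j<N. g j (x j) * (\<phi> (\<sigma> j) (x j) * cnj (\<phi> (\<tau> j) (x j)))))" for x
    unfolding of_real_mult norm_slater_sq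
    by (simp add: sum_distrib_left prod.distrib mult_ac)
  have ii2: "integrable (PiM {..<N} (\<lambda>_. M)) (\<lambda>x. of_int (sign \<sigma>) * of_int (sign \<tau>) *
        (\<Prod>j<N. g j (x j) * (\<phi> (\<sigma> j) (x j) * cnj (\<phi> (\<tau> j) (x j)))))"
    if "\<sigma> permutes {..<N}" "\<tau> permutes {..<N}" for \<sigma> \<tau>
    by (intro integrable_mult_right product_integrable_prod) (use ii[OF that] in auto)
  show ?I unfolding eq by (intro Bochner_Integration.integrable_sum ii2) auto
  have "(LINT x|PiM {..<N} (\<lambda>_. M). complex_of_real ((\<Prod>j<N. g j (x j)) * (cmod (slater \<phi> N x))\<^sup>2)) =
     (\<Sum>\<sigma> | \<sigma> permutes {..<N}. \<Sum>\<tau> | \<tau> permutes {..<N}. LINT x|PiM {..<N} (\<lambda>_. M). of_int (sign \<sigma>) * of_int (sign \<tau>) *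
        (\<Prod>j<N. g j (x j) * (\<phi> (\<sigma> j) (x j) * cnj (\<phi> (\<tau> j) (x j)))))"
    unfolding eq
    by (subst Bochner_Integration.integral_sum, (intro Bochner_Integration.integrable_sum ii2; simp),
        intro sum.cong refl Bochner_Integration.integral_sum ii2) auto
  also have "\<dots> = (\<Sum>\<sigma> | \<sigma> permutes {..<N}. \<Sum>\<tau> | \<tau> permutes {..<N}. of_int (sign \<sigma>) * of_int (sign \<tau>) *
        (\<Prod>j<N. LINT x|M. g j x * (\<phi> (\<sigma> j) x * cnj (\<phi> (\<tau> j) x))))"
    by (intro sum.cong refl, subst integral_mult_right_zero, subst product_integral_prod) (use ii in auto)
  finally show ?E .
qed

lemma slater_norm: "(LINT x|PiM {..<N} (\<lambda>_. M). (cmod (slater \<phi> N x))\<^sup>2) = fact N"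
  and slater_integrable: "integrable (PiM {..<N} (\<lambda>_. M)) (\<lambda>x. (cmod (slater \<phi> N x))\<^sup>2)"
proof -
  note * = slater_weighted_integral[of "\<lambda>_ _. 1", simplified]
  have I: "integrable (PiM {..<N} (\<lambda>_. M)) (\<lambda>x. complex_of_real ((cmod (slater \<phi> N x))\<^sup>2))"
    using *(1) by simp
  then show "integrable (PiM {..<N} (\<lambda>_. M)) (\<lambda>x. (cmod (slater \<phi> N x))\<^sup>2)"
    by (simp only: complex_of_real_integrable_eq)
  have "complex_of_real (LINT x|PiM {..<N} (\<lambda>_. M). (cmod (slater \<phi> N x))\<^sup>2) =
     (LINT x|PiM {..<N} (\<lambda>_. M). complex_of_real ((cmod (slater \<phi> N x))\<^sup>2))" by (rule integral_complex_of_real[symmetric])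
  also have "\<dots> = (\<Sum>\<sigma> | \<sigma> permutes {..<N}. \<Sum>\<tau> | \<tau> permutes {..<N}. of_int (sign \<sigma>) * of_int (sign \<tau>) *
        (\<Prod>j<N. LINT x|M. (\<phi> (\<sigma> j) x * cnj (\<phi> (\<tau> j) x))))" using *(2) by simp
  also have "\<dots> = (\<Sum>\<sigma> | \<sigma> permutes {..<N}. \<Sum>\<tau> | \<tau> permutes {..<N}. of_bool (\<sigma> = \<tau>))"
  proof (intro sum.cong refl, clarify)
    fix \<sigma> \<tau> assume p: "\<sigma> permutes {..<N}" "\<tau> permutes {..<N}"
    have lt: "\<sigma> j < N" "\<tau> j < N" if "j < N" for j using that p by (metis lessThan_iff permutes_in_image)+
    have "(\<Prod>j<N. LINT x|M. (\<phi> (\<sigma> j) x * cnj (\<phi> (\<tau> j) x))) = (\<Prod>j<N. of_bool (\<sigma> j = \<tau> j))"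
      by (intro prod.cong refl orth) (use lt in auto)
    also have "\<dots> = of_bool (\<sigma> = \<tau>)"
      using permutes_eq_if_agree_elsewhere[OF p, of N] by (cases "\<sigma> = \<tau>") auto
    finally show "of_int (sign \<sigma>) * of_int (sign \<tau>) * (\<Prod>j<N. LINT x|M. (\<phi> (\<sigma> j) x * cnj (\<phi> (\<tau> j) x))) = (of_bool (\<sigma> = \<tau>) :: complex)"
      by (auto simp flip: of_int_mult)
  qed
  also have "\<dots> = of_nat (card {\<sigma>. \<sigma> permutes {..<N}})"
    by (simp add: of_bool_def sum.delta finite_permutations)
  also have "\<dots> = complex_of_real (fact N)"
    by (simp add: card_permutations)
  finally show "(LINT x|PiM {..<N} (\<lambda>_. M). (cmod (slater \<phi> N x))\<^sup>2) = fact N" by (simp only: of_real_eq_iff)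
qed

text \<open>
  For each \<open>j\<close> only the diagonal terms \<open>\<sigma> = \<tau>\<close> survive, with the value \<open>c (\<sigma> j)\<close>; summing over \<open>j\<close> first
  replaces \<open>\<sigma> j\<close> by all indices \<open>k\<close>, whatever \<open>\<sigma>\<close> is.
\<close>
lemma slater_count:
  assumes B: "B \<in> sets M"
  shows "(LINT x|PiM {..<N} (\<lambda>_. M). real (card {j\<in>{..<N}. x j \<in> B}) * (cmod (slater \<phi> N x))\<^sup>2) =
     fact N * (\<Sum>k<N. LINT x|M. indicator B x * (cmod (\<phi> k x))\<^sup>2)"
proof -
  define g where "g = (\<lambda>(j::nat) i x. if i = j then indicator B x else (1::real))"
  define c where "c = (\<lambda>k. LINT x|M. indicator B x * (cmod (\<phi> k x))\<^sup>2)"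
  have g: "g j i \<in> borel_measurable M" "\<bar>g j i x\<bar> \<le> 1" for i j x using B by (auto simp: g_def indicator_def)
  have g_prod: "(\<Prod>i<N. g j i (x i)) = indicator B (x j)" if "j < N" for j x
    using that by (simp add: g_def prod.delta)
  note * = slater_weighted_integral[of "g j" for j, OF g]
  have I: "integrable (PiM {..<N} (\<lambda>_. M)) (\<lambda>x. indicator B (x j) * (cmod (slater \<phi> N x))\<^sup>2)" if "j < N" for j
    using *(1)[of j] that by (simp only: complex_of_real_integrable_eq g_prod)
  have E: "(LINT x|PiM {..<N} (\<lambda>_. M). indicator B (x j) * (cmod (slater \<phi> N x))\<^sup>2) = (\<Sum>\<sigma> | \<sigma> permutes {..<N}. c (\<sigma> j))"
    if j: "j < N" for j
  proof -
    have "complex_of_real (LINT x|PiM {..<N} (\<lambda>_. M). indicator B (x j) * (cmod (slater \<phi> N x))\<^sup>2) =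
     (LINT x|PiM {..<N} (\<lambda>_. M). complex_of_real (indicator B (x j) * (cmod (slater \<phi> N x))\<^sup>2))"
      by (rule integral_complex_of_real[symmetric])
    also have "\<dots> = (\<Sum>\<sigma> | \<sigma> permutes {..<N}. \<Sum>\<tau> | \<tau> permutes {..<N}. of_int (sign \<sigma>) * of_int (sign \<tau>) *
        (\<Prod>i<N. LINT x|M. g j i x * (\<phi> (\<sigma> i) x * cnj (\<phi> (\<tau> i) x))))" using *(2)[of j] j by (simp only: g_prod)
    also have "\<dots> = (\<Sum>\<sigma> | \<sigma> permutes {..<N}. \<Sum>\<tau> | \<tau> permutes {..<N}. of_bool (\<sigma> = \<tau>) * complex_of_real (c (\<sigma> j)))"
    proof (intro sum.cong refl, clarify)
      fix \<sigma> \<tau> assume p: "\<sigma> permutes {..<N}" "\<tau> permutes {..<N}"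
      have lt: "\<sigma> j < N" "\<tau> j < N" if "j < N" for j using that p by (metis lessThan_iff permutes_in_image)+
      have "(\<Prod>i<N. LINT x|M. g j i x * (\<phi> (\<sigma> i) x * cnj (\<phi> (\<tau> i) x)))
         = (LINT x|M. g j j x * (\<phi> (\<sigma> j) x * cnj (\<phi> (\<tau> j) x))) *
           (\<Prod>i\<in>{..<N}-{j}. LINT x|M. g j i x * (\<phi> (\<sigma> i) x * cnj (\<phi> (\<tau> i) x)))"
        using j by (simp add: prod.remove)
      also have "(\<Prod>i\<in>{..<N}-{j}. LINT x|M. g j i x * (\<phi> (\<sigma> i) x * cnj (\<phi> (\<tau> i) x))) = (\<Prod>i\<in>{..<N}-{j}. of_bool (\<sigma> i = \<tau> i))"
        by (intro prod.cong refl) (use lt orth in \<open>auto simp: g_def\<close>)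
      also have "\<dots> = of_bool (\<sigma> = \<tau>)"
        using permutes_eq_if_agree_elsewhere[OF p, of j] by (cases "\<sigma> = \<tau>") auto
      finally have e: "(\<Prod>i<N. LINT x|M. g j i x * (\<phi> (\<sigma> i) x * cnj (\<phi> (\<tau> i) x))) =
         (LINT x|M. g j j x * (\<phi> (\<sigma> j) x * cnj (\<phi> (\<tau> j) x))) * of_bool (\<sigma> = \<tau>)" .
      have "(LINT x|M. g j j x * (\<phi> (\<sigma> j) x * cnj (\<phi> (\<sigma> j) x))) = (LINT x|M. complex_of_real (indicator B x * (cmod (\<phi> (\<sigma> j) x))\<^sup>2))"
        by (intro Bochner_Integration.integral_cong refl) (simp add: g_def complex_norm_square del: of_real_power)
      also have "\<dots> = complex_of_real (c (\<sigma> j))" unfolding c_def by (rule integral_complex_of_real)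
      finally show "of_int (sign \<sigma>) * of_int (sign \<tau>) * (\<Prod>i<N. LINT x|M. g j i x * (\<phi> (\<sigma> i) x * cnj (\<phi> (\<tau> i) x)))
         = of_bool (\<sigma> = \<tau>) * complex_of_real (c (\<sigma> j))"
        unfolding e by (cases "\<sigma> = \<tau>") (auto simp flip: of_int_mult)
    qed
    also have "\<dots> = complex_of_real (\<Sum>\<sigma> | \<sigma> permutes {..<N}. c (\<sigma> j))"
      by (simp add: of_bool_def sum.delta finite_permutations if_distrib if_distribR cong: if_cong)
    finally show ?thesis by (simp only: of_real_eq_iff)
  qed
  have card_eq: "real (card {j\<in>{..<N}. x j \<in> B}) = (\<Sum>j<N. indicator B (x j))" for x
    by (simp add: indicator_def sum.If_cases Int_def)
  have "(LINT x|PiM {..<N} (\<lambda>_. M). real (card {j\<in>{..<N}. x j \<in> B}) * (cmod (slater \<phi> N x))\<^sup>2)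
     = (\<Sum>j<N. LINT x|PiM {..<N} (\<lambda>_. M). indicator B (x j) * (cmod (slater \<phi> N x))\<^sup>2)"
    unfolding card_eq sum_distrib_right
    by (intro Bochner_Integration.integral_sum I) auto
  also have "\<dots> = (\<Sum>j<N. \<Sum>\<sigma> | \<sigma> permutes {..<N}. c (\<sigma> j))" by (intro sum.cong refl E) auto
  also have "\<dots> = (\<Sum>\<sigma> | \<sigma> permutes {..<N}. \<Sum>j<N. c (\<sigma> j))" by (rule sum.swap)
  also have "\<dots> = (\<Sum>\<sigma> | \<sigma> permutes {..<N}. \<Sum>k<N. c k)"
    by (intro sum.cong refl sum.reindex_bij_betw) (auto simp: permutes_imp_bij)
  also have "\<dots> = fact N * (\<Sum>k<N. c k)" by (simp add: card_permutations)
  finally show ?thesis by (simp add: c_def)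
qed

end

lemma sum_off_diagonal_symmetric:
  fixes g :: "nat \<Rightarrow> nat \<Rightarrow> real"
  assumes "\<And>j k. g j k = g k j"
  shows "(\<Sum>j<N. \<Sum>k\<in>{..<N} - {j}. g j k) = 2 * (\<Sum>j<N. \<Sum>k<j. g j k)"
proof (induction N)
  case (Suc N)
  have "(\<Sum>j<Suc N. \<Sum>k\<in>{..<Suc N} - {j}. g j k) = (\<Sum>j<N. \<Sum>k\<in>{..<Suc N} - {j}. g j k) + (\<Sum>k<N. g N k)"
    by (simp add: lessThan_Suc)
  also have "(\<Sum>j<N. \<Sum>k\<in>{..<Suc N} - {j}. g j k) = (\<Sum>j<N. (\<Sum>k\<in>{..<N} - {j}. g j k) + g N j)"
  proof (intro sum.cong refl)
    fix j assume "j \<in> {..<N}"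
    then have "{..<Suc N} - {j} = insert N ({..<N} - {j})" by auto
    then show "(\<Sum>k\<in>{..<Suc N} - {j}. g j k) = (\<Sum>k\<in>{..<N} - {j}. g j k) + g N j"
      by (simp add: assms[of j N])
  qed
  finally show ?case by (simp add: sum.distrib Suc.IH)
qed simp

text \<open>
  For points in general position. If two points coincide the two sides differ: the right-hand side is 0, but
  the logarithm of 0 is 0 by convention.
\<close>
lemma exp_neg_energy:
  assumes "inj_on \<zeta> {..<N}"
  shows "exp (- energy N Q \<zeta>) =
    (\<Prod>j<N. \<Prod>k<j. cmod (\<zeta> j - \<zeta> k))\<^sup>2 * (\<Prod>j<N. exp (- real N * Q (\<zeta> j)))"
proof -
  have pos: "cmod (\<zeta> j - \<zeta> k) > 0" if "j < N" "k < j" for j k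
    using inj_onD[OF assms, of j k] that by auto
  have "- energy N Q \<zeta> = (\<Sum>j<N. \<Sum>k\<in>{..<N} - {j}. ln (cmod (\<zeta> j - \<zeta> k))) + (\<Sum>j<N. - real N * Q (\<zeta> j))"
    by (simp add: energy_def ln_div ln_inverse inverse_eq_divide[symmetric] sum_negf sum_distrib_left)
  also have "(\<Sum>j<N. \<Sum>k\<in>{..<N} - {j}. ln (cmod (\<zeta> j - \<zeta> k))) = 2 * (\<Sum>j<N. \<Sum>k<j. ln (cmod (\<zeta> j - \<zeta> k)))"
    by (rule sum_off_diagonal_symmetric) (simp add: norm_minus_commute)
  finally have "exp (- energy N Q \<zeta>) = exp (\<Sum>j<N. \<Sum>k<j. ln (cmod (\<zeta> j - \<zeta> k))) ^ 2 * exp (\<Sum>j<N. - real N * Q (\<zeta> j))"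
    by (simp only: exp_add exp_double)
  also have "exp (\<Sum>j<N. \<Sum>k<j. ln (cmod (\<zeta> j - \<zeta> k))) = (\<Prod>j<N. \<Prod>k<j. cmod (\<zeta> j - \<zeta> k))"
    using pos by (simp add: exp_sum)
  also have "exp (\<Sum>j<N. - real N * Q (\<zeta> j)) = (\<Prod>j<N. exp (- real N * Q (\<zeta> j)))"
    by (simp add: exp_sum)
  finally show ?thesis .
qed

lemma sigma_finite_area: "sigma_finite_measure area_measure"
  unfolding area_measure_def by (subst sigma_finite_measure.sigma_finite_iff_density_finite[OF sigma_finite_lborel]) auto

lemma sets_area[measurable_cong, simp]: "sets area_measure = sets borel"
  and space_area[simp]: "space area_measure = UNIV"
  by (simp_all add: area_measure_def)

lemma integral_area:
  fixes f :: "complex \<Rightarrow> 'b::{banach,second_countable_topology}"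
  assumes "f \<in> borel_measurable borel"
  shows "integral\<^sup>L area_measure f = (LINT x|lborel. f x) /\<^sub>R pi"
  using assms unfolding area_measure_def by (subst integral_density) (auto simp: inverse_eq_divide)

lemma integrable_area:
  fixes f :: "complex \<Rightarrow> 'b::{banach,second_countable_topology}"
  assumes "f \<in> borel_measurable borel"
  shows "integrable area_measure f \<longleftrightarrow> integrable lborel f"
proof -
  have "integrable lborel f" if "integrable lborel (\<lambda>x. (1 / pi) *\<^sub>R f x)"
    using integrable_scaleR_right[OF that, of pi] by simp
  then show ?thesis
    using assms unfolding area_measure_def by (subst integrable_density) auto
qed

lemma emeasure_area: "A \<in> sets borel \<Longrightarrow> emeasure area_measure A = ennreal (1 / pi) * emeasure lborel A"
  unfolding area_measure_def by (subst emeasure_density) (auto simp: nn_integral_cmult)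

lemma emeasure_area_ball:
  assumes "r \<ge> 0" shows "emeasure area_measure (ball z r) = ennreal (r\<^sup>2)"
  using assms by (simp add: emeasure_area emeasure_ball unit_ball_vol_2 flip: ennreal_mult)

text \<open>
  Integrating out the coordinate \<open>j\<close> first, the set where it equals the coordinate \<open>k\<close> is a point.
\<close>
lemma AE_distinct: "AE \<zeta> in config_measure N. inj_on \<zeta> {..<N}"
proof -
  interpret product_sigma_finite "\<lambda>_. area_measure"
    using sigma_finite_area by (simp add: product_sigma_finite_def)
  have "AE \<zeta> in config_measure N. \<zeta> j \<noteq> \<zeta> k" if jk: "j < N" "k < N" "j \<noteq> k" for j k
  proof -
    let ?I = "{..<N} - {j}"
    have ins: "insert j ?I = {..<N}" using jk by auto
    have mj: "(\<lambda>\<zeta>. \<zeta> i) \<in> borel_measurable (PiM {..<N} (\<lambda>_. area_measure))" if "i < N" for i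
      using measurable_component_singleton[of i "{..<N}" "\<lambda>_. area_measure"] that by (simp cong: measurable_cong_sets)
    have S: "{\<zeta> \<in> space (PiM {..<N} (\<lambda>_. area_measure)). \<zeta> j = \<zeta> k} \<in> sets (PiM {..<N} (\<lambda>_. area_measure))"
      using mj[of j] mj[of k] jk by measurable
    have "(\<integral>\<^sup>+\<zeta>. indicator {\<zeta> \<in> space (PiM {..<N} (\<lambda>_. area_measure)). \<zeta> j = \<zeta> k} \<zeta> \<partial>PiM {..<N} (\<lambda>_. area_measure)) =
      (\<integral>\<^sup>+\<zeta>. (\<integral>\<^sup>+y. indicator {\<zeta> \<in> space (PiM {..<N} (\<lambda>_. area_measure)). \<zeta> j = \<zeta> k} (\<zeta>(j := y)) \<partial>area_measure) \<partial>PiM ?I (\<lambda>_. area_measure))"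
      using product_nn_integral_insert[of ?I j "indicator {\<zeta> \<in> space (PiM {..<N} (\<lambda>_. area_measure)). \<zeta> j = \<zeta> k}"] S
      unfolding ins by simp
    also have "\<dots> \<le> (\<integral>\<^sup>+\<zeta>. (\<integral>\<^sup>+y. indicator {\<zeta> k} y \<partial>area_measure) \<partial>PiM ?I (\<lambda>_. area_measure))"
      using jk by (intro nn_integral_mono) (auto simp: indicator_def)
    also have "\<dots> = 0"
      by (simp add: emeasure_area)
    finally have "emeasure (PiM {..<N} (\<lambda>_. area_measure)) {\<zeta> \<in> space (PiM {..<N} (\<lambda>_. area_measure)). \<zeta> j = \<zeta> k} = 0"
      using S by simp
    then show ?thesis using S unfolding config_measure_def by (subst AE_iff_measurable[OF S]) auto
  qed
  then have "AE \<zeta> in config_measure N. \<forall>j\<in>{..<N}. \<forall>k\<in>{..<N}. j \<noteq> k \<longrightarrow> \<zeta> j \<noteq> \<zeta> k"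
    by (intro AE_finite_allI AE_impI) auto
  then show ?thesis by eventually_elim (auto simp: inj_on_def)
qed

lemma measurable_energy:
  assumes [measurable]: "Q \<in> borel_measurable borel"
  shows "energy N Q \<in> borel_measurable (config_measure N)"
proof -
  have mj: "(\<lambda>\<zeta>. \<zeta> i) \<in> borel_measurable (config_measure N)" if "i < N" for i
    using measurable_component_singleton[of i "{..<N}" "\<lambda>_. area_measure"] that
    by (simp add: config_measure_def cong: measurable_cong_sets)
  have m1: "(\<lambda>\<zeta>. ln (1 / cmod (\<zeta> j - \<zeta> k))) \<in> borel_measurable (config_measure N)" if "j < N" "k < N" for j k
    using mj[OF that(1)] mj[OF that(2)] by measurable
  have m2: "(\<lambda>\<zeta>. Q (\<zeta> j)) \<in> borel_measurable (config_measure N)" if "j < N" for j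
    using measurable_compose[OF mj[OF that] assms] .
  show ?thesis unfolding energy_def
    by (intro borel_measurable_add borel_measurable_sum borel_measurable_times borel_measurable_const m1 m2) auto
qed

lemma ball_average_tendsto:
  fixes \<rho> :: "complex \<Rightarrow> real"
  assumes int: "integrable area_measure \<rho>" and cont: "isCont \<rho> z"
  shows "((\<lambda>\<epsilon>. (LINT x|area_measure. indicator (ball z \<epsilon>) x * \<rho> x) / \<epsilon>\<^sup>2) \<longlongrightarrow> \<rho> z) (at_right 0)"
proof (rule tendstoI)
  fix e :: real assume "e > 0"
  then obtain d where d: "d > 0" "\<And>x. dist x z < d \<Longrightarrow> dist (\<rho> x) (\<rho> z) < e / 2"
    using cont[unfolded continuous_at_eps_delta, rule_format, of "e / 2"] by auto
  have "eventually (\<lambda>\<epsilon>. \<epsilon> \<in> {0<..<d}) (at_right 0)"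
    using d(1) by (rule eventually_at_right_real)
  then show "\<forall>\<^sub>F \<epsilon> in at_right 0. dist ((LINT x|area_measure. indicator (ball z \<epsilon>) x * \<rho> x) / \<epsilon>\<^sup>2) (\<rho> z) < e"
  proof eventually_elim
    fix \<epsilon> :: real assume \<epsilon>: "\<epsilon> \<in> {0<..<d}"
    have fin: "emeasure area_measure (ball z \<epsilon>) = ennreal (\<epsilon>\<^sup>2)" using \<epsilon> by (intro emeasure_area_ball) auto
    have m: "measure area_measure (ball z \<epsilon>) = \<epsilon>\<^sup>2" by (simp add: measure_def fin)
    have i0: "integrable area_measure (indicat_real (ball z \<epsilon>))"
      by (rule integrable_real_indicator) (auto simp: fin)
    have i1: "integrable area_measure (\<lambda>x. indicator (ball z \<epsilon>) x * \<rho> x)"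
      using integrable_mult_indicator[OF _ int, of "ball z \<epsilon>"] by simp
    have "(LINT x|area_measure. indicator (ball z \<epsilon>) x * \<rho> x) - \<epsilon>\<^sup>2 * \<rho> z
        = (LINT x|area_measure. indicator (ball z \<epsilon>) x * \<rho> x) - (LINT x|area_measure. indicator (ball z \<epsilon>) x * \<rho> z)"
      by (simp add: m)
    also have "\<dots> = (LINT x|area_measure. indicator (ball z \<epsilon>) x * \<rho> x - indicator (ball z \<epsilon>) x * \<rho> z)"
      using i0 i1 by (intro Bochner_Integration.integral_diff[symmetric]) auto
    also have "\<bar>\<dots>\<bar> \<le> (LINT x|area_measure. indicator (ball z \<epsilon>) x * (e / 2))"
      unfolding real_norm_def[symmetric]
    proof (rule Bochner_Integration.integral_norm_bound_integral)
      fix x assume "x \<in> space area_measure"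
      show "norm (indicator (ball z \<epsilon>) x * \<rho> x - indicator (ball z \<epsilon>) x * \<rho> z) \<le> indicator (ball z \<epsilon>) x * (e / 2)"
        using d(2)[of x] \<epsilon> by (auto simp: indicator_def dist_real_def dist_commute)
    qed (use i0 i1 in auto)
    also have "\<dots> = \<epsilon>\<^sup>2 * (e / 2)" by (simp add: m)
    finally have "\<bar>(LINT x|area_measure. indicator (ball z \<epsilon>) x * \<rho> x) - \<epsilon>\<^sup>2 * \<rho> z\<bar> / \<epsilon>\<^sup>2 \<le> e / 2"
      using \<epsilon> by (simp add: field_simps)
    moreover have "(LINT x|area_measure. indicator (ball z \<epsilon>) x * \<rho> x) / \<epsilon>\<^sup>2 - \<rho> z
        = ((LINT x|area_measure. indicator (ball z \<epsilon>) x * \<rho> x) - \<epsilon>\<^sup>2 * \<rho> z) / \<epsilon>\<^sup>2"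
      using \<epsilon> by (simp add: diff_divide_distrib)
    ultimately have "\<bar>(LINT x|area_measure. indicator (ball z \<epsilon>) x * \<rho> x) / \<epsilon>\<^sup>2 - \<rho> z\<bar> \<le> e / 2"
      by (simp only: abs_divide abs_power2)
    then show "dist ((LINT x|area_measure. indicator (ball z \<epsilon>) x * \<rho> x) / \<epsilon>\<^sup>2) (\<rho> z) < e"
      using \<open>e > 0\<close> by (simp add: dist_real_def)
  qed
qed

text \<open>
  The squared Slater determinant of the functions \<open>sqrt w * p\<^sub>n\<close> is the Gibbs weight up to the squared leading
  coefficients, hence integrating it gives the partition function, and \<open>slater_count\<close> gives the mean number of
  particles in a small disc as the integral of a density that is continuous at \<open>z\<close>.
\<close>
theorem one_point_function_orthonormal:
  fixes p :: "nat \<Rightarrow> complex poly"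
  assumes Q[measurable]: "Q \<in> borel_measurable borel" and cont: "isCont Q z"
    and deg: "\<And>i. degree (p i) \<le> i" and lead: "\<And>i. coeff (p i) i \<noteq> 0"
    and int: "\<And>m n. integrable area_measure (\<lambda>x. exp (- real N * Q x) * (poly (p m) x * cnj (poly (p n) x)))"
    and orth: "\<And>m n. (LINT x|area_measure. exp (- real N * Q x) * (poly (p m) x * cnj (poly (p n) x))) = of_bool (m = n)"
  shows "one_point_function N Q z = exp (- real N * Q z) * (\<Sum>k<N. (cmod (poly (p k) z))\<^sup>2)"
proof -
  define \<phi> where "\<phi> = (\<lambda>i x. complex_of_real (sqrt (exp (- real N * Q x))) * poly (p i) x)"
  have pmeas [measurable]: "poly (p i) \<in> borel_measurable borel" for i
    by (intro borel_measurable_continuous_onI continuous_intros)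
  have \<phi>\<phi>: "\<phi> m x * cnj (\<phi> n x) = exp (- real N * Q x) * (poly (p m) x * cnj (poly (p n) x))" for m n x
  proof -
    have "complex_of_real (sqrt (exp (- real N * Q x))) * complex_of_real (sqrt (exp (- real N * Q x))) = complex_of_real (exp (- real N * Q x))"
      by (simp only: of_real_mult[symmetric] real_sqrt_mult_self abs_exp_cancel)
    then show ?thesis unfolding \<phi>_def by (simp add: mult_ac)
  qed
  have hi: "integrable area_measure (\<lambda>x. \<phi> m x * cnj (\<phi> n x))" for m n
    using int[of m n] by (simp only: \<phi>\<phi>)
  have ho: "(LINT x|area_measure. \<phi> m x * cnj (\<phi> n x)) = of_bool (m = n)" for m n
    using orth[of m n] by (simp only: \<phi>\<phi>)
  note slater_int = slater_integrable[OF sigma_finite_area hi ho, where N = N, folded config_measure_def]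
    and slater_one = slater_norm[OF sigma_finite_area hi ho, where N = N, folded config_measure_def]
    and slater_cnt = slater_count[OF sigma_finite_area hi ho, where N = N, folded config_measure_def]
  define C where "C = (\<Prod>j<N. (cmod (coeff (p j) j))\<^sup>2)"
  have C: "C > 0" using lead by (auto simp: C_def intro!: prod_pos)
  \<comment> \<open>The constant \<open>C\<close> relates the determinant of the \<open>\<phi> i\<close> to the Vandermonde product.\<close>
  have sl: "(cmod (slater \<phi> N \<zeta>))\<^sup>2 = C * exp (- energy N Q \<zeta>)" if inj: "inj_on \<zeta> {..<N}" for \<zeta>
  proof -
    have "slater \<phi> N \<zeta> = (\<Prod>j<N. complex_of_real (sqrt (exp (- real N * Q (\<zeta> j))))) *
        Determinant.det (Matrix.mat N N (\<lambda>(j, i). poly (p i) (\<zeta> j)))"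
      unfolding slater_def Determinant.det_def
      by (auto simp: \<phi>_def prod.distrib sum_distrib_left lessThan_atLeast0 mult_ac intro!: sum.cong)
    also have "\<dots> = (\<Prod>j<N. complex_of_real (sqrt (exp (- real N * Q (\<zeta> j))))) *
        (\<Prod>j<N. coeff (p j) j * (\<Prod>k<j. \<zeta> j - \<zeta> k))"
      using deg inj by (simp add: vandermonde_det)
    finally have "(cmod (slater \<phi> N \<zeta>))\<^sup>2 = (\<Prod>j<N. (sqrt (exp (- real N * Q (\<zeta> j))))\<^sup>2) *
        ((\<Prod>j<N. (cmod (coeff (p j) j))\<^sup>2) * (\<Prod>j<N. \<Prod>k<j. cmod (\<zeta> j - \<zeta> k))\<^sup>2)"
      by (simp add: norm_mult prod_norm[symmetric] power_mult_distrib prod_power_distrib prod.distrib)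
    then show ?thesis unfolding exp_neg_energy[OF inj] C_def by (simp add: mult_ac)
  qed
  have AE_sl: "AE \<zeta> in config_measure N. (cmod (slater \<phi> N \<zeta>))\<^sup>2 = C * exp (- energy N Q \<zeta>)"
    using AE_distinct[of N] by eventually_elim (rule sl)
  have [measurable]: "energy N Q \<in> borel_measurable (config_measure N)"
    by (rule measurable_energy[OF Q])
  have [measurable]: "(\<lambda>\<zeta>. (cmod (slater \<phi> N \<zeta>))\<^sup>2) \<in> borel_measurable (config_measure N)"
    using slater_int by (rule borel_measurable_integrable)
  have "partition_function N Q = (\<integral>\<^sup>+ \<zeta>. ennreal ((cmod (slater \<phi> N \<zeta>))\<^sup>2 / C) \<partial>config_measure N)"
    unfolding partition_function_def
  proof (rule nn_integral_cong_AE)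
    show "AE \<zeta> in config_measure N. ennreal (exp (- energy N Q \<zeta>)) = ennreal ((cmod (slater \<phi> N \<zeta>))\<^sup>2 / C)"
      using AE_sl by eventually_elim (use C in simp)
  qed
  also have "\<dots> = ennreal (LINT \<zeta>|config_measure N. (cmod (slater \<phi> N \<zeta>))\<^sup>2 / C)"
    using slater_int C by (intro nn_integral_eq_integral) auto
  also have "\<dots> = ennreal (fact N / C)" using slater_one by simp
  finally have Z: "partition_function N Q = ennreal (fact N / C)" .
  have gibbs: "gibbs_measure N Q = density (config_measure N) (\<lambda>\<zeta>. ennreal ((cmod (slater \<phi> N \<zeta>))\<^sup>2 / fact N))"
    unfolding gibbs_measure_def
  proof (rule density_cong)
    show "AE \<zeta> in config_measure N. ennreal (exp (- energy N Q \<zeta>)) / partition_function N Q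
             = ennreal ((cmod (slater \<phi> N \<zeta>))\<^sup>2 / fact N)"
      using AE_sl by eventually_elim (use C in \<open>simp add: Z divide_ennreal field_simps\<close>)
  qed measurable
  have coordm: "(\<lambda>\<zeta>. \<zeta> i) \<in> borel_measurable (config_measure N)" if "i < N" for i
    using measurable_component_singleton[of i "{..<N}" "\<lambda>_. area_measure"] that
    by (simp add: config_measure_def cong: measurable_cong_sets)
  define \<rho> where "\<rho> = (\<lambda>x. exp (- real N * Q x) * (\<Sum>k<N. (cmod (poly (p k) x))\<^sup>2))"
  have \<phi>n: "(cmod (\<phi> k x))\<^sup>2 = exp (- real N * Q x) * (cmod (poly (p k) x))\<^sup>2" for k x
    by (simp add: \<phi>_def norm_mult power_mult_distrib)
  have \<phi>i: "integrable area_measure (\<lambda>x. (cmod (\<phi> k x))\<^sup>2)" for k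
    using hi[of k k] unfolding complex_norm_square[symmetric] by (simp only: complex_of_real_integrable_eq)
  have \<rho>_sum: "\<rho> x = (\<Sum>k<N. (cmod (\<phi> k x))\<^sup>2)" for x
    by (simp only: \<rho>_def \<phi>n sum_distrib_left)
  have \<rho>i: "integrable area_measure \<rho>"
    unfolding \<rho>_sum[abs_def] using \<phi>i by (intro Bochner_Integration.integrable_sum)
  have mean: "(\<integral>\<zeta>. real (card {j \<in> {..<N}. \<zeta> j \<in> ball z \<epsilon>}) \<partial>gibbs_measure N Q) =
      (LINT x|area_measure. indicator (ball z \<epsilon>) x * \<rho> x)" for \<epsilon>
  proof -
    have card_eq: "real (card {j\<in>{..<N}. \<zeta> j \<in> ball z \<epsilon>}) = (\<Sum>j<N. indicator (ball z \<epsilon>) (\<zeta> j))" for \<zeta> :: "nat \<Rightarrow> complex"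
      by (simp add: indicator_def sum.If_cases Int_def)
    have [measurable]: "(\<lambda>\<zeta>. real (card {j\<in>{..<N}. \<zeta> j \<in> ball z \<epsilon>})) \<in> borel_measurable (config_measure N)"
      unfolding card_eq by (intro borel_measurable_sum measurable_compose[OF coordm] borel_measurable_indicator) auto
    have "(\<integral>\<zeta>. real (card {j \<in> {..<N}. \<zeta> j \<in> ball z \<epsilon>}) \<partial>gibbs_measure N Q) =
      (LINT \<zeta>|config_measure N. ((cmod (slater \<phi> N \<zeta>))\<^sup>2 / fact N) *\<^sub>R real (card {j \<in> {..<N}. \<zeta> j \<in> ball z \<epsilon>}))"
      unfolding gibbs
    proof (rule integral_density)
      show "(\<lambda>\<zeta>. (cmod (slater \<phi> N \<zeta>))\<^sup>2 / fact N) \<in> borel_measurable (config_measure N)" by measurable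
    qed (fact, simp)
    also have "\<dots> = (LINT \<zeta>|config_measure N. real (card {j \<in> {..<N}. \<zeta> j \<in> ball z \<epsilon>}) * (cmod (slater \<phi> N \<zeta>))\<^sup>2 / fact N)"
      by (intro Bochner_Integration.integral_cong refl) simp
    also have "\<dots> = (\<Sum>k<N. LINT x|area_measure. indicator (ball z \<epsilon>) x * (cmod (\<phi> k x))\<^sup>2)"
      using slater_cnt[of "ball z \<epsilon>"] by simp
    also have "\<dots> = (LINT x|area_measure. indicator (ball z \<epsilon>) x * \<rho> x)"
      unfolding \<rho>_sum sum_distrib_left
      using integrable_mult_indicator[OF _ \<phi>i, of "ball z \<epsilon>"]
      by (intro Bochner_Integration.integral_sum[symmetric]) auto
    finally show ?thesis .
  qed
  have "isCont \<rho> z" unfolding \<rho>_def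
    by (intro continuous_intros cont isCont_o2[OF cont])
  then have "one_point_function N Q z = \<rho> z"
    unfolding one_point_function_def mean
    by (intro tendsto_Lim ball_average_tendsto[OF \<rho>i]) simp_all
  then show ?thesis by (simp add: \<rho>_def)
qed

section \<open>An integral representation of the Bessel function of the second kind\<close>

text \<open>
  The kernel is cut off at 0, so that its integrals can be taken over the whole line.
\<close>
definition bessel_kernel where "bessel_kernel m y t = indicat_real {0<..} t * (t powr (m - 1) * exp (- t - y / t))"

text \<open>
  In classical notation this is \<open>2 y\<^sup>m\<^sup>/\<^sup>2 K\<^sub>m(2 \<surd>y)\<close> for \<open>y > 0\<close>.
\<close>
definition bessel_integral :: "real \<Rightarrow> real \<Rightarrow> real" where
  "bessel_integral m y = (LINT t|lborel. bessel_kernel m y t)"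

lemma bessel_kernel_measurable [measurable]: "bessel_kernel m y \<in> borel_measurable borel"
  unfolding bessel_kernel_def by measurable

lemma gamma_integral:
  assumes "s > (0::real)"
  shows "integrable lborel (\<lambda>t. indicator {0<..} t * (t powr (s - 1) * exp (- t)))"
    and "(LINT t|lborel. indicator {0<..} t * (t powr (s - 1) * exp (- t))) = Gamma s"
proof -
  have e: "AE t in lborel. indicator {0..} t * t powr (s - 1) / exp t = indicator {0<..} t * (t powr (s - 1) * exp (- t))"
    using AE_lborel_singleton[of 0] by eventually_elim (auto simp: indicator_def exp_minus divide_inverse)
  have "has_bochner_integral lborel (\<lambda>t. indicator {0..} t * t powr (s - 1) / exp t) (Gamma s)"
    by (rule has_bochner_integral_nn_integral)
       (use Gamma_conv_nn_integral_real[OF assms] Gamma_real_pos[OF assms] in \<open>auto intro!: AE_I2 simp: indicator_def less_imp_le\<close>)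
  then have "has_bochner_integral lborel (\<lambda>t. indicator {0<..} t * (t powr (s - 1) * exp (- t))) (Gamma s)"
    by (subst (asm) has_bochner_integral_cong_AE[OF _ _ e]) measurable
  then show "integrable lborel (\<lambda>t. indicator {0<..} t * (t powr (s - 1) * exp (- t)))"
    and "(LINT t|lborel. indicator {0<..} t * (t powr (s - 1) * exp (- t))) = Gamma s"
    by (auto simp: has_bochner_integral_iff)
qed

text \<open>
  By \<open>ln u \<le> u - 1\<close> at \<open>u = x / a\<close>. The rapid decay of \<open>exp (- y / t)\<close> at \<open>t = 0\<close> that this
  expresses is what makes the kernel integrable for every order.
\<close>
lemma exp_neg_le_powr:
  assumes "a \<ge> (0::real)" shows "\<exists>C\<ge>0. \<forall>x>0. exp (- x) \<le> C * x powr (- a)"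
proof (cases "a = 0")
  case True
  then show ?thesis by (intro exI[of _ 1]) auto
next
  case False
  then have a: "a > 0" using assms by simp
  have "exp (- x) \<le> exp (a * ln a - a) * x powr (- a)" if x: "x > 0" for x
  proof -
    have "ln (x / a) \<le> x / a - 1" using x a by (intro ln_le_minus_one) auto
    then have "a * ln (x / a) \<le> x - a" using a by (simp add: field_simps)
    then have "- x \<le> a * ln a - a + (- a) * ln x" using x a by (simp add: ln_div algebra_simps)
    then have "exp (- x) \<le> exp (a * ln a - a + (- a) * ln x)" by simp
    also have "\<dots> = exp (a * ln a - a) * exp ((- a) * ln x)" by (rule exp_add)
    also have "exp ((- a) * ln x) = x powr (- a)" using x by (simp add: powr_def)
    finally show ?thesis .
  qed
  then show ?thesis by (intro exI[of _ "exp (a * ln a - a)"]) auto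
qed

lemma bessel_kernel_nonneg: "bessel_kernel m y t \<ge> 0" by (simp add: bessel_kernel_def)

lemma bessel_kernel_integrable:
  assumes "y > 0" shows "integrable lborel (bessel_kernel m y)"
proof -
  define a where "a = max 0 (1 - m)"
  have a: "a \<ge> 0" "m + a > 0" by (auto simp: a_def)
  obtain C where C: "C \<ge> 0" "\<And>x. x > 0 \<Longrightarrow> exp (- x) \<le> C * x powr (- a)"
    using exp_neg_le_powr[OF a(1)] by auto
  have "integrable lborel (\<lambda>t. C * y powr (- a) * (indicator {0<..} t * (t powr ((m + a) - 1) * exp (- t))))"
    by (intro integrable_mult_right gamma_integral a)
  then show ?thesis
  proof (rule Bochner_Integration.integrable_bound)
    show "AE t in lborel. norm (bessel_kernel m y t) \<le> norm (C * y powr (- a) * (indicator {0<..} t * (t powr ((m + a) - 1) * exp (- t))))"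
    proof (rule AE_I2)
      fix t :: real
      show "norm (bessel_kernel m y t) \<le> norm (C * y powr (- a) * (indicator {0<..} t * (t powr ((m + a) - 1) * exp (- t))))"
      proof (cases "t > 0")
        case True
        have "exp (- (y / t)) \<le> C * (y / t) powr (- a)" using True assms by (intro C) auto
        also have "(y / t) powr (- a) = y powr (- a) * t powr a"
          using True assms by (simp add: powr_divide powr_minus field_simps)
        finally have "(t powr (m - 1) * exp (- t)) * exp (- (y / t)) \<le> (t powr (m - 1) * exp (- t)) * (C * (y powr (- a) * t powr a))"
          by (intro mult_left_mono) auto
        also have "(t powr (m - 1) * exp (- t)) * exp (- (y / t)) = bessel_kernel m y t"
          using True by (simp add: bessel_kernel_def mult.assoc mult_exp_exp)
        also have "(t powr (m - 1) * exp (- t)) * (C * (y powr (- a) * t powr a)) = C * y powr (- a) * (t powr (m - 1) * t powr a * exp (- t))"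
          by (simp only: mult_ac)
        also have "t powr (m - 1) * t powr a = t powr (m + a - 1)" by (simp add: powr_add[symmetric] algebra_simps)
        finally show ?thesis using True bessel_kernel_nonneg[of m y t] by simp
      qed (simp add: bessel_kernel_def)
    qed
  qed auto
qed

lemma bessel_integral_nonneg: "bessel_integral m y \<ge> 0"
  unfolding bessel_integral_def by (intro integral_nonneg_AE AE_I2 bessel_kernel_nonneg)

lemma bessel_integral_pos: assumes "y > 0" shows "bessel_integral m y > 0"
proof (rule ccontr)
  assume "\<not> bessel_integral m y > 0"
  then have "bessel_integral m y = 0" using bessel_integral_nonneg[of m y] by simp
  then have "AE t in lborel. bessel_kernel m y t = 0"
    unfolding bessel_integral_def
    using integral_nonneg_eq_0_iff_AE[OF bessel_kernel_integrable[OF assms]] bessel_kernel_nonneg by auto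
  then have "AE t in lborel. \<not> (0 < t \<and> t < (1::real))" by eventually_elim (auto simp: bessel_kernel_def)
  then have "emeasure lborel {t \<in> space lborel. 0 < t \<and> t < (1::real)} = 0" by (rule emeasure_eq_0_AE)
  moreover have "{t \<in> space lborel. 0 < t \<and> t < (1::real)} = {0<..<1}" by auto
  ultimately show False by simp
qed

text \<open>
  Substitute \<open>y / s\<close> for \<open>t\<close>.
\<close>
lemma bessel_integral_reflect:
  assumes "y > 0" shows "bessel_integral (- m) y = y powr (- m) * bessel_integral m y"
proof -
  define k where "k = (\<lambda>m t. t powr (m - 1) * exp (- t - y / t))"
  have k_int: "set_integrable lborel {0<..} (k m)" for m
    using bessel_kernel_integrable[OF assms, of m] by (simp add: set_integrable_def bessel_kernel_def[abs_def] k_def)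
  have k_abs: "k m absolutely_integrable_on {0<..}" for m
    using k_int[of m] unfolding set_integrable_def
    by (subst integrable_completion) (auto dest: borel_measurable_integrable)
  have k_eq: "bessel_integral m y = integral {0<..} (k m)" for m
    using set_borel_integral_eq_integral(2)[OF k_int[of m]]
    by (simp add: bessel_integral_def bessel_kernel_def[abs_def] k_def set_lebesgue_integral_def)
  have img: "(\<lambda>s. y / s) ` {0<..} = {0<..}"
  proof (intro equalityI subsetI)
    fix t :: real assume "t \<in> {0<..}"
    then show "t \<in> (\<lambda>s. y / s) ` {0<..}" using assms by (intro image_eqI[of _ _ "y / t"]) auto
  qed (use assms in auto)
  have "(\<lambda>s. \<bar>- y / s\<^sup>2\<bar> * k m (y / s)) absolutely_integrable_on {0<..} \<and>
        integral {0<..} (\<lambda>s. \<bar>- y / s\<^sup>2\<bar> * k m (y / s)) = integral {0<..} (k m)"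
  proof -
    have d: "((\<lambda>s. y / s) has_field_derivative - y / x\<^sup>2) (at x within {0<..})" if "x \<in> {0<..}" for x
      using that by (auto intro!: derivative_eq_intros simp: power2_eq_square)
    have inj: "inj_on (\<lambda>s. y / s) {0<..}" using assms by (intro inj_onI) simp
    show ?thesis
      using has_absolute_integral_change_of_variables_1'[OF _ d inj, of "k m" "integral {0<..} (k m)"] k_abs[of m]
      unfolding img by simp
  qed
  moreover have "integral {0<..} (\<lambda>s. \<bar>- y / s\<^sup>2\<bar> * k m (y / s)) = integral {0<..} (\<lambda>s. y powr m * k (- m) s)"
  proof (intro integral_cong)
    fix s :: real assume "s \<in> {0<..}"
    then have s: "s > 0" by simp
    have "(y / s) powr (m - 1) = (y powr m / y) * (s / s powr m)" "s powr (- m - 1) = 1 / (s powr m * s)"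
      using s assms by (simp_all add: powr_divide powr_diff powr_minus_divide)
    moreover have "- (y / s) - y / (y / s) = - s - y / s" using s assms by simp
    moreover have "\<bar>- y / s\<^sup>2\<bar> = y / (s * s)" using s assms by (simp add: power2_eq_square)
    ultimately show "\<bar>- y / s\<^sup>2\<bar> * k m (y / s) = y powr m * k (- m) s" using s assms
      unfolding k_def by (simp only:) simp
  qed
  ultimately have "bessel_integral m y = y powr m * bessel_integral (- m) y"
    by (simp add: k_eq)
  then show ?thesis using assms by (simp add: powr_minus)
qed

lemma exp_minus_linear_bound: "\<bar>exp x - 1 - x\<bar> \<le> x\<^sup>2 * exp \<bar>x\<bar>" for x :: real
proof -
  have 0: "exp x - 1 - x \<ge> 0" using exp_ge_add_one_self[of x] by linarith
  have "exp x * (1 - x) \<le> exp x * exp (- x)" using exp_ge_add_one_self[of "- x"] by (intro mult_left_mono) auto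
  then have 1: "exp x - 1 - x \<le> x * (exp x - 1)" by (simp add: algebra_simps flip: exp_add)
  have "x * (exp x - 1) \<le> x\<^sup>2 * exp \<bar>x\<bar>"
  proof (cases "x \<ge> 0")
    case True
    then have "x * (exp x - 1) \<le> x * (x * exp x)" using \<open>exp x * (1 - x) \<le> exp x * exp (- x)\<close>
      by (intro mult_left_mono) (auto simp: algebra_simps simp flip: exp_add)
    then show ?thesis using True by (simp add: power2_eq_square)
  next
    case False
    then have "(- x) * (1 - exp x) \<le> (- x) * ((- x) * exp (- x))"
    proof (intro mult_left_mono)
      have "1 - exp x \<le> - x" using exp_ge_add_one_self[of x] by linarith
      also have "\<dots> \<le> (- x) * exp (- x)" using False mult_left_mono[of 1 "exp (- x)" "- x"] by simp
      finally show "1 - exp x \<le> (- x) * exp (- x)" .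
    qed auto
    then show ?thesis using False by (simp add: power2_eq_square algebra_simps)
  qed
  with 0 1 show ?thesis by simp
qed

text \<open>
  Differentiation under the integral sign, justified by the second-order bound on the exponential:
  the remainder is at most \<open>h\<^sup>2\<close> times an integral of the same type, of order \<open>m - 2\<close> and at \<open>y / 2\<close>.
\<close>
lemma bessel_integral_deriv:
  assumes y: "y > 0" shows "(bessel_integral m has_real_derivative - bessel_integral (m - 1) y) (at y)"
proof -
  define K where "K = bessel_integral (m - 2) (y / 2)"
  have bd: "\<bar>bessel_integral m (y + h) - bessel_integral m y + h * bessel_integral (m - 1) y\<bar> \<le> h\<^sup>2 * K"
    if h: "\<bar>h\<bar> < y / 2" for h
  proof -
    have yh: "y + h > 0" using h y by linarith
    have "bessel_integral m (y + h) - bessel_integral m y + h * bessel_integral (m - 1) y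
       = (LINT t|lborel. bessel_kernel m (y + h) t - bessel_kernel m y t + h * bessel_kernel (m - 1) y t)"
      unfolding bessel_integral_def using bessel_kernel_integrable[OF y] bessel_kernel_integrable[OF yh] by simp
    also have "\<bar>\<dots>\<bar> \<le> (LINT t|lborel. h\<^sup>2 * bessel_kernel (m - 2) (y / 2) t)"
    proof (rule Bochner_Integration.integral_abs_bound_integral)
      fix t :: real
      show "\<bar>bessel_kernel m (y + h) t - bessel_kernel m y t + h * bessel_kernel (m - 1) y t\<bar> \<le> h\<^sup>2 * bessel_kernel (m - 2) (y / 2) t"
      proof (cases "t > 0")
        case True
        define e where "e = t powr (m - 1) * exp (- t - y / t)"
        have k1: "bessel_kernel m (y + h) t = e * exp (- h / t)"
          using True by (simp add: bessel_kernel_def e_def add_divide_distrib mult_exp_exp mult.assoc)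
        have k2: "bessel_kernel (m - 1) y t = e / t"
          using True by (simp add: bessel_kernel_def e_def powr_diff power2_eq_square powr_numeral)
        have "bessel_kernel m (y + h) t - bessel_kernel m y t + h * bessel_kernel (m - 1) y t = e * (exp (- h / t) - 1 - (- h / t))"
          unfolding k1 k2 using True by (simp add: bessel_kernel_def e_def algebra_simps)
        also have "\<bar>\<dots>\<bar> \<le> e * ((- h / t)\<^sup>2 * exp \<bar>- h / t\<bar>)"
          unfolding abs_mult using exp_minus_linear_bound[of "- h / t"] by (intro mult_mono) (auto simp: e_def)
        also have "exp \<bar>- h / t\<bar> \<le> exp (y / 2 / t)" using h True divide_right_mono[of "\<bar>h\<bar>" "y / 2" t] by (simp add: abs_divide)
        then have "e * ((- h / t)\<^sup>2 * exp \<bar>- h / t\<bar>) \<le> e * ((- h / t)\<^sup>2 * exp (y / 2 / t))"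
          by (intro mult_left_mono) (auto simp: e_def)
        also have "\<dots> = h\<^sup>2 * (t powr (m - 1) / t\<^sup>2 * (exp (- t - y / t) * exp (y / 2 / t)))"
          using True by (simp add: e_def power_divide)
        also have "exp (- t - y / t) * exp (y / 2 / t) = exp (- t - y / 2 / t)"
          using True by (simp add: mult_exp_exp field_simps)
        also have "t powr (m - 1) / t\<^sup>2 = t powr ((m - 2) - 1)"
          using True by (simp add: powr_diff powr_numeral power2_eq_square power3_eq_cube field_simps)
        finally show ?thesis using True by (simp add: bessel_kernel_def)
      qed (simp add: bessel_kernel_def)
    qed (use bessel_kernel_integrable[OF y] bessel_kernel_integrable[OF yh] bessel_kernel_integrable[of "y / 2"] y in auto)
    also have "\<dots> = h\<^sup>2 * K" by (simp add: K_def bessel_integral_def)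
    finally show ?thesis .
  qed
  have "((\<lambda>h. (bessel_integral m (y + h) - bessel_integral m y) / h) \<longlongrightarrow> - bessel_integral (m - 1) y) (at 0)"
  proof (rule Lim_null[THEN iffD2], rule Lim_null_comparison)
    show "((\<lambda>h. \<bar>h\<bar> * K) \<longlongrightarrow> 0) (at 0)" by (auto intro!: tendsto_eq_intros)
    have "\<forall>\<^sub>F h in at 0. h \<noteq> 0 \<and> \<bar>h\<bar> < y / 2"
      unfolding eventually_at using y by (intro exI[of _ "y / 2"]) (auto simp: dist_real_def)
    then show "\<forall>\<^sub>F h in at 0. norm ((bessel_integral m (y + h) - bessel_integral m y) / h - - bessel_integral (m - 1) y) \<le> \<bar>h\<bar> * K"
    proof eventually_elim
      case (elim h)
      have "norm ((bessel_integral m (y + h) - bessel_integral m y) / h - - bessel_integral (m - 1) y)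
         = \<bar>bessel_integral m (y + h) - bessel_integral m y + h * bessel_integral (m - 1) y\<bar> / \<bar>h\<bar>"
        using elim by (simp add: abs_divide[symmetric] add_divide_distrib del: abs_divide)
      also have "\<dots> \<le> h\<^sup>2 * K / \<bar>h\<bar>" using bd[of h] elim by (intro divide_right_mono) auto
      also have "\<dots> = \<bar>h\<bar> * K" using elim by (simp add: power2_eq_square abs_if)
      finally show ?case .
    qed
  qed
  then show ?thesis by (simp add: DERIV_def)
qed

lemma one_minus_exp_le_powr:
  assumes "0 < a" "a \<le> 1" "0 < x" shows "1 - exp (- x) \<le> x powr (a::real)"
proof (cases "x \<le> 1")
  case True
  have "1 - exp (- x) \<le> x powr 1" using exp_ge_add_one_self[of "- x"] assms by simp
  also have "\<dots> \<le> x powr a" using True assms by (intro powr_mono') auto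
  finally show ?thesis .
next
  case False
  have "1 - exp (- x) \<le> 1" by simp
  also have "\<dots> \<le> x powr a" using False assms by (simp add: ge_one_powr_ge_zero)
  finally show ?thesis .
qed

lemma powr_tendsto_0:
  assumes "a > (0::real)" shows "((\<lambda>y. y powr a) \<longlongrightarrow> 0) (at_right 0)"
proof -
  have "((\<lambda>y. y powr a) \<longlongrightarrow> 0 powr a) (at_right 0)"
    using assms eventually_at_right_less[of "0::real"]
    by (intro tendsto_powr' tendsto_ident_at tendsto_const) (auto elim!: eventually_mono)
  then show ?thesis by simp
qed

text \<open>
  The difference to the Gamma integral contains the factor \<open>1 - exp (- y / t)\<close>, which is at most \<open>(y / t)\<^sup>a\<close> for
  \<open>0 < a \<le> 1\<close>; for \<open>a < m\<close> the factor \<open>t\<close> to the power \<open>- a\<close> is still integrable.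
\<close>
lemma bessel_integral_at_0:
  assumes "m > 0" shows "(bessel_integral m \<longlongrightarrow> Gamma m) (at_right 0)"
proof -
  define a where "a = min 1 (m / 2)"
  have a: "0 < a" "a \<le> 1" "m - a > 0" using assms by (auto simp: a_def)
  let ?g = "\<lambda>s t. indicator {0<..} t * (t powr (s - 1) * exp (- t))"
  have ig: "integrable lborel (?g m)" "integrable lborel (\<lambda>t. r * ?g (m - a) t)" for r
    by (rule gamma_integral(1)[OF assms]) (rule integrable_mult_right, rule gamma_integral(1)[OF a(3)])
  have bd: "\<bar>bessel_integral m y - Gamma m\<bar> \<le> y powr a * Gamma (m - a)" if y: "y > 0" for y
  proof -
    have "\<bar>bessel_integral m y - Gamma m\<bar> = \<bar>LINT t|lborel. bessel_kernel m y t - ?g m t\<bar>"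
      unfolding bessel_integral_def gamma_integral(2)[OF assms, symmetric]
      using bessel_kernel_integrable[OF y] gamma_integral(1)[OF assms] by simp
    also have "\<dots> \<le> (LINT t|lborel. y powr a * ?g (m - a) t)"
    proof (rule Bochner_Integration.integral_abs_bound_integral)
      fix t :: real
      show "\<bar>bessel_kernel m y t - ?g m t\<bar> \<le> y powr a * ?g (m - a) t"
      proof (cases "t > 0")
        case True
        have "bessel_kernel m y t - ?g m t = - ((t powr (m - 1) * exp (- t)) * (1 - exp (- (y / t))))"
          using True by (simp add: bessel_kernel_def algebra_simps exp_diff exp_minus divide_inverse)
        also have "\<bar>\<dots>\<bar> \<le> (t powr (m - 1) * exp (- t)) * (y / t) powr a"
        proof -
          have "0 \<le> 1 - exp (- (y / t))" using y True by simp
          then show ?thesis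
            using one_minus_exp_le_powr[OF a(1,2), of "y / t"] True y by (simp add: abs_mult)
        qed
        also have "\<dots> = y powr a * ?g (m - a) t"
          using True y by (simp add: powr_divide powr_diff powr_add field_simps)
        finally show ?thesis by simp
      qed (simp add: bessel_kernel_def)
    qed (rule Bochner_Integration.integrable_diff[OF bessel_kernel_integrable[OF y] ig(1)], rule ig(2))
    also have "\<dots> = y powr a * Gamma (m - a)" by (simp only: integral_mult_right_zero gamma_integral(2)[OF a(3)])
    finally show ?thesis .
  qed
  show ?thesis
  proof (rule Lim_null[THEN iffD2], rule Lim_null_comparison)
    have "((\<lambda>y. y powr a) \<longlongrightarrow> 0) (at_right 0)" using a(1) by (rule powr_tendsto_0)
    then show "((\<lambda>y. y powr a * Gamma (m - a)) \<longlongrightarrow> 0) (at_right 0)" by (rule tendsto_mult_left_zero)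
    show "\<forall>\<^sub>F y in at_right 0. norm (bessel_integral m y - Gamma m) \<le> y powr a * Gamma (m - a)"
      using eventually_at_right_less[of "0::real"] by eventually_elim (use bd in simp)
  qed
qed

text \<open>
  Integrate the derivative of \<open>t\<^sup>m exp (- t - y / t)\<close>, which vanishes at both ends of the half-line.
\<close>
lemma bessel_integral_rec:
  assumes "y > 0" shows "bessel_integral (m + 1) y = m * bessel_integral m y + y * bessel_integral (m - 1) y"
proof -
  define f where "f = (\<lambda>t. m * (t powr (m - 1) * exp (- t - y / t)) - t powr m * exp (- t - y / t) + y * (t powr (m - 2) * exp (- t - y / t)))"
  have ind: "indicator {0<..} t *\<^sub>R f t = m * bessel_kernel m y t - bessel_kernel (m + 1) y t + y * bessel_kernel (m - 1) y t" for t
    by (simp add: bessel_kernel_def f_def indicator_def)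
  have int: "set_integrable lborel {0<..} f"
    unfolding set_integrable_def ind using bessel_kernel_integrable[OF assms] by auto
  have "(LBINT t=0..\<infinity>. f t) = 0 - 0"
  proof (rule interval_integral_FTC_integrable[where F = "\<lambda>t. t powr m * exp (- t - y / t)"])
    show "((\<lambda>t. t powr m * exp (- t - y / t)) has_vector_derivative f t) (at t)" if "0 < ereal t" "ereal t < \<infinity>" for t
      unfolding has_real_derivative_iff_has_vector_derivative[symmetric] f_def using that
      by (auto intro!: derivative_eq_intros simp: powr_diff powr_numeral power2_eq_square field_simps)
    show "isCont f t" if "0 < ereal t" "ereal t < \<infinity>" for t
      unfolding f_def using that by (intro continuous_intros) auto
    show "set_integrable lborel (einterval 0 \<infinity>) f"
      using int by (simp add: einterval_def greaterThan_def[symmetric] zero_ereal_def)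
    have "((\<lambda>t. t powr m * exp (- t - y / t)) \<longlongrightarrow> 0) (at_right 0)" using assms by real_asymp
    then show "(((\<lambda>t. t powr m * exp (- t - y / t)) \<circ> real_of_ereal) \<longlongrightarrow> 0) (at_right 0)"
      by (simp add: zero_ereal_def ereal_tendsto_simps)
    have "((\<lambda>t. t powr m * exp (- t - y / t)) \<longlongrightarrow> 0) at_top" using assms by real_asymp
    then show "(((\<lambda>t. t powr m * exp (- t - y / t)) \<circ> real_of_ereal) \<longlongrightarrow> 0) (at_left \<infinity>)"
      by (simp add: ereal_tendsto_simps)
  qed auto
  moreover have "(LBINT t=0..\<infinity>. f t) = (LINT t|lborel. m * bessel_kernel m y t - bessel_kernel (m + 1) y t + y * bessel_kernel (m - 1) y t)"
    unfolding ind[symmetric]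
    by (simp add: interval_lebesgue_integral_def set_lebesgue_integral_def einterval_def greaterThan_def[symmetric] zero_ereal_def)
  moreover have "\<dots> = m * bessel_integral m y - bessel_integral (m + 1) y + y * bessel_integral (m - 1) y"
    unfolding bessel_integral_def using bessel_kernel_integrable[OF assms] by simp
  ultimately show ?thesis by simp
qed

lemma exp_diff_bound: "\<bar>exp a - exp b\<bar> \<le> \<bar>a - b\<bar> * (exp a + exp b)" for a b :: real
proof -
  have "exp a - exp b \<le> (a - b) * exp a" for a b :: real
    using mult_left_mono[OF exp_ge_add_one_self[of "b - a"], of "exp a"] by (simp add: algebra_simps flip: exp_add)
  from this[of a b] this[of b a] show ?thesis
    by (smt (verit) exp_gt_zero mult_right_mono mult_nonneg_nonneg distrib_left)
qed

text \<open>
  The integral is even Lipschitz near \<open>m\<close>: changing the exponent costs a factor \<open>ln t\<close>, which is at most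
  \<open>t + 1 / t\<close> in absolute value and thus amounts to a shift of the order.
\<close>
lemma bessel_integral_isCont_order:
  assumes "y > 0" shows "isCont (\<lambda>m. bessel_integral m y) m"
proof -
  \<comment> \<open>From \<open>(t + 1/t) * 2 * (t\<^sup>m\<^sup>-\<^sup>2 + t\<^sup>m)\<close>, where the sum of powers dominates \<open>t\<^sup>s\<^sup>-\<^sup>1\<close> for \<open>\<bar>s - m\<bar> < 1\<close>.\<close>
  define K where "K = 2 * (bessel_integral (m - 2) y + 2 * bessel_integral m y + bessel_integral (m + 2) y)"
  have bd: "\<bar>bessel_integral s y - bessel_integral m y\<bar> \<le> \<bar>s - m\<bar> * K" if s: "\<bar>s - m\<bar> < 1" for s
  proof -
    have "\<bar>bessel_integral s y - bessel_integral m y\<bar> = \<bar>LINT t|lborel. bessel_kernel s y t - bessel_kernel m y t\<bar>"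
      unfolding bessel_integral_def using bessel_kernel_integrable[OF assms] by simp
    also have "\<dots> \<le> (LINT t|lborel. \<bar>s - m\<bar> * (2 * (bessel_kernel (m - 2) y t + 2 * bessel_kernel m y t + bessel_kernel (m + 2) y t)))"
    proof (rule Bochner_Integration.integral_abs_bound_integral)
      fix t :: real
      show "\<bar>bessel_kernel s y t - bessel_kernel m y t\<bar> \<le> \<bar>s - m\<bar> * (2 * (bessel_kernel (m - 2) y t + 2 * bessel_kernel m y t + bessel_kernel (m + 2) y t))"
      proof (cases "t > 0")
        case True
        have pw: "t powr r \<le> t powr (m - 2) + t powr m" if "m - 2 \<le> r" "r \<le> m" for r
        proof (cases "t \<ge> 1")
          case True
          then show ?thesis using that powr_mono[of r m t] by (simp add: add_increasing)
        next
          case False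
          then show ?thesis using \<open>t > 0\<close> that powr_mono'[of "m - 2" r t] by (simp add: add_increasing2)
        qed
        have l: "\<bar>ln t\<bar> \<le> t + 1 / t"
          using ln_le_minus_one[OF True] ln_le_minus_one[of "1 / t"] True by (simp add: ln_div abs_le_iff)
             (smt (verit) True divide_pos_pos)
        have "\<bar>t powr (s - 1) - t powr (m - 1)\<bar> \<le> \<bar>(s - 1) * ln t - (m - 1) * ln t\<bar> * (t powr (s - 1) + t powr (m - 1))"
          using True exp_diff_bound[of "(s - 1) * ln t" "(m - 1) * ln t"] by (simp add: powr_def)
        also have "(s - 1) * ln t - (m - 1) * ln t = (s - m) * ln t" by (simp add: algebra_simps)
        also have "\<bar>(s - m) * ln t\<bar> * (t powr (s - 1) + t powr (m - 1)) \<le> (\<bar>s - m\<bar> * (t + 1 / t)) * (2 * (t powr (m - 2) + t powr m))"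
        proof -
          have "t powr (s - 1) \<le> t powr (m - 2) + t powr m" "t powr (m - 1) \<le> t powr (m - 2) + t powr m"
            using s by (intro pw; linarith)+
          then show ?thesis unfolding abs_mult using l True by (intro mult_mono mult_left_mono) auto
        qed
        also have "\<dots> = \<bar>s - m\<bar> * (2 * (t powr (m - 2 - 1) + 2 * t powr (m - 1) + t powr (m + 2 - 1)))"
        proof -
          have "t powr (m - 2) = t powr m / t\<^sup>2" "t powr (m - 2 - 1) = t powr m / t ^ 3" "t powr (m - 1) = t powr m / t"
            using True by (simp_all add: powr_diff powr_numeral power2_eq_square power3_eq_cube)
          moreover have "t powr (m + 2 - 1) = t powr m * t"
            using True by (simp add: powr_add)
          ultimately show ?thesis using True
            by (simp only:) (simp add: field_simps power2_eq_square power3_eq_cube)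
        qed
        finally have "\<bar>t powr (s - 1) - t powr (m - 1)\<bar> * exp (- t - y / t) \<le>
            \<bar>s - m\<bar> * (2 * (t powr (m - 2 - 1) + 2 * t powr (m - 1) + t powr (m + 2 - 1))) * exp (- t - y / t)"
          by (intro mult_right_mono) auto
        moreover have "\<bar>t powr (s - 1) - t powr (m - 1)\<bar> * exp (- t - y / t) = \<bar>bessel_kernel s y t - bessel_kernel m y t\<bar>"
        proof -
          have "bessel_kernel s y t - bessel_kernel m y t = (t powr (s - 1) - t powr (m - 1)) * exp (- t - y / t)"
            using True by (simp add: bessel_kernel_def algebra_simps)
          then show ?thesis by (simp add: abs_mult)
        qed
        ultimately show ?thesis using True by (simp add: bessel_kernel_def algebra_simps)
      qed (simp add: bessel_kernel_def)
    qed (intro Bochner_Integration.integrable_diff bessel_kernel_integrable assms,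
         intro integrable_mult_right Bochner_Integration.integrable_add bessel_kernel_integrable assms)
    also have "\<dots> = \<bar>s - m\<bar> * K"
      unfolding K_def bessel_integral_def using bessel_kernel_integrable[OF assms] by simp
    finally show ?thesis .
  qed
  have "((\<lambda>s. bessel_integral s y) \<longlongrightarrow> bessel_integral m y) (at m)"
  proof (rule Lim_null[THEN iffD2], rule Lim_null_comparison)
    show "((\<lambda>s. \<bar>s - m\<bar> * K) \<longlongrightarrow> 0) (at m)" by (auto intro!: tendsto_eq_intros)
    have "\<forall>\<^sub>F s in at m. \<bar>s - m\<bar> < 1"
      unfolding eventually_at by (intro exI[of _ 1]) (auto simp: dist_real_def)
    then show "\<forall>\<^sub>F s in at m. norm (bessel_integral s y - bessel_integral m y) \<le> \<bar>s - m\<bar> * K"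
      by eventually_elim (use bd in simp)
  qed
  then show ?thesis by (simp add: isCont_def)
qed

text \<open>
  The entire function \<open>E\<^sub>\<nu>\<close> common to the Bessel functions: \<open>I\<^sub>\<nu>(x) = (x/2)\<^sup>\<nu> E\<^sub>\<nu>(x\<^sup>2/4)\<close> and
  \<open>J\<^sub>\<nu>(w) = (w/2)\<^sup>\<nu> E\<^sub>\<nu>(- w\<^sup>2/4)\<close>. It is used for real and for complex arguments.
\<close>
definition bessel_series :: "real \<Rightarrow> 'a::{real_normed_field,banach} \<Rightarrow> 'a" where
  "bessel_series \<nu> y = (\<Sum>k. of_real (rGamma (of_nat k + \<nu> + 1) / fact k) * y ^ k)"

text \<open>
  As soon as \<open>k \<ge> \<bar>\<nu>\<bar>\<close>, the functional equation makes the values decrease in absolute value.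
\<close>
lemma rGamma_bound: "\<exists>C\<ge>0. \<forall>k. \<bar>rGamma (real k + \<nu> + 1)\<bar> \<le> C"
proof -
  define r where "r = (\<lambda>k. \<bar>rGamma (real k + \<nu> + 1)\<bar>)"
  obtain K :: nat where K: "real K \<ge> \<bar>\<nu>\<bar>" using real_arch_simple by blast
  have step: "r (Suc k) \<le> r k" if "k \<ge> K" for k
  proof -
    have "r k = \<bar>real k + \<nu> + 1\<bar> * r (Suc k)"
      using rGamma_plus1[of "real k + \<nu> + 1"] by (simp add: r_def add_ac abs_mult[symmetric])
    moreover have "1 * r (Suc k) \<le> \<bar>real k + \<nu> + 1\<bar> * r (Suc k)"
      using K that by (intro mult_right_mono) (auto simp: r_def)
    ultimately show ?thesis by simp
  qed
  have "r (K + n) \<le> r K" for n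
  proof (induction n)
    case (Suc n)
    then show ?case using step[of "K + n"] by simp
  qed simp
  then have 1: "r k \<le> r K" if "k \<ge> K" for k using that by (metis le_add_diff_inverse)
  have 2: "r k \<le> sum r {..K}" if "k \<le> K" for k
    using that by (intro member_le_sum) (auto simp: r_def)
  have "r k \<le> sum r {..K}" for k
    using 1[of k] 2[of k] 2[of K] by linarith
  then show ?thesis by (intro exI[of _ "sum r {..K}"]) (auto simp: r_def sum_nonneg)
qed

lemma bessel_series_summable:
  fixes y :: "'a::{real_normed_field,banach}"
  shows "summable (\<lambda>k. norm (of_real (rGamma (of_nat k + \<nu> + 1) / fact k) * y ^ k))"
proof -
  obtain C where C: "C \<ge> 0" "\<And>k. \<bar>rGamma (real k + \<nu> + 1)\<bar> \<le> C" using rGamma_bound[of \<nu>] by auto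
  have "summable (\<lambda>k. C * (norm y ^ k /\<^sub>R fact k))"
    by (intro summable_mult summable_exp_generic)
  then show ?thesis
  proof (rule summable_comparison_test'[where N=0])
    fix k :: nat
    show "norm (norm (of_real (rGamma (of_nat k + \<nu> + 1) / fact k) * y ^ k)) \<le> C * (norm y ^ k /\<^sub>R fact k)"
      using mult_right_mono[OF C(2)[of k], of "norm y ^ k / fact k"]
      by (simp add: norm_mult norm_power norm_divide divide_simps)
  qed
qed

lemma bessel_series_deriv:
  "((bessel_series \<nu> :: real \<Rightarrow> real) has_real_derivative bessel_series (\<nu> + 1) y) (at y)"
proof -
  define c where "c = (\<lambda>k. rGamma (real k + \<nu> + 1) / fact k)"
  have s: "summable (\<lambda>k. c k * x ^ k)" for x :: real
    by (rule summable_norm_cancel) (use bessel_series_summable[of \<nu> x] in \<open>simp add: c_def\<close>)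
  have "((\<lambda>x. \<Sum>k. c k * x ^ k) has_real_derivative (\<Sum>k. diffs c k * y ^ k)) (at y)"
    by (rule termdiffs_strong_converges_everywhere[OF s])
  moreover have "diffs c k = rGamma (real k + (\<nu> + 1) + 1) / fact k" for k
    by (simp add: c_def diffs_def add_ac)
  ultimately show ?thesis by (simp add: bessel_series_def[abs_def] c_def)
qed

lemma bessel_series_rec:
  fixes y :: real
  shows "bessel_series (\<nu> - 1) y = \<nu> * bessel_series \<nu> y + y * bessel_series (\<nu> + 1) y"
proof -
  define f where "f = (\<lambda>\<mu> k. rGamma (real k + \<mu> + 1) / fact k * y ^ k)"
  have s: "summable (f \<mu>)" for \<mu>
    by (rule summable_norm_cancel) (use bessel_series_summable[of \<mu> y] in \<open>simp add: f_def\<close>)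
  have E: "bessel_series \<mu> y = suminf (f \<mu>)" for \<mu> by (simp add: bessel_series_def f_def)
  define g where "g = (\<lambda>k. f (\<nu> - 1) k - \<nu> * f \<nu> k)"
  have sg: "summable g" unfolding g_def by (intro summable_diff summable_mult s)
  have g0: "g 0 = 0" using rGamma_plus1[of \<nu>] by (simp add: g_def f_def)
  have gS: "g (Suc k) = y * f (\<nu> + 1) k" for k
  proof -
    have "g (Suc k) = (rGamma (real k + \<nu> + 1) - \<nu> * rGamma ((real k + \<nu> + 1) + 1)) / fact (Suc k) * y ^ Suc k"
      by (simp add: g_def f_def algebra_simps diff_divide_distrib)
    also have "rGamma (real k + \<nu> + 1) = (real k + \<nu> + 1) * rGamma ((real k + \<nu> + 1) + 1)"
      by (rule rGamma_plus1[symmetric])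
    also have "(real k + \<nu> + 1) * rGamma ((real k + \<nu> + 1) + 1) - \<nu> * rGamma ((real k + \<nu> + 1) + 1) = (real k + 1) * rGamma ((real k + \<nu> + 1) + 1)"
      by (simp add: algebra_simps)
    also have "(real k + 1) * rGamma ((real k + \<nu> + 1) + 1) / fact (Suc k) = rGamma (real k + (\<nu> + 1) + 1) / fact k"
      by (simp add: field_simps del: of_nat_Suc) (simp add: algebra_simps)
    finally show ?thesis by (simp add: f_def)
  qed
  have "suminf g = g 0 + (\<Sum>k. g (Suc k))" using suminf_split_head[OF sg] by simp
  also have "\<dots> = y * suminf (f (\<nu> + 1))" using g0 gS s by (simp add: suminf_mult)
  finally have "suminf g = y * suminf (f (\<nu> + 1))" .
  moreover have "suminf g = suminf (f (\<nu> - 1)) - \<nu> * suminf (f \<nu>)"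
    unfolding g_def using s by (subst suminf_diff[symmetric]) (auto intro!: summable_mult simp: suminf_mult)
  ultimately show ?thesis by (simp add: E)
qed

lemma bessel_I_series:
  assumes "x > 0" shows "bessel_I \<nu> x = (x / 2) powr \<nu> * bessel_series \<nu> (x\<^sup>2 / 4)"
proof -
  have "(x / 2) ^ (2 * k) = (x\<^sup>2 / 4) ^ k" for k
    unfolding power_mult by (simp add: power_divide)
  then show ?thesis by (simp add: bessel_I_def bessel_series_def)
qed

text \<open>
  Uniqueness for the system \<open>u' = a v\<close>, \<open>v' = b u\<close> with coefficients that may be singular at 0 but are integrable
  there. As \<open>2 u v (a + b) \<le> (u\<^sup>2 + v\<^sup>2) (\<bar>a\<bar> + \<bar>b\<bar>)\<close>, the function \<open>(u\<^sup>2 + v\<^sup>2) exp (- A)\<close> does not increase; it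
  is nonnegative and tends to 0 at 0.
\<close>
lemma linear_system_zero:
  fixes u v a b A B :: "real \<Rightarrow> real"
  assumes du: "\<And>y. y > 0 \<Longrightarrow> (u has_real_derivative a y * v y) (at y)"
    and dv: "\<And>y. y > 0 \<Longrightarrow> (v has_real_derivative b y * u y) (at y)"
    and dA: "\<And>y. y > 0 \<Longrightarrow> (A has_real_derivative \<bar>a y\<bar> + \<bar>b y\<bar>) (at y)"
    and u0: "(u \<longlongrightarrow> 0) (at_right 0)" and v0: "(v \<longlongrightarrow> 0) (at_right 0)"
    and A0: "(A \<longlongrightarrow> A0) (at_right 0)"
    and y: "y > 0"
  shows "u y = 0"
proof -
  define M where "M = (\<lambda>y. ((u y)\<^sup>2 + (v y)\<^sup>2) * exp (- A y))"
  have dM: "(M has_real_derivative (2 * u x * v x * (a x + b x) - ((u x)\<^sup>2 + (v x)\<^sup>2) * (\<bar>a x\<bar> + \<bar>b x\<bar>)) * exp (- A x)) (at x)"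
    if "x > 0" for x
    unfolding M_def using that
    by (auto intro!: derivative_eq_intros du dv dA simp: algebra_simps power2_eq_square)
  have neg: "(2 * u x * v x * (a x + b x) - ((u x)\<^sup>2 + (v x)\<^sup>2) * (\<bar>a x\<bar> + \<bar>b x\<bar>)) * exp (- A x) \<le> 0" for x
  proof -
    have "2 * u x * v x * (a x + b x) \<le> \<bar>2 * u x * v x\<bar> * \<bar>a x + b x\<bar>"
      by (metis abs_ge_self abs_mult)
    also have "\<dots> \<le> ((u x)\<^sup>2 + (v x)\<^sup>2) * (\<bar>a x\<bar> + \<bar>b x\<bar>)"
    proof (rule mult_mono)
      have "0 \<le> (\<bar>u x\<bar> - \<bar>v x\<bar>)\<^sup>2" by simp
      then show "\<bar>2 * u x * v x\<bar> \<le> (u x)\<^sup>2 + (v x)\<^sup>2"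
        by (simp add: power2_eq_square abs_mult algebra_simps)
    qed auto
    finally show ?thesis by (simp add: mult_le_0_iff)
  qed
  have le: "M y \<le> M x" if "0 < x" "x \<le> y" for x
    by (rule DERIV_nonpos_imp_nonincreasing[OF that(2)]) (use dM neg that in \<open>meson less_le_trans\<close>)
  have "(M \<longlongrightarrow> (0\<^sup>2 + 0\<^sup>2) * exp (- A0)) (at_right 0)"
    unfolding M_def by (intro tendsto_intros u0 v0 A0)
  moreover have "\<forall>\<^sub>F x in at_right 0. M y \<le> M x"
    using eventually_at_right_real[OF y] by eventually_elim (auto intro: le)
  ultimately have "M y \<le> 0" using tendsto_lowerbound[of M _ "at_right 0" "M y"] by simp
  then have "(u y)\<^sup>2 + (v y)\<^sup>2 \<le> 0" by (simp add: M_def mult_le_0_iff)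
  then show ?thesis by (simp add: sum_power2_le_zero_iff)
qed

text \<open>
  Let \<open>F\<^sub>m\<close> be the integral of order \<open>m\<close>. By the derivative and reflection formulas, \<open>u = F\<^sub>m\<close> and
  \<open>v = - F\<^sub>1\<^sub>-\<^sub>m\<close> satisfy \<open>u' = y\<^sup>m\<^sup>-\<^sup>1 v\<close>, \<open>v' = y\<^sup>-\<^sup>m u\<close>. The series on the right satisfy the same system, and the
  reflection formula of the Gamma function makes the limits at 0 agree. For \<open>0 < m < 1\<close> both coefficients
  are integrable at 0.
\<close>
lemma bessel_integral_series_01:
  assumes m: "0 < m" "m < 1" and y: "y > 0"
  shows "bessel_integral m y = pi / sin (pi * m) * (bessel_series (- m) y - y powr m * bessel_series m y)"
proof -
  define c where "c = pi / sin (pi * m)"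
  define u where "u = (\<lambda>y. bessel_integral m y - c * (bessel_series (- m) y - y powr m * bessel_series m y))"
  define v where "v = (\<lambda>y. - bessel_integral (1 - m) y - c * (y powr (1 - m) * bessel_series (1 - m) y - bessel_series (m - 1) y))"
  have G: "c = Gamma m * Gamma (1 - m)"
  proof -
    have "complex_of_real (rGamma m * rGamma (1 - m)) = complex_of_real (sin (pi * m) / pi)"
      using rGamma_reflection_complex[of "complex_of_real m"]
      by (simp add: rGamma_complex_of_real[symmetric] sin_of_real[symmetric])
    then have "rGamma m * rGamma (1 - m) = sin (pi * m) / pi" by (simp only: of_real_eq_iff)
    then have "inverse (Gamma m * Gamma (1 - m)) = inverse c"
      by (simp add: rGamma_inverse_Gamma c_def)
    then show ?thesis by (simp only: inverse_eq_iff_eq)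
  qed
  have gpos: "Gamma m \<noteq> 0" "Gamma (1 - m) \<noteq> 0" using m Gamma_real_pos[of m] Gamma_real_pos[of "1 - m"] by linarith+
  have E0: "bessel_series \<mu> 0 = rGamma (\<mu> + 1)" for \<mu> :: real 
    using powser_zero[of "\<lambda>k. rGamma (real k + \<mu> + 1) / fact k"] by (simp add: bessel_series_def)
  have Ec: "((bessel_series \<mu> :: real \<Rightarrow> real) \<longlongrightarrow> rGamma (\<mu> + 1)) (at_right 0)" for \<mu>
    using DERIV_isCont[OF bessel_series_deriv[of \<mu> 0]] E0[of \<mu>]
    by (simp add: isCont_def filterlim_at_split)
  have p0: "((\<lambda>y. y powr s) \<longlongrightarrow> 0) (at_right 0)" if "s > 0" for s :: real
    using that by (rule powr_tendsto_0)
  show ?thesis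
  proof -
    have "u y = 0"
    proof (rule linear_system_zero[where u = u and y = y and v = v and a = "\<lambda>y. y powr (m - 1)" and b = "\<lambda>y. y powr (- m)"
          and A = "\<lambda>y. y powr m / m + y powr (1 - m) / (1 - m)"])
      show "(u \<longlongrightarrow> 0) (at_right 0)"
      proof -
        have "(u \<longlongrightarrow> Gamma m - c * (rGamma (- m + 1) - 0 * rGamma (m + 1))) (at_right 0)"
          unfolding u_def using m by (intro tendsto_intros bessel_integral_at_0 Ec p0) auto
        moreover have "Gamma m - c * (rGamma (- m + 1) - 0 * rGamma (m + 1)) = 0"
          using gpos by (simp add: G rGamma_inverse_Gamma)
        ultimately show ?thesis by simp
      qed
      show "(v \<longlongrightarrow> 0) (at_right 0)"
      proof -
        have "(v \<longlongrightarrow> - Gamma (1 - m) - c * (0 * rGamma (1 - m + 1) - rGamma (m - 1 + 1))) (at_right 0)"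
          unfolding v_def using m by (intro tendsto_intros bessel_integral_at_0 Ec p0) auto
        moreover have "- Gamma (1 - m) - c * (0 * rGamma (1 - m + 1) - rGamma (m - 1 + 1)) = 0"
          using gpos by (simp add: G rGamma_inverse_Gamma)
        ultimately show ?thesis by simp
      qed
      show "((\<lambda>y. y powr m / m + y powr (1 - m) / (1 - m)) \<longlongrightarrow> 0 / m + 0 / (1 - m)) (at_right 0)"
        using m by (intro tendsto_intros p0) auto
      fix x :: real assume x: "x > 0"
      show "((\<lambda>y. y powr m / m + y powr (1 - m) / (1 - m)) has_real_derivative \<bar>x powr (m - 1)\<bar> + \<bar>x powr (- m)\<bar>) (at x)"
      proof -
        have "((\<lambda>y. y powr m / m + y powr (1 - m) / (1 - m)) has_real_derivative
            m * x powr (m - 1) / m + (1 - m) * x powr (1 - m - 1) / (1 - m)) (at x)"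
          by (intro DERIV_add DERIV_cdivide has_real_derivative_powr x)
        then show ?thesis using m by simp
      qed
      have px: "x powr m = x powr (m - 1) * x" "x powr (1 - m) = x powr (- m) * x"
        "x powr (m - 1) * x powr (1 - m) = 1" "x powr (- m) * x powr m = 1"
        using x powr_add[of x "m - 1" 1] powr_add[of x "- m" 1] powr_add[of x "m - 1" "1 - m"] powr_add[of x "- m" m]
        by simp_all
      \<comment> \<open>The common algebra of the two differential equations, with \<open>p\<close> and \<open>r\<close> mutually inverse powers of \<open>x\<close>.\<close>
      have alg: "- (p * f) - c * (e - (m * p * e' + p * x * e'')) = p * (- f - c * (r * e - (m * e' + x * e'')))"
        "p * f - c * (m * p * e' + p * x * e'' - e) = p * (f - c * (m * e' + x * e'' - r * e))"
        if "p * r = 1" for p r f m e e' e'' :: real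
      proof -
        have "p * (- f - c * (r * e - (m * e' + x * e''))) = - (p * f) - c * ((p * r) * e - (m * p * e' + p * x * e''))"
          by (simp add: algebra_simps)
        then show "- (p * f) - c * (e - (m * p * e' + p * x * e'')) = p * (- f - c * (r * e - (m * e' + x * e'')))"
          using that by simp
        have "p * (f - c * (m * e' + x * e'' - r * e)) = p * f - c * (m * p * e' + p * x * e'' - (p * r) * e)"
          by (simp add: algebra_simps)
        then show "p * f - c * (m * p * e' + p * x * e'' - e) = p * (f - c * (m * e' + x * e'' - r * e))"
          using that by simp
      qed
      have r1: "bessel_integral (m - 1) x = x powr (m - 1) * bessel_integral (1 - m) x"
        using bessel_integral_reflect[OF x, of "1 - m"] by simp
      have r2: "bessel_integral (- m) x = x powr (- m) * bessel_integral m x"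
        using bessel_integral_reflect[OF x, of m] by simp
      have e1: "bessel_series (m - 1) x = m * bessel_series m x + x * bessel_series (m + 1) x" by (rule bessel_series_rec)
      have e2: "bessel_series (- m) x = (1 - m) * bessel_series (1 - m) x + x * bessel_series (2 - m) x"
        using bessel_series_rec[of "1 - m" x] by simp
      have "(u has_real_derivative - bessel_integral (m - 1) x - c * (bessel_series (- m + 1) x - (m * x powr (m - 1) * bessel_series m x + bessel_series (m + 1) x * x powr m))) (at x)"
        unfolding u_def
        by (intro DERIV_diff DERIV_cmult DERIV_mult bessel_integral_deriv bessel_series_deriv has_real_derivative_powr x)
      also have "- bessel_integral (m - 1) x - c * (bessel_series (- m + 1) x - (m * x powr (m - 1) * bessel_series m x + bessel_series (m + 1) x * x powr m)) = x powr (m - 1) * v x"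
        using alg(1)[OF px(3), of "bessel_integral (1 - m) x" "bessel_series (1 - m) x" m "bessel_series m x" "bessel_series (m + 1) x"]
        unfolding v_def r1 e1 px(1) by (simp add: mult_ac)
      finally show "(u has_real_derivative x powr (m - 1) * v x) (at x)" .
      have "(v has_real_derivative - (- bessel_integral ((1 - m) - 1) x) - c * (((1 - m) * x powr ((1 - m) - 1) * bessel_series (1 - m) x + bessel_series (1 - m + 1) x * x powr (1 - m)) - bessel_series (m - 1 + 1) x)) (at x)"
        unfolding v_def
        by (intro DERIV_diff DERIV_minus DERIV_cmult DERIV_mult bessel_integral_deriv bessel_series_deriv has_real_derivative_powr x)
      also have "- (- bessel_integral ((1 - m) - 1) x) - c * (((1 - m) * x powr ((1 - m) - 1) * bessel_series (1 - m) x + bessel_series (1 - m + 1) x * x powr (1 - m)) - bessel_series (m - 1 + 1) x) = x powr (- m) * u x"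
        using alg(2)[OF px(4), of "bessel_integral m x" "1 - m" "bessel_series (1 - m) x" "bessel_series (2 - m) x" "bessel_series m x"]
        unfolding u_def e2 px(2) by (simp add: mult_ac r2)
      finally show "(v has_real_derivative x powr (- m) * u x) (at x)" .
    qed (use y in simp)
    then show ?thesis by (simp add: u_def c_def)
  qed
qed

definition bessel_K_integral where "bessel_K_integral \<mu> x = 1 / 2 * (x / 2) powr (- \<mu>) * bessel_integral \<mu> (x\<^sup>2 / 4)"
definition bessel_K_quotient where "bessel_K_quotient \<mu> x = pi / 2 * (bessel_I (- \<mu>) x - bessel_I \<mu> x) / sin (\<mu> * pi)"

lemma bessel_K_quotient_eq_integral_01: assumes "0 < \<mu>" "\<mu> < 1" "x > 0" shows "bessel_K_quotient \<mu> x = bessel_K_integral \<mu> x"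
proof -
  have "(x / 2) powr (- \<mu>) * (x\<^sup>2 / 4) powr \<mu> = (x / 2) powr \<mu>"
  proof -
    have "x\<^sup>2 / 4 = (x / 2) powr 2" using assms by (simp add: power_divide)
    then have "(x\<^sup>2 / 4) powr \<mu> = (x / 2) powr (2 * \<mu>)" by (simp add: powr_powr)
    then show ?thesis using assms by (simp flip: powr_add)
  qed
  then have i: "bessel_I \<mu> x = (x / 2) powr (- \<mu>) * ((x\<^sup>2 / 4) powr \<mu> * bessel_series \<mu> (x\<^sup>2 / 4))"
    using assms by (simp add: bessel_I_series mult.assoc[symmetric])
  have b: "bessel_integral \<mu> (x\<^sup>2 / 4) = pi / sin (pi * \<mu>) * (bessel_series (- \<mu>) (x\<^sup>2 / 4) - (x\<^sup>2 / 4) powr \<mu> * bessel_series \<mu> (x\<^sup>2 / 4))"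
    using assms by (intro bessel_integral_series_01) auto
  show ?thesis unfolding bessel_K_quotient_def bessel_K_integral_def i b bessel_I_series[OF assms(3), of "- \<mu>"] mult.commute[of \<mu> pi]
    by (simp add: right_diff_distrib diff_divide_distrib mult_ac)
qed

lemma bessel_K_quotient_minus: "bessel_K_quotient (- \<mu>) x = bessel_K_quotient \<mu> x" by (simp add: bessel_K_quotient_def minus_divide_right[symmetric] algebra_simps diff_divide_distrib)

lemma bessel_K_integral_minus: assumes "x > 0" shows "bessel_K_integral (- \<mu>) x = bessel_K_integral \<mu> x"
proof -
  have "x\<^sup>2 / 4 = (x / 2) powr 2" using assms by (simp add: power_divide)
  then have "(x\<^sup>2 / 4) powr (- \<mu>) = (x / 2) powr (- \<mu>) * (x / 2) powr (- \<mu>)"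
    by (simp add: powr_powr flip: powr_add)
  moreover have "bessel_integral (- \<mu>) (x\<^sup>2 / 4) = (x\<^sup>2 / 4) powr (- \<mu>) * bessel_integral \<mu> (x\<^sup>2 / 4)"
    using assms by (intro bessel_integral_reflect) auto
  moreover have "(x / 2) powr \<mu> * (x / 2) powr (- \<mu>) = 1" using assms by (simp flip: powr_add)
  ultimately show ?thesis by (simp add: bessel_K_integral_def)
qed

lemma bessel_I_rec: assumes "x > 0" shows "bessel_I (s - 1) x - bessel_I (s + 1) x = 2 * s / x * bessel_I s x"
proof -
  have p: "(x / 2) powr (s + 1) = (x / 2) powr (s - 1) * (x\<^sup>2 / 4)" "(x / 2) powr s = (x / 2) powr (s - 1) * (x / 2)"
    using assms by (simp_all add: powr_add powr_diff power2_eq_square)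
  show ?thesis using assms unfolding bessel_I_series[OF assms] bessel_series_rec[of s] p by (simp add: algebra_simps)
qed

lemma bessel_K_quotient_rec: assumes "x > 0" "\<mu> \<notin> \<int>" shows "bessel_K_quotient (\<mu> + 1) x = 2 * \<mu> / x * bessel_K_quotient \<mu> x + bessel_K_quotient (\<mu> - 1) x"
proof -
  have s: "sin ((\<mu> + 1) * pi) = - sin (\<mu> * pi)" "sin ((\<mu> - 1) * pi) = - sin (\<mu> * pi)"
    by (simp_all add: distrib_right left_diff_distrib sin_diff)
  have i: "bessel_I (- (\<mu> + 1)) x = bessel_I (- (\<mu> - 1)) x - 2 * \<mu> / x * bessel_I (- \<mu>) x"
    "bessel_I (\<mu> + 1) x = bessel_I (\<mu> - 1) x - 2 * \<mu> / x * bessel_I \<mu> x"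
    using bessel_I_rec[OF assms(1), of "- \<mu>"] bessel_I_rec[OF assms(1), of \<mu>] by (simp_all add: algebra_simps minus_diff_commute)
  show ?thesis unfolding bessel_K_quotient_def s i by (simp add: algebra_simps diff_divide_distrib add_divide_distrib)
qed
lemma bessel_K_integral_rec: assumes "x > 0" shows "bessel_K_integral (\<mu> + 1) x = 2 * \<mu> / x * bessel_K_integral \<mu> x + bessel_K_integral (\<mu> - 1) x"
proof -
  have p: "(x / 2) powr (- (\<mu> - 1)) = (x / 2) powr (- (\<mu> + 1)) * (x\<^sup>2 / 4)" "(x / 2) powr (- \<mu>) = (x / 2) powr (- (\<mu> + 1)) * (x / 2)"
    using assms by (simp_all add: powr_add powr_diff powr_minus power2_eq_square field_simps)
  have r: "bessel_integral (\<mu> + 1) (x\<^sup>2 / 4) = \<mu> * bessel_integral \<mu> (x\<^sup>2 / 4) + x\<^sup>2 / 4 * bessel_integral (\<mu> - 1) (x\<^sup>2 / 4)"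
    using assms by (intro bessel_integral_rec) auto
  show ?thesis using assms unfolding bessel_K_integral_def r p by (simp add: algebra_simps)
qed

text \<open>
  Upward induction with the three-term recurrence. It needs two starting values: the order \<open>\<mu>\<close> in the unit
  interval, and \<open>\<mu> - 1\<close>, which symmetry reduces to \<open>1 - \<mu>\<close>.
\<close>
lemma bessel_K_quotient_eq_integral_pos: assumes "x > 0" "0 < \<mu>" "\<mu> < 1" shows "bessel_K_quotient (\<mu> + of_nat n) x = bessel_K_integral (\<mu> + of_nat n) x"
proof (induction n rule: less_induct)
  case (less n)
  have nz: "\<mu> + of_nat k \<notin> \<int>" for k 
  proof
    assume "\<mu> + of_nat k \<in> \<int>"
    then have "\<mu> \<in> \<int>" using Ints_diff[of "\<mu> + of_nat k" "of_nat k"] by simp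
    then show False using assms by (auto elim!: Ints_cases)
  qed
  consider "n = 0" | "n = 1" | k where "n = Suc (Suc k)" by (metis One_nat_def not0_implies_Suc)
  then show ?case
  proof cases
    case 1
    then show ?thesis using bessel_K_quotient_eq_integral_01 assms by simp
  next
    case 2
    have "bessel_K_quotient (\<mu> - 1) x = bessel_K_integral (\<mu> - 1) x"
      using bessel_K_quotient_minus[of "1 - \<mu>" x] bessel_K_integral_minus[of x "1 - \<mu>"] bessel_K_quotient_eq_integral_01[of "1 - \<mu>" x] assms by simp
    then show ?thesis using 2 bessel_K_quotient_rec[of x \<mu>] bessel_K_integral_rec[of x \<mu>] nz[of 0] bessel_K_quotient_eq_integral_01 assms by simp
  next
    case 3
    then show ?thesis using bessel_K_quotient_rec[of x "\<mu> + of_nat (Suc k)"] bessel_K_integral_rec[of x "\<mu> + of_nat (Suc k)"] nz[of "Suc k"] less.IH[of "Suc k"] less.IH[of k] assms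
      by (simp add: add_ac)
  qed
qed

lemma bessel_K_quotient_eq_integral: assumes "x > 0" "\<mu> \<notin> \<int>" shows "bessel_K_quotient \<mu> x = bessel_K_integral \<mu> x"
proof -
  have pos: "bessel_K_quotient s x = bessel_K_integral s x" if "s > 0" "s \<notin> \<int>" for s
  proof -
    have "frac s > 0" "frac s < 1" using that by (auto simp: frac_gt_0_iff frac_lt_1)
    moreover have "s = frac s + of_nat (nat \<lfloor>s\<rfloor>)" using that by (simp add: frac_def)
    ultimately show ?thesis using bessel_K_quotient_eq_integral_pos[of x "frac s" "nat \<lfloor>s\<rfloor>"] assms by metis
  qed
  show ?thesis
  proof (cases "\<mu> > 0")
    case False
    then have "- \<mu> > 0" "- \<mu> \<notin> \<int>" using assms Ints_0 by (auto simp: minus_in_Ints_iff not_less less_eq_real_def)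
    then show ?thesis using pos[of "- \<mu>"] bessel_K_quotient_minus bessel_K_integral_minus assms by simp
  qed (use pos assms in auto)
qed

text \<open>
  At an integer order, \<open>bessel_K\<close> is a limit over orders that are not integers, where the quotient agrees
  with the integral; the integral is continuous in the order.
\<close>
lemma bessel_K_eq_integral:
  assumes "x > 0" shows "bessel_K \<nu> x = bessel_K_integral \<nu> x"
proof (cases "\<nu> \<in> \<int>")
  case False
  then show ?thesis using bessel_K_quotient_eq_integral[OF assms] by (simp add: bessel_K_def bessel_K_quotient_def Let_def)
next
  case True
  have "isCont (\<lambda>\<mu>. bessel_K_integral \<mu> x) \<nu>"
    unfolding bessel_K_integral_def using assms by (intro continuous_intros bessel_integral_isCont_order) auto
  then have "((\<lambda>\<mu>. bessel_K_integral \<mu> x) \<longlongrightarrow> bessel_K_integral \<nu> x) (at \<nu>)" by (simp add: isCont_def)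
  moreover have "\<forall>\<^sub>F \<mu> in at \<nu>. bessel_K_integral \<mu> x = bessel_K_quotient \<mu> x"
    unfolding eventually_at
  proof (intro exI[of _ 1] conjI ballI impI)
    fix \<mu> assume "\<mu> \<noteq> \<nu> \<and> dist \<mu> \<nu> < 1"
    then have "\<mu> \<notin> \<int>" using True by (auto elim!: Ints_cases simp: dist_real_def)
    then show "bessel_K_integral \<mu> x = bessel_K_quotient \<mu> x" using bessel_K_quotient_eq_integral[OF assms] by simp
  qed simp
  ultimately have "((\<lambda>\<mu>. bessel_K_quotient \<mu> x) \<longlongrightarrow> bessel_K_integral \<nu> x) (at \<nu>)" by (rule Lim_transform_eventually)
  then have "Lim (at \<nu>) (\<lambda>\<mu>. bessel_K_quotient \<mu> x) = bessel_K_integral \<nu> x" by (intro tendsto_Lim) auto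
  then show ?thesis using True by (simp add: bessel_K_def bessel_K_quotient_def Let_def)
qed

lemma bessel_integral_measurable [measurable]: "bessel_integral \<nu> \<in> borel_measurable borel"
proof -
  have "(\<lambda>y. LINT t|lborel. bessel_kernel \<nu> y t) \<in> borel_measurable borel" unfolding bessel_kernel_def by measurable
  then show ?thesis by (simp add: bessel_integral_def[abs_def])
qed

lemma bessel_integral_isCont: "y > 0 \<Longrightarrow> isCont (bessel_integral \<nu>) y"
  using bessel_integral_deriv by (rule DERIV_isCont)

lemma bessel_K_integral_isCont:
  assumes "x > 0" shows "isCont (bessel_K_integral \<nu>) x"
  unfolding bessel_K_integral_def[abs_def] using assms
  by (intro continuous_intros isCont_o2[where g = "bessel_integral \<nu>", OF _ bessel_integral_isCont]) auto

lemma bessel_K_pos: "x > 0 \<Longrightarrow> bessel_K \<nu> x > 0"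
  by (simp add: bessel_K_eq_integral bessel_K_integral_def bessel_integral_pos)

text \<open>
  This is where the mixture of Gaussians enters: the product of the Bessel function and the power in the potential
  is, up to a constant, the integral of order \<open>\<nu>\<close>.
\<close>
lemma bessel_K_scaled:
  assumes "r > 0" "l > 0"
  shows "bessel_K \<nu> (l * r) * r powr \<nu> = 2 powr (\<nu> - 1) * l powr (- \<nu>) * bessel_integral \<nu> ((l * r)\<^sup>2 / 4)"
proof -
  have e: "1 / 2 * (l * r / 2) powr (- \<nu>) * r powr \<nu> = 2 powr (\<nu> - 1) * l powr (- \<nu>)"
  proof -
    have "(l * r / 2) powr (- \<nu>) = l powr (- \<nu>) * r powr (- \<nu>) * 2 powr \<nu>"
      using assms by (simp add: powr_divide powr_mult powr_minus_divide)
    moreover have "r powr (- \<nu>) * r powr \<nu> = 1" using assms by (simp flip: powr_add)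
    moreover have "2 powr (\<nu> - 1) = 2 powr \<nu> / 2" by (simp add: powr_diff)
    ultimately show ?thesis by (simp add: mult_ac)
  qed
  have "bessel_K \<nu> (l * r) * r powr \<nu> = (1 / 2 * (l * r / 2) powr (- \<nu>) * r powr \<nu>) * bessel_integral \<nu> ((l * r)\<^sup>2 / 4)"
    using assms by (simp add: bessel_K_eq_integral bessel_K_integral_def mult_ac)
  then show ?thesis by (simp only: e)
qed

section \<open>Gaussian moments in the plane\<close>

lemma complex_lborel_pair:
  "distr (lborel \<Otimes>\<^sub>M lborel) borel (\<lambda>p. Complex (fst p) (snd p)) = lborel"
proof (rule lborel_eqI[symmetric])
  have [measurable]: "(\<lambda>p. Complex (fst p) (snd p)) \<in> borel_measurable (lborel \<Otimes>\<^sub>M lborel)"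
    unfolding Complex_eq by measurable
  fix l u :: complex assume le: "\<And>b. b \<in> Basis \<Longrightarrow> l \<bullet> b \<le> u \<bullet> b"
  have le': "Re l \<le> Re u" "Im l \<le> Im u" using le[of 1] le[of \<i>] by (auto simp: Basis_complex_def)
  have pre: "(\<lambda>p. Complex (fst p) (snd p)) -` box l u \<inter> space (lborel \<Otimes>\<^sub>M lborel) = {Re l<..<Re u} \<times> {Im l<..<Im u}"
    by (auto simp: box_def Basis_complex_def space_pair_measure)
  have "emeasure (distr (lborel \<Otimes>\<^sub>M lborel) borel (\<lambda>p. Complex (fst p) (snd p))) (box l u)
     = emeasure (lborel \<Otimes>\<^sub>M lborel) ({Re l<..<Re u} \<times> {Im l<..<Im u})"
    by (subst emeasure_distr) (auto simp: pre)
  also have "\<dots> = ennreal (Re u - Re l) * ennreal (Im u - Im l)"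
    using le' by (subst lborel.emeasure_pair_measure_Times) auto
  also have "\<dots> = ennreal ((Re u - Re l) * (Im u - Im l))"
    using le' by (simp add: ennreal_mult)
  finally show "emeasure (distr (lborel \<Otimes>\<^sub>M lborel) borel (\<lambda>p. Complex (fst p) (snd p))) (box l u) =
      ennreal (prod ((\<bullet>) (u - l)) Basis)"
    by (simp add: Basis_complex_def)
qed simp

lemma measurable_Complex [measurable]: "(\<lambda>p. Complex (fst p) (snd p)) \<in> borel_measurable (lborel \<Otimes>\<^sub>M lborel)"
  unfolding Complex_eq by measurable

lemma integrable_complex_lborel:
  fixes f :: "complex \<Rightarrow> 'b::{banach,second_countable_topology}"
  assumes "f \<in> borel_measurable borel"
  shows "integrable lborel f \<longleftrightarrow> integrable (lborel \<Otimes>\<^sub>M lborel) (\<lambda>p. f (Complex (fst p) (snd p)))"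
  unfolding complex_lborel_pair[symmetric] using assms by (intro integrable_distr_eq) auto

lemma integral_complex_lborel:
  fixes f :: "complex \<Rightarrow> 'b::{banach,second_countable_topology}"
  assumes "f \<in> borel_measurable borel"
  shows "integral\<^sup>L lborel f = (LINT p|(lborel \<Otimes>\<^sub>M lborel). f (Complex (fst p) (snd p)))"
  unfolding complex_lborel_pair[symmetric] using assms by (intro integral_distr) auto

lemma gaussian_line:
  assumes "b > 0"
  shows "integrable lborel (\<lambda>x::real. exp (- b * x\<^sup>2))" "(LINT x|lborel. exp (- b * x\<^sup>2)) = sqrt (pi / b)"
proof -
  define \<sigma> where "\<sigma> = sqrt (1 / (2 * b))"
  have \<sigma>: "\<sigma> > 0" "\<sigma>\<^sup>2 = 1 / (2 * b)" using assms by (auto simp: \<sigma>_def)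
  have eq: "exp (- b * x\<^sup>2) = sqrt (pi / b) * normal_density 0 \<sigma> x" for x
    using assms by (simp add: normal_density_def \<sigma> field_simps)
  show "integrable lborel (\<lambda>x::real. exp (- b * x\<^sup>2))" unfolding eq using \<sigma> by auto
  show "(LINT x|lborel. exp (- b * x\<^sup>2)) = sqrt (pi / b)" unfolding eq using \<sigma> by simp
qed

lemma gaussian_plane:
  assumes "b > 0"
  shows "integrable lborel (\<lambda>z::complex. exp (- b * (cmod z)\<^sup>2))" "(LINT z|lborel. exp (- b * (cmod z)\<^sup>2)) = pi / b"
proof -
  have m: "(\<lambda>z::complex. exp (- b * (cmod z)\<^sup>2)) \<in> borel_measurable borel" by measurable
  have eq: "exp (- b * (cmod (Complex x y))\<^sup>2) = exp (- b * x\<^sup>2) * exp (- b * y\<^sup>2)" for x y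
    by (simp add: cmod_power2 algebra_simps exp_diff flip: exp_add)
  have int: "integrable (lborel \<Otimes>\<^sub>M lborel) (\<lambda>p. exp (- b * (fst p)\<^sup>2) * exp (- b * (snd p)\<^sup>2))"
    by (rule lborel_pair.Fubini_integrable) (use gaussian_line[OF assms] in \<open>auto simp: norm_mult\<close>)
  show "integrable lborel (\<lambda>z::complex. exp (- b * (cmod z)\<^sup>2))"
    unfolding integrable_complex_lborel[OF m] eq by (rule int)
  have "(LINT z|lborel. exp (- b * (cmod z)\<^sup>2)) = (LINT p|(lborel \<Otimes>\<^sub>M lborel). exp (- b * (fst p)\<^sup>2) * exp (- b * (snd p)\<^sup>2))"
    unfolding integral_complex_lborel[OF m] eq ..
  also have "\<dots> = (LINT x|lborel. LINT y|lborel. exp (- b * x\<^sup>2) * exp (- b * y\<^sup>2))"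
    using lborel_pair.integral_fst'[OF int] by simp
  also have "\<dots> = pi / b" using gaussian_line[OF assms] assms by simp
  finally show "(LINT z|lborel. exp (- b * (cmod z)\<^sup>2)) = pi / b" .
qed

lemma power_times_gaussian_bound:
  assumes "a > 0" shows "\<exists>C\<ge>0. \<forall>z::complex. cmod z ^ n * exp (- a * (cmod z)\<^sup>2) \<le> C * exp (- (a / 2) * (cmod z)\<^sup>2)"
proof -
  obtain C where C: "C \<ge> 0" "\<And>x. x > 0 \<Longrightarrow> exp (- x) \<le> C * x powr (- (real n / 2))"
    using exp_neg_le_powr[of "real n / 2"] by auto
  have "cmod z ^ n * exp (- a * (cmod z)\<^sup>2) \<le> (C * (a / 2) powr (- (real n / 2)) + 1) * exp (- (a / 2) * (cmod z)\<^sup>2)" for z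
  proof (cases "z = 0")
    case True
    then show ?thesis using C by (cases n) auto
  next
    case False
    define r where "r = cmod z"
    have r: "r > 0" using False by (simp add: r_def)
    have "exp (- (a / 2 * r\<^sup>2)) \<le> C * (a / 2 * r\<^sup>2) powr (- (real n / 2))" using r assms by (intro C) auto
    also have "(a / 2 * r\<^sup>2) powr (- (real n / 2)) = (a / 2) powr (- (real n / 2)) * (r\<^sup>2) powr (- (real n / 2))"
      by (rule powr_mult)
    also have "(r\<^sup>2) powr (- (real n / 2)) = inverse (r ^ n)"
    proof -
      have "(r\<^sup>2) powr (- (real n / 2)) = (r powr 2) powr (- (real n / 2))" using r by simp
      also have "\<dots> = r powr (- real n)" by (simp add: powr_powr)
      finally show ?thesis using r by (simp add: powr_minus powr_realpow)
    qed
    finally have "r ^ n * exp (- (a / 2 * r\<^sup>2)) \<le> C * (a / 2) powr (- (real n / 2))"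
      using r by (simp add: field_simps)
    then have "r ^ n * exp (- (a / 2 * r\<^sup>2)) \<le> C * (a / 2) powr (- (real n / 2)) + 1" by simp
    then have "r ^ n * exp (- (a / 2 * r\<^sup>2)) * exp (- (a / 2 * r\<^sup>2)) \<le> (C * (a / 2) powr (- (real n / 2)) + 1) * exp (- (a / 2 * r\<^sup>2))"
      by (rule mult_right_mono) simp
    moreover have "exp (- (a / 2 * r\<^sup>2)) * exp (- (a / 2 * r\<^sup>2)) = exp (- a * r\<^sup>2)"
      by (simp flip: exp_add)
    ultimately show ?thesis unfolding r_def by (simp only: mult.assoc minus_mult_left)
  qed
  then show ?thesis using C by (intro exI[of _ "C * (a / 2) powr (- (real n / 2)) + 1"]) auto
qed

definition gaussian_monomial :: "real \<Rightarrow> nat \<Rightarrow> nat \<Rightarrow> complex \<Rightarrow> complex" where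
  "gaussian_monomial a j l z = z ^ j * cnj z ^ l * of_real (exp (- a * (cmod z)\<^sup>2))"

lemma gaussian_monomial_measurable [measurable]: "gaussian_monomial a j l \<in> borel_measurable borel"
  unfolding gaussian_monomial_def[abs_def]
  by (intro borel_measurable_continuous_onI continuous_intros)

lemma gaussian_monomial_bound:
  assumes "a > 0" shows "\<exists>C\<ge>0. \<forall>z. cmod (gaussian_monomial a j l z) \<le> C * exp (- (a / 2) * (cmod z)\<^sup>2)"
  using power_times_gaussian_bound[OF assms, of "j + l"]
  by (simp add: gaussian_monomial_def norm_mult norm_power power_add mult.assoc)

lemma gaussian_monomial_integrable:
  assumes "a > 0" shows "integrable lborel (gaussian_monomial a j l)"
proof -
  obtain C where C: "C \<ge> 0" "\<And>z. cmod (gaussian_monomial a j l z) \<le> C * exp (- (a / 2) * (cmod z)\<^sup>2)"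
    using gaussian_monomial_bound[OF assms] by blast
  have "integrable lborel (\<lambda>z::complex. C * exp (- (a / 2) * (cmod z)\<^sup>2))"
    using gaussian_plane(1)[of "a / 2"] assms by (intro integrable_mult_right) auto
  then show ?thesis
    by (rule Bochner_Integration.integrable_bound) (use C in \<open>auto intro!: AE_I2 order.trans[OF C(2)]\<close>)
qed

lemma integral_line_derivative_zero:
  fixes f g :: "real \<Rightarrow> complex"
  assumes d: "\<And>x. (f has_vector_derivative g x) (at x)" and c: "\<And>x. isCont g x"
    and i: "integrable lborel g"
    and b: "a > 0" "\<And>x. cmod (f x) \<le> C * exp (- a * x\<^sup>2)"
  shows "(LINT x|lborel. g x) = 0"
proof -
  have lim: "((\<lambda>x::real. C * exp (- a * x\<^sup>2)) \<longlongrightarrow> 0) at_top" "((\<lambda>x::real. C * exp (- a * x\<^sup>2)) \<longlongrightarrow> 0) at_bot"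
  proof -
    have "((\<lambda>x::real. exp (- a * x\<^sup>2)) \<longlongrightarrow> 0) at_top" "((\<lambda>x::real. exp (- a * x\<^sup>2)) \<longlongrightarrow> 0) at_bot"
      using b(1) by real_asymp+
    then show "((\<lambda>x::real. C * exp (- a * x\<^sup>2)) \<longlongrightarrow> 0) at_top" "((\<lambda>x::real. C * exp (- a * x\<^sup>2)) \<longlongrightarrow> 0) at_bot"
      by (auto intro: tendsto_mult_right_zero)
  qed
  have "(LBINT x=-\<infinity>..\<infinity>. g x) = 0 - 0"
  proof (rule interval_integral_FTC_integrable[where F = f])
    show "set_integrable lborel (einterval (- \<infinity>) \<infinity>) g" using i by (simp add: set_integrable_def)
    have "(f \<longlongrightarrow> 0) at_top" by (rule Lim_null_comparison[OF _ lim(1)]) (use b in auto)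
    then show "((f \<circ> real_of_ereal) \<longlongrightarrow> 0) (at_left \<infinity>)" by (simp add: ereal_tendsto_simps)
    have "(f \<longlongrightarrow> 0) at_bot" by (rule Lim_null_comparison[OF _ lim(2)]) (use b in auto)
    then show "((f \<circ> real_of_ereal) \<longlongrightarrow> 0) (at_right (- \<infinity>))" by (simp add: ereal_tendsto_simps)
  qed (use d c in auto)
  then show ?thesis by (simp add: interval_lebesgue_integral_def set_lebesgue_integral_def)
qed

text \<open>
  The integrand is the derivative of \<open>z\<^sup>j (cnj z)\<^sup>l exp (- a \<bar>z\<bar>\<^sup>2)\<close> with respect to the conjugate variable, that is
  half the derivative in \<open>x\<close> plus \<open>\<i> / 2\<close> times the derivative in \<open>y\<close>. Each partial derivative has integral 0 along
  almost every line in its direction.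
\<close>
lemma gaussian_monomial_stein:
  assumes a: "a > 0"
  shows "(LINT z|lborel. of_nat l * gaussian_monomial a j (l - 1) z - a * gaussian_monomial a (Suc j) l z) = 0"
proof -
  let ?P = "\<lambda>z. of_nat j * gaussian_monomial a (j - 1) l z + of_nat l * gaussian_monomial a j (l - 1) z"
  \<comment> \<open>The partial derivatives of \<open>gaussian_monomial a j l\<close> in \<open>x\<close> and \<open>y\<close>.\<close>
  define fx where "fx = (\<lambda>z. ?P z - a * (gaussian_monomial a (Suc j) l z + gaussian_monomial a j (Suc l) z))"
  define fy where "fy = (\<lambda>z. \<i> * (of_nat j * gaussian_monomial a (j - 1) l z - of_nat l * gaussian_monomial a j (l - 1) z + a * (gaussian_monomial a (Suc j) l z - gaussian_monomial a j (Suc l) z)))"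
  have ix: "integrable lborel fx" unfolding fx_def using gaussian_monomial_integrable[OF a] by auto
  have iy: "integrable lborel fy" unfolding fy_def using gaussian_monomial_integrable[OF a]
    by (intro integrable_mult_right Bochner_Integration.integrable_add Bochner_Integration.integrable_diff) auto
  have [measurable]: "fx \<in> borel_measurable borel" "fy \<in> borel_measurable borel"
    unfolding fx_def fy_def by measurable
  have cont: "isCont fx z" "isCont fy z" for z
    unfolding fx_def fy_def gaussian_monomial_def by (intro continuous_intros)+
  have real_gm: "gaussian_monomial a j l (Complex x y) = (of_real x + \<i> * of_real y) ^ j * (of_real x - \<i> * of_real y) ^ l * exp (of_real (- a * (x\<^sup>2 + y\<^sup>2)))" for x y j l
    by (simp add: gaussian_monomial_def cmod_power2 Complex_eq exp_of_real[symmetric])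
  have dx: "((\<lambda>x. gaussian_monomial a j l (Complex x y)) has_vector_derivative fx (Complex x y)) (at x)" for x y
  proof -
    have "((\<lambda>x. (x + \<i> * of_real y) ^ j * (x - \<i> * of_real y) ^ l * exp (- of_real a * (x\<^sup>2 + (of_real y)\<^sup>2))) has_field_derivative fx (Complex x y)) (at (of_real x))"
      unfolding fx_def real_gm
      by (rule derivative_eq_intros refl | simp)+ (simp add: algebra_simps power2_eq_square)
    from has_vector_derivative_real_field[OF this]
    show ?thesis unfolding real_gm by (simp add: o_def)
  qed
  have dy: "((\<lambda>y. gaussian_monomial a j l (Complex x y)) has_vector_derivative fy (Complex x y)) (at y)" for x y
  proof -
    have "((\<lambda>y. (of_real x + \<i> * y) ^ j * (of_real x - \<i> * y) ^ l * exp (- of_real a * ((of_real x)\<^sup>2 + y\<^sup>2))) has_field_derivative fy (Complex x y)) (at (of_real y))"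
      unfolding fy_def real_gm
      by (rule derivative_eq_intros refl | simp)+ (simp add: algebra_simps power2_eq_square)
    from has_vector_derivative_real_field[OF this]
    show ?thesis unfolding real_gm by (simp add: o_def)
  qed
  obtain C where C: "C \<ge> 0" "\<And>z. cmod (gaussian_monomial a j l z) \<le> C * exp (- (a / 2) * (cmod z)\<^sup>2)"
    using gaussian_monomial_bound[OF a] by blast
  have bx: "cmod (gaussian_monomial a j l (Complex x y)) \<le> C * exp (- (a / 2) * x\<^sup>2)"
   and by': "cmod (gaussian_monomial a j l (Complex x y)) \<le> C * exp (- (a / 2) * y\<^sup>2)" for x y
    using a C(1) by (auto intro!: order.trans[OF C(2)] mult_left_mono simp: cmod_power2)
  have px: "integrable (lborel \<Otimes>\<^sub>M lborel) (\<lambda>p. fx (Complex (fst p) (snd p)))"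
    and py: "integrable (lborel \<Otimes>\<^sub>M lborel) (\<lambda>p. fy (Complex (fst p) (snd p)))"
    using ix iy by (simp_all add: integrable_complex_lborel)
  have "(LINT z|lborel. fx z) = (LINT y|lborel. LINT x|lborel. fx (Complex x y))"
    using lborel_pair.integral_snd[of "\<lambda>x y. fx (Complex x y)"] px by (simp add: integral_complex_lborel case_prod_beta')
  also have "\<dots> = (LINT y|(lborel :: real measure). 0)"
  proof (rule integral_cong_AE)
    have "AE y in lborel. integrable lborel (\<lambda>x. fx (Complex x y))"
      using lborel_pair.AE_integrable_snd[of "\<lambda>x y. fx (Complex x y)"] px by (simp add: case_prod_beta')
    then show "AE y in lborel. (LINT x|lborel. fx (Complex x y)) = 0"
    proof eventually_elim
      case (elim y)
      show ?case
        by (rule integral_line_derivative_zero[OF dx _ elim, of "a / 2" C])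
           (use a bx cont in \<open>auto intro!: isCont_o2[OF _ cont(1)] simp: Complex_eq intro!: continuous_intros\<close>)
    qed
  qed (auto simp: Complex_eq)
  finally have zx: "(LINT z|lborel. fx z) = 0" by simp
  have "(LINT z|lborel. fy z) = (LINT x|lborel. LINT y|lborel. fy (Complex x y))"
    using lborel_pair.integral_fst'[OF py] by (simp add: integral_complex_lborel)
  also have "\<dots> = (LINT x|(lborel :: real measure). 0)"
  proof (rule integral_cong_AE)
    have "AE x in lborel. integrable lborel (\<lambda>y. fy (Complex x y))"
      using lborel_pair.AE_integrable_fst'[OF py] by simp
    then show "AE x in lborel. (LINT y|lborel. fy (Complex x y)) = 0"
    proof eventually_elim
      case (elim x)
      show ?case
        by (rule integral_line_derivative_zero[OF dy _ elim, of "a / 2" C])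
           (use a by' cont in \<open>auto intro!: isCont_o2[OF _ cont(2)] simp: Complex_eq intro!: continuous_intros\<close>)
    qed
  qed (auto simp: Complex_eq)
  finally have zy: "(LINT z|lborel. fy z) = 0" by simp
  have "of_nat l * gaussian_monomial a j (l - 1) z - a * gaussian_monomial a (Suc j) l z = (1 / 2) * (fx z + \<i> * fy z)" for z
    by (simp add: fx_def fy_def algebra_simps)
  then have "(LINT z|lborel. of_nat l * gaussian_monomial a j (l - 1) z - a * gaussian_monomial a (Suc j) l z) = (LINT z|lborel. (1 / 2) * (fx z + \<i> * fy z))"
    by (simp only:)
  also have "\<dots> = (1 / 2) * ((LINT z|lborel. fx z) + \<i> * (LINT z|lborel. fy z))"
    using ix iy by simp
  finally have "(LINT z|lborel. of_nat l * gaussian_monomial a j (l - 1) z - a * gaussian_monomial a (Suc j) l z) = (1 / 2) * ((LINT z|lborel. fx z) + \<i> * (LINT z|lborel. fy z))" .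
  then show ?thesis using zx zy by simp
qed

lemma gaussian_monomial_area_integrable: "a > 0 \<Longrightarrow> integrable area_measure (gaussian_monomial a j l)"
  by (simp add: integrable_area gaussian_monomial_integrable)

text \<open>
  The Stein identity lowers both exponents by one at the cost of the factor \<open>l / a\<close>, and conjugation
  exchanges them. So all moments reduce to the total mass, and those with \<open>j \<noteq> l\<close> to 0.
\<close>
lemma gaussian_monomial_moment:
  assumes a: "a > 0"
  shows "(LINT z|area_measure. gaussian_monomial a j l z) = (if j = l then fact j / of_real a ^ Suc j else 0)"
proof -
  define I where "I = (\<lambda>j l. LINT z|area_measure. gaussian_monomial a j l z)"
  have Ie: "I j l = (LINT z|lborel. gaussian_monomial a j l z) /\<^sub>R pi" for j l
    by (simp add: I_def integral_area)
  have rec: "I (Suc j) l = of_nat l / a * I j (l - 1)" for j l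
  proof -
    have "of_nat l * (LINT z|lborel. gaussian_monomial a j (l - 1) z) - a * (LINT z|lborel. gaussian_monomial a (Suc j) l z) = 0"
      using gaussian_monomial_stein[OF a, of l j] gaussian_monomial_integrable[OF a] by (subst (asm) Bochner_Integration.integral_diff) auto
    then have "(LINT z|lborel. gaussian_monomial a (Suc j) l z) = of_nat l / a * (LINT z|lborel. gaussian_monomial a j (l - 1) z)"
      using a by (simp add: field_simps)
    then show ?thesis by (simp add: Ie)
  qed
  have cj: "I j l = cnj (I l j)" for j l
  proof -
    have "I j l = (LINT z|area_measure. cnj (gaussian_monomial a l j z))" unfolding I_def by (simp add: gaussian_monomial_def[abs_def] mult_ac)
    then show ?thesis by (simp add: I_def)
  qed
  have I00: "I 0 0 = 1 / of_real a"
  proof -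
    have "(LINT z|lborel. gaussian_monomial a 0 0 z) = (LINT z|lborel. complex_of_real (exp (- a * (cmod z)\<^sup>2)))"
      by (simp add: gaussian_monomial_def)
    also have "\<dots> = of_real (LINT z|lborel. exp (- a * (cmod (z::complex))\<^sup>2))" by (rule integral_complex_of_real)
    also have "\<dots> = of_real (pi / a)" by (simp only: gaussian_plane(2)[OF a])
    finally show ?thesis by (simp add: Ie scaleR_conv_of_real field_simps)
  qed
  have "I j l = (if j = l then fact j / of_real a ^ Suc j else 0)"
  proof (induction j arbitrary: l)
    case 0
    show ?case
    proof (cases l)
      case (Suc l')
      have "I 0 l = cnj (I (Suc l') 0)" using cj[of 0 l] Suc by simp
      then show ?thesis using rec[of l' 0] Suc by simp
    qed (simp add: I00)
  next
    case (Suc j)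
    show ?case
      by (cases l) (simp_all add: rec Suc.IH)
  qed
  then show ?thesis by (simp add: I_def)
qed

lemma area_translate:
  fixes f :: "complex \<Rightarrow> complex"
  assumes [measurable]: "f \<in> borel_measurable borel"
  shows "(LINT z|area_measure. f (b + z)) = (LINT z|area_measure. f z)"
    and "integrable area_measure (\<lambda>z. f (b + z)) \<longleftrightarrow> integrable area_measure f"
proof -
  have "(LINT z|lborel. f z) = (LINT z|distr lborel borel ((+) b). f z)" by (simp add: lborel_distr_plus)
  also have "\<dots> = (LINT z|lborel. f (b + z))" by (subst integral_distr) auto
  finally show "(LINT z|area_measure. f (b + z)) = (LINT z|area_measure. f z)"
    by (simp add: integral_area)
  have "integrable lborel f = integrable (distr lborel borel ((+) b)) f" by (simp add: lborel_distr_plus)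
  also have "\<dots> = integrable lborel (\<lambda>z. f (b + z))" by (subst integrable_distr_eq) auto
  finally show "integrable area_measure (\<lambda>z. f (b + z)) \<longleftrightarrow> integrable area_measure f"
    by (simp add: integrable_area)
qed

definition tilted_monomial :: "real \<Rightarrow> nat \<Rightarrow> nat \<Rightarrow> real \<Rightarrow> complex \<Rightarrow> complex" where
  "tilted_monomial \<alpha> k m t z = z ^ k * cnj z ^ m * of_real (exp (\<alpha> * Re z - (cmod z)\<^sup>2 / (4 * t)))"

definition tilted_moment :: "real \<Rightarrow> nat \<Rightarrow> nat \<Rightarrow> real \<Rightarrow> real" where
  "tilted_moment \<alpha> k m t = (\<Sum>j\<le>k. real (k choose j) * real (m choose j) * fact j * (4 * t) ^ Suc j * (2 * \<alpha> * t) ^ (k - j) * (2 * \<alpha> * t) ^ (m - j) * exp (\<alpha>\<^sup>2 * t))"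

text \<open>
  Completing the square, \<open>\<alpha> Re z - \<bar>z\<bar>\<^sup>2 / (4 t)\<close> becomes a centred quadratic after translation by \<open>b = 2 \<alpha> t\<close>, plus
  the constant \<open>\<alpha>\<^sup>2 t\<close>. The powers of \<open>b + z\<close> are then expanded binomially.
\<close>
lemma tilted_monomial_moment:
  assumes t: "t > 0"
  shows "integrable area_measure (tilted_monomial \<alpha> k m t)" "(LINT z|area_measure. tilted_monomial \<alpha> k m t z) = of_real (tilted_moment \<alpha> k m t)"
proof -
  define a where "a = 1 / (4 * t)"
  have a: "a > 0" using t by (simp add: a_def)
  define b where "b = complex_of_real (2 * \<alpha> * t)"
  have [measurable]: "tilted_monomial \<alpha> k m t \<in> borel_measurable borel"
    unfolding tilted_monomial_def[abs_def] by (intro borel_measurable_continuous_onI continuous_intros) (use t in auto)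
  have cb: "cnj b = b" by (simp add: b_def)
  have e: "\<alpha> * Re (b + z) - (cmod (b + z))\<^sup>2 / (4 * t) = - a * (cmod z)\<^sup>2 + \<alpha>\<^sup>2 * t" for z
    using t unfolding cmod_power2 by (simp add: a_def b_def power2_eq_square field_simps)
  have expand: "tilted_monomial \<alpha> k m t (b + z) = (\<Sum>j\<le>k. \<Sum>l\<le>m. (of_nat (k choose j) * of_nat (m choose l) * b ^ (k - j) * b ^ (m - l) * of_real (exp (\<alpha>\<^sup>2 * t))) * gaussian_monomial a j l z)" for z
  proof -
    have "tilted_monomial \<alpha> k m t (b + z) = (z + b) ^ k * (cnj z + b) ^ m * (of_real (exp (- a * (cmod z)\<^sup>2)) * of_real (exp (\<alpha>\<^sup>2 * t)))"
      unfolding tilted_monomial_def e exp_add by (simp add: cb add.commute)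
    also have "\<dots> = (\<Sum>j\<le>k. of_nat (k choose j) * z ^ j * b ^ (k - j)) * (\<Sum>l\<le>m. of_nat (m choose l) * cnj z ^ l * b ^ (m - l)) * (of_real (exp (- a * (cmod z)\<^sup>2)) * of_real (exp (\<alpha>\<^sup>2 * t)))"
      by (simp only: binomial_ring)
    also have "\<dots> = (\<Sum>j\<le>k. \<Sum>l\<le>m. (of_nat (k choose j) * of_nat (m choose l) * b ^ (k - j) * b ^ (m - l) * of_real (exp (\<alpha>\<^sup>2 * t))) * gaussian_monomial a j l z)"
      unfolding sum_product unfolding sum_distrib_right by (intro sum.cong refl) (simp add: gaussian_monomial_def mult_ac)
    finally show ?thesis .
  qed
  have "integrable area_measure (\<lambda>z. tilted_monomial \<alpha> k m t (b + z))"
    unfolding expand using gaussian_monomial_area_integrable[OF a] by (intro Bochner_Integration.integrable_sum integrable_mult_right)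
  then show "integrable area_measure (tilted_monomial \<alpha> k m t)" by (subst (asm) area_translate) auto
  have "(LINT z|area_measure. tilted_monomial \<alpha> k m t z) = (LINT z|area_measure. tilted_monomial \<alpha> k m t (b + z))"
    by (rule area_translate(1)[symmetric]) simp
  also have "\<dots> = (\<Sum>j\<le>k. \<Sum>l\<le>m. (of_nat (k choose j) * of_nat (m choose l) * b ^ (k - j) * b ^ (m - l) * of_real (exp (\<alpha>\<^sup>2 * t))) * (LINT z|area_measure. gaussian_monomial a j l z))"
    unfolding expand using gaussian_monomial_area_integrable[OF a]
    by (subst Bochner_Integration.integral_sum, intro Bochner_Integration.integrable_sum integrable_mult_right, simp,
        intro sum.cong refl, subst Bochner_Integration.integral_sum, intro integrable_mult_right, simp, simp)
  also have "\<dots> = (\<Sum>j\<le>k. of_nat (k choose j) * of_nat (m choose j) * b ^ (k - j) * b ^ (m - j) * of_real (exp (\<alpha>\<^sup>2 * t)) * (fact j / of_real a ^ Suc j))"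
  proof (intro sum.cong refl)
    fix j
    have "(\<Sum>l\<le>m. (of_nat (k choose j) * of_nat (m choose l) * b ^ (k - j) * b ^ (m - l) * of_real (exp (\<alpha>\<^sup>2 * t))) * (LINT z|area_measure. gaussian_monomial a j l z))
      = (\<Sum>l\<le>m. if l = j then (of_nat (k choose j) * of_nat (m choose j) * b ^ (k - j) * b ^ (m - j) * of_real (exp (\<alpha>\<^sup>2 * t))) * (fact j / of_real a ^ Suc j) else 0)"
      by (intro sum.cong refl) (simp add: gaussian_monomial_moment[OF a])
    also have "\<dots> = of_nat (k choose j) * of_nat (m choose j) * b ^ (k - j) * b ^ (m - j) * of_real (exp (\<alpha>\<^sup>2 * t)) * (fact j / of_real a ^ Suc j)"
      by (cases "j \<le> m") (simp_all add: sum.delta)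
    finally show "(\<Sum>l\<le>m. (of_nat (k choose j) * of_nat (m choose l) * b ^ (k - j) * b ^ (m - l) * of_real (exp (\<alpha>\<^sup>2 * t))) * (LINT z|area_measure. gaussian_monomial a j l z))
      = of_nat (k choose j) * of_nat (m choose j) * b ^ (k - j) * b ^ (m - j) * of_real (exp (\<alpha>\<^sup>2 * t)) * (fact j / of_real a ^ Suc j)" .
  qed
  also have "\<dots> = of_real (tilted_moment \<alpha> k m t)"
    unfolding tilted_moment_def of_real_sum using t
    by (intro sum.cong refl) (simp add: b_def a_def power_divide mult_ac)
  finally show "(LINT z|area_measure. tilted_monomial \<alpha> k m t z) = of_real (tilted_moment \<alpha> k m t)" .
qed

lemma area_scale:
  fixes f :: "complex \<Rightarrow> complex"
  assumes [measurable]: "f \<in> borel_measurable borel" and l: "l > 0"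
  shows "(LINT z|area_measure. f (of_real l * z)) = (LINT z|area_measure. f z) / of_real (l\<^sup>2)"
    and "integrable area_measure f \<Longrightarrow> integrable area_measure (\<lambda>z. f (of_real l * z))"
proof -
  have L: "lborel = density (distr lborel borel (\<lambda>z::complex. 0 + l *\<^sub>R z)) (\<lambda>_. ennreal (l\<^sup>2))"
    using lborel_affine[of l "0::complex"] l by simp
  have "(LINT z|lborel. f z) = (LINT z|density (distr lborel borel (\<lambda>z::complex. 0 + l *\<^sub>R z)) (\<lambda>_. ennreal (l\<^sup>2)). f z)"
    using L by simp
  also have "\<dots> = (LINT z|distr lborel borel (\<lambda>z::complex. 0 + l *\<^sub>R z). l\<^sup>2 *\<^sub>R f z)"
    by (rule integral_density) auto
  also have "\<dots> = (LINT z|lborel. l\<^sup>2 *\<^sub>R f (of_real l * z))"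
    by (subst integral_distr) (auto simp: scaleR_conv_of_real)
  finally have "(LINT z|lborel. f z) = l\<^sup>2 *\<^sub>R (LINT z|lborel. f (of_real l * z))" by simp
  then show "(LINT z|area_measure. f (of_real l * z)) = (LINT z|area_measure. f z) / of_real (l\<^sup>2)"
    using l by (simp add: integral_area scaleR_conv_of_real field_simps)
  assume "integrable area_measure f"
  then have "integrable lborel f" by (simp add: integrable_area)
  then have "integrable (density (distr lborel borel (\<lambda>z::complex. 0 + l *\<^sub>R z)) (\<lambda>_. ennreal (l\<^sup>2))) f" using L by simp
  then have "integrable (distr lborel borel (\<lambda>z::complex. 0 + l *\<^sub>R z)) (\<lambda>z. l\<^sup>2 *\<^sub>R f z)"
    by (subst (asm) integrable_density) auto
  then have "integrable lborel (\<lambda>z. l\<^sup>2 *\<^sub>R f (of_real l * z))"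
    by (subst (asm) integrable_distr_eq) (auto simp: scaleR_conv_of_real)
  then have "integrable lborel (\<lambda>z. (1 / l\<^sup>2) *\<^sub>R (l\<^sup>2 *\<^sub>R f (of_real l * z)))" by (rule integrable_scaleR_right)
  then show "integrable area_measure (\<lambda>z. f (of_real l * z))"
    using l by (simp add: integrable_area)
qed

section \<open>Moments of the Bessel weight\<close>

lemma gamma_integral_scaled:
  fixes s c :: real
  assumes s: "s > 0" and c: "c > 0"
  shows "integrable lborel (\<lambda>t. indicator {0<..} t * (t powr (s - 1) * exp (- c * t)))"
    and "(LINT t|lborel. indicator {0<..} t * (t powr (s - 1) * exp (- c * t))) = Gamma s / c powr s"
proof -
  let ?g = "\<lambda>t. indicator {0<..} t * (t powr (s - 1) * exp (- t))"
  have eq: "indicator {0<..} t * (t powr (s - 1) * exp (- c * t)) = c powr (1 - s) * ?g (0 + c * t)" for t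
  proof (cases "t > 0")
    case True
    have "c * t > 0" using c True by (rule mult_pos_pos)
    moreover have "(c * t) powr (s - 1) = c powr (s - 1) * t powr (s - 1)" by (rule powr_mult)
    moreover have "c powr (1 - s) * c powr (s - 1) = 1" using c by (simp flip: powr_add)
    ultimately show ?thesis using True by (simp add: mult.assoc[symmetric])
  qed (use c in \<open>auto simp: indicator_def zero_less_mult_iff\<close>)
  have "integrable lborel (\<lambda>t. ?g (0 + c * t))"
    using lborel_integrable_real_affine[OF gamma_integral(1)[OF s], of c 0] c by simp
  then show "integrable lborel (\<lambda>t. indicator {0<..} t * (t powr (s - 1) * exp (- c * t)))"
    unfolding eq by (rule integrable_mult_right)
  have "Gamma s = c * (LINT t|lborel. ?g (0 + c * t))"
    using lborel_integral_real_affine[of c ?g 0] c gamma_integral(2)[OF s] by simp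
  then have "(LINT t|lborel. ?g (0 + c * t)) = Gamma s / c" using c by simp
  then have "(LINT t|lborel. c powr (1 - s) * ?g (0 + c * t)) = c powr (1 - s) * (Gamma s / c)"
    by (simp only: integral_mult_right_zero)
  also have "\<dots> = Gamma s / c powr s" using c by (simp add: powr_diff)
  finally show "(LINT t|lborel. indicator {0<..} t * (t powr (s - 1) * exp (- c * t))) = Gamma s / c powr s"
    unfolding eq .
qed

text \<open>
  Up to the factor \<open>2\<^sup>1\<^sup>-\<^sup>\<nu>\<close> this is \<open>\<bar>z\<bar>\<^sup>\<nu> K\<^sub>\<nu>(\<bar>z\<bar>) exp (\<alpha> Re z)\<close> for \<open>z \<noteq> 0\<close>.
\<close>
definition bessel_weight :: "real \<Rightarrow> real \<Rightarrow> complex \<Rightarrow> real" where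
  "bessel_weight \<nu> \<alpha> z = bessel_integral \<nu> ((cmod z)\<^sup>2 / 4) * exp (\<alpha> * Re z)"

text \<open>
  Only \<open>j \<le> min k m\<close> contributes, so the truncated differences are harmless. The exponent
  \<open>j + (k - j) + (m - j)\<close> is \<open>k + m - j\<close>, written in the form in which it arises from powers of \<open>t\<close>.
\<close>
definition weighted_moment :: "real \<Rightarrow> real \<Rightarrow> nat \<Rightarrow> nat \<Rightarrow> real" where
  "weighted_moment \<nu> \<alpha> k m = (\<Sum>j\<le>k. real (k choose j) * real (m choose j) * fact j * 4 ^ Suc j * (2 * \<alpha>) ^ (k - j) * (2 * \<alpha>) ^ (m - j) *
     (Gamma (\<nu> + 1 + real (j + (k - j) + (m - j))) / (1 - \<alpha>\<^sup>2) powr (\<nu> + 1 + real (j + (k - j) + (m - j)))))"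

lemma tilted_moment_gamma:
  assumes \<nu>: "\<nu> > -1" and \<alpha>: "\<bar>\<alpha>\<bar> < 1"
  shows "integrable lborel (\<lambda>t. indicator {0<..} t * (t powr (\<nu> - 1) * exp (- t)) * tilted_moment \<alpha> k m t)"
    and "(LINT t|lborel. indicator {0<..} t * (t powr (\<nu> - 1) * exp (- t)) * tilted_moment \<alpha> k m t) = weighted_moment \<nu> \<alpha> k m"
proof -
  have s: "1 - \<alpha>\<^sup>2 > 0" using \<alpha> by (simp add: abs_square_less_1)
  define p where "p = (\<lambda>j. \<nu> + 1 + real (j + (k - j) + (m - j)))"
  have p: "p j > 0" for j using \<nu> by (simp add: p_def)
  define C where "C = (\<lambda>j. real (k choose j) * real (m choose j) * fact j * 4 ^ Suc j * (2 * \<alpha>) ^ (k - j) * (2 * \<alpha>) ^ (m - j))"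
  have eq: "indicator {0<..} t * (t powr (\<nu> - 1) * exp (- t)) * tilted_moment \<alpha> k m t =
    (\<Sum>j\<le>k. C j * (indicator {0<..} t * (t powr (p j - 1) * exp (- (1 - \<alpha>\<^sup>2) * t))))" for t
  proof (cases "t > 0")
    case True
    have "t powr (p j - 1) * exp (- (1 - \<alpha>\<^sup>2) * t) = t powr (\<nu> - 1) * exp (- t) * (t * t ^ j * t ^ (k - j) * t ^ (m - j) * exp (\<alpha>\<^sup>2 * t))" for j
    proof -
      have "t powr (p j - 1) = t powr ((\<nu> - 1) + real (Suc (j + (k - j) + (m - j))))" by (simp add: p_def algebra_simps)
      also have "\<dots> = t powr (\<nu> - 1) * t ^ Suc (j + (k - j) + (m - j))" unfolding powr_add using True by (simp only: powr_realpow)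
      finally have "t powr (p j - 1) = t powr (\<nu> - 1) * (t * t ^ j * t ^ (k - j) * t ^ (m - j))" by (simp only: power_Suc power_add mult.assoc)
      moreover have "exp (- (1 - \<alpha>\<^sup>2) * t) = exp (- t) * exp (\<alpha>\<^sup>2 * t)" by (simp add: algebra_simps flip: exp_add)
      ultimately show ?thesis by (simp add: mult_ac)
    qed
    then show ?thesis using True unfolding tilted_moment_def sum_distrib_left
      by (intro sum.cong refl) (simp add: C_def power_mult_distrib mult_ac)
  qed simp
  show "integrable lborel (\<lambda>t. indicator {0<..} t * (t powr (\<nu> - 1) * exp (- t)) * tilted_moment \<alpha> k m t)"
    unfolding eq by (intro Bochner_Integration.integrable_sum integrable_mult_right gamma_integral_scaled p s)
  show "(LINT t|lborel. indicator {0<..} t * (t powr (\<nu> - 1) * exp (- t)) * tilted_moment \<alpha> k m t) = weighted_moment \<nu> \<alpha> k m"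
    unfolding eq
    by (subst Bochner_Integration.integral_sum, intro integrable_mult_right gamma_integral_scaled p s)
       (simp only: integral_mult_right_zero gamma_integral_scaled(2)[OF p s], simp only: weighted_moment_def C_def p_def)
qed

text \<open>
  Fubini's theorem for the mixture of tilted Gaussians. Joint integrability follows from
  \<open>\<bar>z\<bar>\<^sup>k\<^sup>+\<^sup>m \<le> \<bar>z\<bar>\<^sup>2\<^sup>k + \<bar>z\<bar>\<^sup>2\<^sup>m\<close>, since the right-hand side consists of monomials whose moments are known.
  The factor \<open>exp (\<alpha>\<^sup>2 t)\<close> in the tilted moments is beaten by \<open>exp (- t)\<close> because \<open>\<bar>\<alpha>\<bar> < 1\<close>.
\<close>
lemma bessel_weight_moment:
  assumes \<nu>: "\<nu> > -1" and \<alpha>: "\<bar>\<alpha>\<bar> < 1"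
  shows "integrable area_measure (\<lambda>z. bessel_weight \<nu> \<alpha> z * (z ^ k * cnj z ^ m))"
    and "(LINT z|area_measure. bessel_weight \<nu> \<alpha> z * (z ^ k * cnj z ^ m)) = of_real (weighted_moment \<nu> \<alpha> k m)"
proof -
  interpret area: sigma_finite_measure area_measure by (rule sigma_finite_area)
  interpret P: pair_sigma_finite lborel area_measure ..
  define d where "d = (\<lambda>t. indicator {0<..} t * (t powr (\<nu> - 1) * exp (- t)))"
  define f where "f = (\<lambda>(t, z). of_real (d t) * tilted_monomial \<alpha> k m t z)"
  have dm [measurable]: "d \<in> borel_measurable borel" unfolding d_def by measurable
  have d0: "d t \<ge> 0" for t by (simp add: d_def)
  have [measurable]: "cnj \<in> borel_measurable borel" "Re \<in> borel_measurable borel"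
    by (intro borel_measurable_continuous_onI continuous_intros)+
  have fm [measurable]: "f \<in> borel_measurable (lborel \<Otimes>\<^sub>M area_measure)"
    unfolding f_def tilted_monomial_def by measurable
  have fz: "f (t, z) = of_real (bessel_kernel \<nu> ((cmod z)\<^sup>2 / 4) t) * (of_real (exp (\<alpha> * Re z)) * (z ^ k * cnj z ^ m))" for t z
  proof (cases "t > 0")
    case True
    have "exp (- t) * exp (\<alpha> * Re z - (cmod z)\<^sup>2 / (4 * t)) = exp (- t - (cmod z)\<^sup>2 / 4 / t) * exp (\<alpha> * Re z)"
      by (simp flip: exp_add)
    then have "d t * exp (\<alpha> * Re z - (cmod z)\<^sup>2 / (4 * t)) = bessel_kernel \<nu> ((cmod z)\<^sup>2 / 4) t * exp (\<alpha> * Re z)"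
      using True by (simp add: d_def bessel_kernel_def mult.assoc)
    then have "complex_of_real (d t) * of_real (exp (\<alpha> * Re z - (cmod z)\<^sup>2 / (4 * t))) = of_real (bessel_kernel \<nu> ((cmod z)\<^sup>2 / 4) t) * of_real (exp (\<alpha> * Re z))"
      by (simp only: of_real_mult[symmetric])
    then have "(complex_of_real (d t) * of_real (exp (\<alpha> * Re z - (cmod z)\<^sup>2 / (4 * t)))) * (z ^ k * cnj z ^ m) =
        (of_real (bessel_kernel \<nu> ((cmod z)\<^sup>2 / 4) t) * of_real (exp (\<alpha> * Re z))) * (z ^ k * cnj z ^ m)" by (simp only:)
    then show ?thesis unfolding f_def tilted_monomial_def prod.case by (simp only: mult_ac)
  qed (simp add: f_def d_def bessel_kernel_def)
  have int1: "integrable area_measure (\<lambda>z. f (t, z))" for t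
    using tilted_monomial_moment(1)[of t \<alpha> k m] by (cases "t > 0") (auto simp: f_def d_def)
  have bound: "(LINT z|area_measure. norm (f (t, z))) \<le> d t * tilted_moment \<alpha> k k t + d t * tilted_moment \<alpha> m m t" for t
  proof (cases "t > 0")
    case True
    have re: "cmod (tilted_monomial \<alpha> r r t z) = Re (tilted_monomial \<alpha> r r t z)" for r z
    proof -
      have "tilted_monomial \<alpha> r r t z = of_real ((cmod z)\<^sup>2 ^ r * exp (\<alpha> * Re z - (cmod z)\<^sup>2 / (4 * t)))"
        unfolding tilted_monomial_def of_real_mult power_mult_distrib[symmetric] complex_norm_square[symmetric] of_real_power ..
      then show ?thesis by (simp only: norm_of_real Re_complex_of_real) simp
    qed
    have ir: "integrable area_measure (\<lambda>z. cmod (tilted_monomial \<alpha> r r t z))"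
      "(LINT z|area_measure. cmod (tilted_monomial \<alpha> r r t z)) = tilted_moment \<alpha> r r t" for r
    proof -
      show "integrable area_measure (\<lambda>z. cmod (tilted_monomial \<alpha> r r t z))"
        by (intro integrable_norm tilted_monomial_moment True)
      show "(LINT z|area_measure. cmod (tilted_monomial \<alpha> r r t z)) = tilted_moment \<alpha> r r t"
        unfolding re using tilted_monomial_moment[OF True, of \<alpha> r r] by simp
    qed
    have "(LINT z|area_measure. norm (f (t, z))) \<le> (LINT z|area_measure. d t * cmod (tilted_monomial \<alpha> k k t z) + d t * cmod (tilted_monomial \<alpha> m m t z))"
    proof (rule integral_mono)
      fix z :: complex
      have nt: "cmod (tilted_monomial \<alpha> k m t z) = (cmod z ^ k * cmod z ^ m) * exp (\<alpha> * Re z - (cmod z)\<^sup>2 / (4 * t))" for k m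
        by (simp add: tilted_monomial_def norm_mult norm_power)
      have "cmod z ^ k * cmod z ^ m \<le> cmod z ^ k * cmod z ^ k + cmod z ^ m * cmod z ^ m"
      proof -
        have 0: "0 \<le> cmod z ^ k * cmod z ^ m" by simp
        have "0 \<le> (cmod z ^ k - cmod z ^ m)\<^sup>2" by simp
        then have "2 * (cmod z ^ k * cmod z ^ m) \<le> cmod z ^ k * cmod z ^ k + cmod z ^ m * cmod z ^ m"
          by (simp add: power2_eq_square algebra_simps)
        with 0 show ?thesis by linarith
      qed
      then have "(cmod z ^ k * cmod z ^ m) * exp (\<alpha> * Re z - (cmod z)\<^sup>2 / (4 * t)) \<le> (cmod z ^ k * cmod z ^ k + cmod z ^ m * cmod z ^ m) * exp (\<alpha> * Re z - (cmod z)\<^sup>2 / (4 * t))"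
        by (rule mult_right_mono) simp
      then have "d t * cmod (tilted_monomial \<alpha> k m t z) \<le> d t * (cmod (tilted_monomial \<alpha> k k t z) + cmod (tilted_monomial \<alpha> m m t z))"
        by (intro mult_left_mono d0) (simp only: nt distrib_right)
      then show "norm (f (t, z)) \<le> d t * cmod (tilted_monomial \<alpha> k k t z) + d t * cmod (tilted_monomial \<alpha> m m t z)"
        using d0[of t] by (simp add: f_def norm_mult distrib_left)
    qed (use int1[of t] ir in auto)
    also have "\<dots> = d t * tilted_moment \<alpha> k k t + d t * tilted_moment \<alpha> m m t" using ir by simp
    finally show ?thesis .
  qed (simp add: f_def d_def)
  have F: "integrable (lborel \<Otimes>\<^sub>M area_measure) f"
  proof (rule P.Fubini_integrable[OF fm])
    have "integrable lborel (\<lambda>t. d t * tilted_moment \<alpha> k k t + d t * tilted_moment \<alpha> m m t)"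
      using tilted_moment_gamma(1)[OF \<nu> \<alpha>] unfolding d_def by (intro Bochner_Integration.integrable_add)
    then show "integrable lborel (\<lambda>t. LINT z|area_measure. norm (f (t, z)))"
    proof (rule Bochner_Integration.integrable_bound)
      show "AE t in lborel. norm (LINT z|area_measure. norm (f (t, z))) \<le> norm (d t * tilted_moment \<alpha> k k t + d t * tilted_moment \<alpha> m m t)"
      proof (rule AE_I2)
        fix t
        have "0 \<le> (LINT z|area_measure. norm (f (t, z)))" by (intro integral_nonneg_AE) auto
        then show "norm (LINT z|area_measure. norm (f (t, z))) \<le> norm (d t * tilted_moment \<alpha> k k t + d t * tilted_moment \<alpha> m m t)"
          using bound[of t] by simp
      qed
    qed measurable
    show "AE t in lborel. integrable area_measure (\<lambda>z. f (t, z))" using int1 by simp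
  qed
  have inner: "(LINT t|lborel. f (t, z)) = bessel_weight \<nu> \<alpha> z * (z ^ k * cnj z ^ m)" if "z \<noteq> 0" for z
  proof -
    have "(LINT t|lborel. f (t, z)) = (LINT t|lborel. complex_of_real (bessel_kernel \<nu> ((cmod z)\<^sup>2 / 4) t) * (exp (\<alpha> * Re z) * (z ^ k * cnj z ^ m)))"
      by (simp only: fz)
    also have "\<dots> = (LINT t|lborel. complex_of_real (bessel_kernel \<nu> ((cmod z)\<^sup>2 / 4) t)) * (exp (\<alpha> * Re z) * (z ^ k * cnj z ^ m))"
      by (rule integral_mult_left_zero)
    also have "(LINT t|lborel. complex_of_real (bessel_kernel \<nu> ((cmod z)\<^sup>2 / 4) t)) = complex_of_real (bessel_integral \<nu> ((cmod z)\<^sup>2 / 4))"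
      unfolding bessel_integral_def by (rule integral_complex_of_real)
    finally show ?thesis by (simp add: bessel_weight_def mult_ac)
  qed
  have AE0: "AE z in area_measure. z \<noteq> (0::complex)"
  proof -
    have "AE z in area_measure. z \<notin> {0::complex}"
      by (rule AE_not_in) (simp add: null_sets_def emeasure_area)
    then show ?thesis by simp
  qed
  have wm: "bessel_weight \<nu> \<alpha> \<in> borel_measurable borel"
    unfolding bessel_weight_def[abs_def] bessel_integral_def bessel_kernel_def by measurable
  have AE: "AE z in area_measure. (LINT t|lborel. f (t, z)) = bessel_weight \<nu> \<alpha> z * (z ^ k * cnj z ^ m)"
    using AE0 by eventually_elim (rule inner)
  have m1: "(\<lambda>z. LINT t|lborel. f (t, z)) \<in> borel_measurable area_measure" by measurable
  have m2: "(\<lambda>z. bessel_weight \<nu> \<alpha> z * (z ^ k * cnj z ^ m)) \<in> borel_measurable area_measure"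
    using wm by measurable
  have iz: "integrable area_measure (\<lambda>z. LINT t|lborel. f (t, z))"
    using P.integrable_snd[of "\<lambda>t z. f (t, z)"] F by (simp add: case_prod_eta)
  then show "integrable area_measure (\<lambda>z. bessel_weight \<nu> \<alpha> z * (z ^ k * cnj z ^ m))"
    by (subst (asm) integrable_cong_AE[OF m1 m2 AE])
  have "(LINT z|area_measure. bessel_weight \<nu> \<alpha> z * (z ^ k * cnj z ^ m)) = (LINT z|area_measure. LINT t|lborel. f (t, z))"
    by (rule integral_cong_AE[OF m2 m1]) (use AE in \<open>eventually_elim, simp\<close>)
  also have "\<dots> = (LINT t|lborel. LINT z|area_measure. f (t, z))"
    using P.Fubini_integral[of "\<lambda>t z. f (t, z)"] F by (simp add: case_prod_eta)
  also have "\<dots> = (LINT t|lborel. complex_of_real (d t * tilted_moment \<alpha> k m t))"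
  proof (intro Bochner_Integration.integral_cong refl)
    fix t show "(LINT z|area_measure. f (t, z)) = complex_of_real (d t * tilted_moment \<alpha> k m t)"
      using tilted_monomial_moment(2)[of t \<alpha> k m] by (cases "t > 0") (auto simp: f_def d_def)
  qed
  also have "\<dots> = of_real (LINT t|lborel. d t * tilted_moment \<alpha> k m t)" by (rule integral_complex_of_real)
  also have "\<dots> = of_real (weighted_moment \<nu> \<alpha> k m)" using tilted_moment_gamma(2)[OF \<nu> \<alpha>] by (simp add: d_def)
  finally show "(LINT z|area_measure. bessel_weight \<nu> \<alpha> z * (z ^ k * cnj z ^ m)) = of_real (weighted_moment \<nu> \<alpha> k m)" .
qed

section \<open>Orthogonality of Laguerre polynomials\<close>

text \<open>
  The \<open>n\<close>-th finite difference at 0 of a power. Absorbing a factor \<open>k\<close> into the binomial coefficient reduces \<open>n\<close>.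
\<close>
lemma alternating_power_sum:
  "i \<le> n \<Longrightarrow> (\<Sum>k\<le>n. (-1) ^ k * real (n choose k) * real k ^ i) = (if i = n then (-1) ^ n * fact n else 0)"
proof (induction n arbitrary: i)
  case 0
  then show ?case by simp
next
  case (Suc n)
  show ?case
  proof (cases i)
    case 0
    have "(\<Sum>k\<le>Suc n. (-1) ^ k * real (Suc n choose k)) = ((-1) + 1) ^ Suc n"
      unfolding binomial_ring by (simp add: mult_ac)
    then show ?thesis using 0 by simp
  next
    case (Suc i')
    have i': "i' \<le> n" using Suc.prems Suc by simp
    have "(\<Sum>k\<le>Suc n. (-1) ^ k * real (Suc n choose k) * real k ^ i) = (\<Sum>k\<le>n. (-1) ^ Suc k * real (Suc n choose Suc k) * real (Suc k) ^ Suc i')"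
      unfolding Suc by (subst sum.atMost_Suc_shift) simp
    also have "\<dots> = (\<Sum>k\<le>n. - real (Suc n) * ((-1) ^ k * real (n choose k) * (real k + 1) ^ i'))"
    proof (intro sum.cong refl)
      fix k
      have "real (Suc k) * real (Suc n choose Suc k) = real (Suc n) * real (n choose k)"
        using Suc_times_binomial[of k n] by (metis of_nat_mult)
      moreover have "(- 1 * e) * A * (S * x) = - N * (e * B * x)" if "S * A = N * B" for e A S x N B :: real
      proof -
        have "(- 1 * e) * A * (S * x) = - (e * (S * A) * x)" by (simp add: mult_ac)
        then show ?thesis using that by (simp add: mult_ac)
      qed
      moreover have "real k + 1 = real (Suc k)" by simp
      ultimately show "(-1) ^ Suc k * real (Suc n choose Suc k) * real (Suc k) ^ Suc i' = - real (Suc n) * ((-1) ^ k * real (n choose k) * (real k + 1) ^ i')"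
        by (simp only: power_Suc)
    qed
    also have "\<dots> = - real (Suc n) * (\<Sum>k\<le>n. \<Sum>r\<le>i'. real (i' choose r) * ((-1) ^ k * real (n choose k) * real k ^ r))"
      unfolding sum_distrib_left[symmetric] binomial_ring by (simp add: sum_distrib_left mult_ac)
    also have "\<dots> = - real (Suc n) * (\<Sum>r\<le>i'. real (i' choose r) * (\<Sum>k\<le>n. (-1) ^ k * real (n choose k) * real k ^ r))"
      by (subst sum.swap) (simp add: sum_distrib_left)
    also have "(\<Sum>r\<le>i'. real (i' choose r) * (\<Sum>k\<le>n. (-1) ^ k * real (n choose k) * real k ^ r)) = (\<Sum>r\<le>i'. if r = n then real (i' choose n) * ((-1) ^ n * fact n) else 0)"
      using i' by (intro sum.cong refl) (simp add: Suc.IH)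
    also have "\<dots> = (if i' = n then (-1) ^ n * fact n else 0)"
      using i' by (auto simp: sum.delta)
    finally have fin: "(\<Sum>k\<le>Suc n. (-1) ^ k * real (Suc n choose k) * real k ^ i) = - real (Suc n) * (if i' = n then (-1) ^ n * fact n else 0)" .
    show ?thesis unfolding fin using Suc by (auto simp: algebra_simps)
  qed
qed

lemma alternating_poly_sum:
  fixes p :: "real poly"
  assumes "degree p \<le> n"
  shows "(\<Sum>k\<le>n. (-1) ^ k * real (n choose k) * poly p (real k)) = (-1) ^ n * fact n * coeff p n"
proof -
  have "poly p x = (\<Sum>i\<le>n. coeff p i * x ^ i)" for x
    unfolding poly_altdef using assms
    by (intro sum.mono_neutral_left) (auto simp: coeff_eq_0)
  then have "(\<Sum>k\<le>n. (-1) ^ k * real (n choose k) * poly p (real k)) = (\<Sum>k\<le>n. \<Sum>i\<le>n. coeff p i * ((-1) ^ k * real (n choose k) * real k ^ i))"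
    by (simp add: sum_distrib_left mult_ac)
  also have "\<dots> = (\<Sum>i\<le>n. coeff p i * (\<Sum>k\<le>n. (-1) ^ k * real (n choose k) * real k ^ i))"
    by (subst sum.swap) (simp add: sum_distrib_left)
  also have "\<dots> = (\<Sum>i\<le>n. if i = n then coeff p n * ((-1) ^ n * fact n) else 0)"
    by (intro sum.cong refl) (simp add: alternating_power_sum)
  also have "\<dots> = (-1) ^ n * fact n * coeff p n" by (simp add: sum.delta)
  finally show ?thesis .
qed

lemma monic_linear_prod:
  fixes c :: "nat \<Rightarrow> real"
  shows "degree (\<Prod>i<n. [:c i, 1:]) = n" "lead_coeff (\<Prod>i<n. [:c i, 1:]) = 1"
    "coeff (\<Prod>i<n. [:c i, 1:]) n = 1"
proof -
  show d: "degree (\<Prod>i<n. [:c i, 1:]) = n" by (subst degree_prod_eq_sum_degree) auto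
  show l: "lead_coeff (\<Prod>i<n. [:c i, 1:]) = 1" by (simp add: lead_coeff_prod)
  show "coeff (\<Prod>i<n. [:c i, 1:]) n = 1" using l unfolding d .
qed

text \<open>
  The coefficients of \<open>n! / \<Gamma>(n + \<nu> + 1) * L\<^sub>n\<^sup>\<nu>(\<kappa> z)\<close>. With this normalization the coefficient of \<open>z\<^sup>k\<close> is that of
  \<open>E\<^sub>\<nu>(- y z)\<close> with \<open>y\<^sup>k\<close> replaced by \<open>\<kappa>\<^sup>k n (n - 1) \<dots> (n - k + 1)\<close>.
\<close>
definition laguerre_coeff :: "real \<Rightarrow> real \<Rightarrow> nat \<Rightarrow> nat \<Rightarrow> real" where
  "laguerre_coeff \<nu> \<kappa> n k = (- \<kappa>) ^ k * real (n choose k) * rGamma (real k + \<nu> + 1)"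

text \<open>
  The Gamma function in the Laguerre coefficient cancels against the one in the moment and leaves a rising
  factorial, a polynomial in \<open>k\<close>. The scale \<open>\<kappa>\<close> is the one for which all \<open>k\<close>-th powers together collapse to
  \<open>(-1)\<^sup>k\<close>. What remains is the alternating binomial sum of a polynomial in \<open>k\<close> of degree \<open>m\<close>.
\<close>
lemma laguerre_weighted_moment:
  assumes \<nu>: "\<nu> > -1" and \<alpha>: "0 < \<alpha>" "\<alpha> < 1" and mn: "m \<le> n"
  defines "\<kappa> \<equiv> (1 - \<alpha>\<^sup>2) / (2 * \<alpha>)"
  shows "(\<Sum>k\<le>n. laguerre_coeff \<nu> \<kappa> n k * weighted_moment \<nu> \<alpha> k m) =
    (if m = n then (-1) ^ n * fact n * (4 * (1 - \<alpha>\<^sup>2) powr (- \<nu> - 1) * (2 / (\<alpha> * (1 - \<alpha>\<^sup>2))) ^ n) else 0)"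
proof -
  define s where "s = 1 - \<alpha>\<^sup>2"
  have s: "s > 0" using \<alpha> by (simp add: s_def abs_square_less_1)
  \<comment> \<open>At \<open>k\<close>, the polynomial \<open>q j\<close> is a falling factorial times a rising factorial of \<open>k + \<nu> + 1\<close>.\<close>
  define q where "q = (\<lambda>j. (\<Prod>i<j. [:- real i, 1:]) * (\<Prod>i<m - j. [:\<nu> + 1 + real i, 1:]))"
  define C where "C = (\<lambda>j. real (m choose j) * 4 ^ Suc j * (2 * \<alpha>) ^ (m - j) * (1 / (2 * \<alpha>)) ^ j * (s powr (- \<nu> - 1) * (1 / s) ^ (m - j)))"
  define P where "P = (\<Sum>j\<le>m. Polynomial.smult (C j) (q j))"
  have qd: "degree (q j) = m" "coeff (q j) m = 1" if "j \<le> m" for j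
  proof -
    have nz: "(\<Prod>i<j. [:- real i, 1:]) \<noteq> 0" "(\<Prod>i<m - j. [:\<nu> + 1 + real i, 1:]) \<noteq> 0" by auto
    show d: "degree (q j) = m" unfolding q_def
      using that by (subst degree_mult_eq[OF nz]) (simp add: monic_linear_prod)
    have "lead_coeff (q j) = 1" unfolding q_def lead_coeff_mult by (simp add: monic_linear_prod)
    then show "coeff (q j) m = 1" by (simp add: d)
  qed
  have term_eq: "laguerre_coeff \<nu> \<kappa> n k * weighted_moment \<nu> \<alpha> k m = (-1) ^ k * real (n choose k) * poly P (real k)" for k
  proof -
    have "weighted_moment \<nu> \<alpha> k m = (\<Sum>j\<le>m. real (k choose j) * real (m choose j) * fact j * 4 ^ Suc j * (2 * \<alpha>) ^ (k - j) * (2 * \<alpha>) ^ (m - j) *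
     (Gamma (\<nu> + 1 + real (j + (k - j) + (m - j))) / s powr (\<nu> + 1 + real (j + (k - j) + (m - j)))))"
    proof -
      define g where "g = (\<lambda>j. real (k choose j) * real (m choose j) * fact j * 4 ^ Suc j * (2 * \<alpha>) ^ (k - j) * (2 * \<alpha>) ^ (m - j) *
         (Gamma (\<nu> + 1 + real (j + (k - j) + (m - j))) / s powr (\<nu> + 1 + real (j + (k - j) + (m - j)))))"
      have "sum g {..k} = sum g {..min k m}" by (rule sum.mono_neutral_right) (auto simp: g_def)
      moreover have "sum g {..m} = sum g {..min k m}" by (rule sum.mono_neutral_right) (auto simp: g_def)
      ultimately show ?thesis by (simp add: weighted_moment_def g_def s_def)
    qed
    moreover have "laguerre_coeff \<nu> \<kappa> n k * (real (k choose j) * real (m choose j) * fact j * 4 ^ Suc j * (2 * \<alpha>) ^ (k - j) * (2 * \<alpha>) ^ (m - j) *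
     (Gamma (\<nu> + 1 + real (j + (k - j) + (m - j))) / s powr (\<nu> + 1 + real (j + (k - j) + (m - j)))))
      = (-1) ^ k * real (n choose k) * (C j * poly (q j) (real k))" if jm: "j \<le> m" for j
    proof (cases "j \<le> k")
      case False
      then have "poly (\<Prod>i<j. [:- real i, 1:]) (real k) = 0"
        by (auto simp: poly_prod intro!: bexI[of _ k])
      then show ?thesis using False by (simp add: q_def)
    next
      case True
      define r where "r = m - j"
      have f1: "real (k choose j) * fact j = poly (\<Prod>i<j. [:- real i, 1:]) (real k)"
      proof -
        have "real (k choose j) * fact j = (real k gchoose j) * fact j" by (simp add: binomial_gbinomial)
        also have "\<dots> = (\<Prod>i = 0..<j. real k - real i)" by (simp add: gbinomial_prod_rev)
        finally show ?thesis by (simp add: poly_prod lessThan_atLeast0)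
      qed
      have arg: "\<nu> + 1 + real (j + (k - j) + (m - j)) = (real k + \<nu> + 1) + real r" using True by (simp add: r_def)
      have f2: "rGamma (real k + \<nu> + 1) * Gamma ((real k + \<nu> + 1) + real r) = poly (\<Prod>i<r. [:\<nu> + 1 + real i, 1:]) (real k)"
      proof -
        have pos: "real k + \<nu> + 1 > 0" using \<nu> by simp
        then have "real k + \<nu> + 1 \<notin> \<int>\<^sub>\<le>\<^sub>0" by (metis nonpos_Ints_nonpos not_le)
        then have "pochhammer (real k + \<nu> + 1) r = Gamma ((real k + \<nu> + 1) + real r) / Gamma (real k + \<nu> + 1)"
          by (rule pochhammer_Gamma)
        then have "rGamma (real k + \<nu> + 1) * Gamma ((real k + \<nu> + 1) + real r) = pochhammer (real k + \<nu> + 1) r"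
          by (simp add: rGamma_inverse_Gamma divide_inverse mult.commute)
        also have "\<dots> = poly (\<Prod>i<r. [:\<nu> + 1 + real i, 1:]) (real k)"
          by (simp add: pochhammer_prod poly_prod lessThan_atLeast0 add_ac)
        finally show ?thesis .
      qed
      have f3: "(- \<kappa>) ^ k * (2 * \<alpha>) ^ (k - j) / s powr ((real k + \<nu> + 1) + real r) = (-1) ^ k * (1 / (2 * \<alpha>)) ^ j * (s powr (- \<nu> - 1) * (1 / s) ^ r)"
      proof -
        have "s powr ((real k + \<nu> + 1) + real r) = s ^ k * s powr (\<nu> + 1) * s ^ r"
          using s by (simp add: powr_add powr_realpow)
        moreover have "(2 * \<alpha>) ^ (k - j) = (2 * \<alpha>) ^ k * (1 / (2 * \<alpha>)) ^ j"
          using True \<alpha> by (simp add: power_diff power_divide)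
        moreover have "(- \<kappa>) ^ k = (-1) ^ k * s ^ k / (2 * \<alpha>) ^ k"
          by (simp add: \<kappa>_def s_def power_minus[of "_ / _"] power_divide)
        moreover have "s powr (- \<nu> - 1) = inverse (s powr (\<nu> + 1))" using powr_minus[of s "\<nu> + 1"] by simp
        moreover have "(e * u / a) * (a * g) / (u * p * q) = e * g * (inverse p * (1 / q))" if "u \<noteq> 0" "a \<noteq> 0" for e u a g p q :: real
          using that by (simp add: field_simps)
        moreover have "s ^ k \<noteq> 0" "(2 * \<alpha>) ^ k \<noteq> 0" using s \<alpha> by auto
        ultimately show ?thesis by (simp only: power_one_over)
      qed
      have "laguerre_coeff \<nu> \<kappa> n k * (real (k choose j) * real (m choose j) * fact j * 4 ^ Suc j * (2 * \<alpha>) ^ (k - j) * (2 * \<alpha>) ^ r *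
        (Gamma ((real k + \<nu> + 1) + real r) / s powr ((real k + \<nu> + 1) + real r)))
        = real (n choose k) * (real (m choose j) * 4 ^ Suc j * (2 * \<alpha>) ^ r) * ((real (k choose j) * fact j) * (rGamma (real k + \<nu> + 1) * Gamma ((real k + \<nu> + 1) + real r)))
          * ((- \<kappa>) ^ k * (2 * \<alpha>) ^ (k - j) / s powr ((real k + \<nu> + 1) + real r))"
        by (simp add: laguerre_coeff_def)
      also have "\<dots> = (-1) ^ k * real (n choose k) * (C j * poly (q j) (real k))"
        unfolding f1 f2 f3 by (simp add: C_def q_def r_def)
      finally show ?thesis unfolding arg unfolding r_def[symmetric] .
    qed
    ultimately show ?thesis
      by (simp add: P_def poly_sum sum_distrib_left)
  qed
  have degP: "degree P \<le> m" unfolding P_def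
  proof (intro degree_sum_le)
    fix j assume "j \<in> {..m}"
    then show "degree (Polynomial.smult (C j) (q j)) \<le> m" using qd(1)[of j] degree_smult_le[of "C j" "q j"] by simp
  qed simp
  have coP: "coeff P m = 4 * s powr (- \<nu> - 1) * (2 / (\<alpha> * s)) ^ m"
  proof -
    have "coeff P m = (\<Sum>j\<le>m. C j)" by (simp add: P_def coeff_sum qd(2))
    also have "\<dots> = (\<Sum>j\<le>m. 4 * s powr (- \<nu> - 1) * (real (m choose j) * (2 / \<alpha>) ^ j * (2 * \<alpha> / s) ^ (m - j)))"
    proof (intro sum.cong refl)
      fix j
      have "(4::real) ^ j * (1 / (2 * \<alpha>)) ^ j = (2 / \<alpha>) ^ j"
        unfolding power_mult_distrib[symmetric] by (simp add: field_simps)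
      moreover have "(2 * \<alpha>) ^ (m - j) * (1 / s) ^ (m - j) = (2 * \<alpha> / s) ^ (m - j)"
        unfolding power_mult_distrib[symmetric] by simp
      moreover have "b * (4 * u) * v * w * (S * x) = 4 * S * (b * (u * w) * (v * x))" for b u v w S x :: real
        by (simp only: mult_ac)
      ultimately show "C j = 4 * s powr (- \<nu> - 1) * (real (m choose j) * (2 / \<alpha>) ^ j * (2 * \<alpha> / s) ^ (m - j))"
        unfolding C_def power_Suc by (simp only:)
    qed
    also have "\<dots> = 4 * s powr (- \<nu> - 1) * (2 / \<alpha> + 2 * \<alpha> / s) ^ m"
      by (simp only: binomial_ring sum_distrib_left)
    also have "2 / \<alpha> + 2 * \<alpha> / s = 2 / (\<alpha> * s)"
    proof -
      have "2 / \<alpha> + 2 * \<alpha> / s = 2 * (s + \<alpha>\<^sup>2) / (\<alpha> * s)" using s \<alpha> by (simp add: field_simps power2_eq_square)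
      then show ?thesis by (simp add: s_def)
    qed
    finally show ?thesis .
  qed
  have "(\<Sum>k\<le>n. laguerre_coeff \<nu> \<kappa> n k * weighted_moment \<nu> \<alpha> k m) = (-1) ^ n * fact n * coeff P n"
    unfolding term_eq using degP mn by (intro alternating_poly_sum) simp
  moreover have "coeff P n = 0" if "m \<noteq> n" using degP mn that by (intro coeff_eq_0) simp
  ultimately show ?thesis using coP by (auto simp: s_def)
qed

definition laguerre_poly :: "real \<Rightarrow> real \<Rightarrow> nat \<Rightarrow> complex poly" where
  "laguerre_poly \<nu> \<kappa> n = (\<Sum>k\<le>n. monom (of_real (laguerre_coeff \<nu> \<kappa> n k)) k)"

lemma poly_laguerre: "poly (laguerre_poly \<nu> \<kappa> n) z = (\<Sum>k\<le>n. of_real (laguerre_coeff \<nu> \<kappa> n k) * z ^ k)"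
  by (simp add: laguerre_poly_def poly_sum poly_monom)

lemma coeff_laguerre: "coeff (laguerre_poly \<nu> \<kappa> n) k = (if k \<le> n then of_real (laguerre_coeff \<nu> \<kappa> n k) else 0)"
  by (simp add: laguerre_poly_def coeff_sum)

lemma degree_laguerre: "degree (laguerre_poly \<nu> \<kappa> n) \<le> n"
  by (intro degree_le) (simp add: coeff_laguerre)

definition laguerre_norm :: "real \<Rightarrow> real \<Rightarrow> nat \<Rightarrow> real" where
  "laguerre_norm \<nu> \<alpha> n = 4 * (1 - \<alpha>\<^sup>2) powr (- \<nu> - 1) * (1 / \<alpha>\<^sup>2) ^ n * (fact n * rGamma (real n + \<nu> + 1))"

lemma weighted_moment_commute: "weighted_moment \<nu> \<alpha> k m = weighted_moment \<nu> \<alpha> m k"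
proof -
  define g where "g = (\<lambda>j k m. real (k choose j) * real (m choose j) * fact j * 4 ^ Suc j * (2 * \<alpha>) ^ (k - j) * (2 * \<alpha>) ^ (m - j) *
     (Gamma (\<nu> + 1 + real (j + (k - j) + (m - j))) / (1 - \<alpha>\<^sup>2) powr (\<nu> + 1 + real (j + (k - j) + (m - j)))))"
  have w: "weighted_moment \<nu> \<alpha> k m = (\<Sum>j\<le>min k m. g j k m)" for k m
    unfolding weighted_moment_def g_def by (rule sum.mono_neutral_right) auto
  have "g j k m = g j m k" for j by (simp add: g_def mult_ac add_ac)
  then show ?thesis by (simp add: w min.commute)
qed

text \<open>
  For \<open>m \<le> n\<close> expand the polynomial of degree \<open>m\<close> into monomials: those of degree below \<open>n\<close> are orthogonal to the
  other factor, and the leading one, of degree \<open>n\<close> only if \<open>m = n\<close>, gives the norm. The case \<open>n < m\<close> follows by symmetry.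
\<close>
lemma laguerre_orthogonal:
  assumes \<nu>: "\<nu> > -1" and \<alpha>: "0 < \<alpha>" "\<alpha> < 1"
  defines "\<kappa> \<equiv> (1 - \<alpha>\<^sup>2) / (2 * \<alpha>)"
  shows "integrable area_measure (\<lambda>z. bessel_weight \<nu> \<alpha> z * (poly (laguerre_poly \<nu> \<kappa> n) z * cnj (poly (laguerre_poly \<nu> \<kappa> m) z)))" (is ?I)
    and "(LINT z|area_measure. bessel_weight \<nu> \<alpha> z * (poly (laguerre_poly \<nu> \<kappa> n) z * cnj (poly (laguerre_poly \<nu> \<kappa> m) z))) =
      (if n = m then of_real (laguerre_norm \<nu> \<alpha> n) else 0)" (is ?E)
proof -
  have a: "\<bar>\<alpha>\<bar> < 1" using \<alpha> by simp
  define l where "l = laguerre_coeff \<nu> \<kappa>"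
  have ex: "bessel_weight \<nu> \<alpha> z * (poly (laguerre_poly \<nu> \<kappa> n) z * cnj (poly (laguerre_poly \<nu> \<kappa> m) z)) =
    (\<Sum>i\<le>m. \<Sum>k\<le>n. (of_real (l m i) * of_real (l n k)) * (bessel_weight \<nu> \<alpha> z * (z ^ k * cnj z ^ i)))" for z n m
  proof -
    have "bessel_weight \<nu> \<alpha> z * (poly (laguerre_poly \<nu> \<kappa> n) z * cnj (poly (laguerre_poly \<nu> \<kappa> m) z)) =
      bessel_weight \<nu> \<alpha> z * ((\<Sum>i\<le>m. of_real (l m i) * cnj z ^ i) * (\<Sum>k\<le>n. of_real (l n k) * z ^ k))"
      by (simp add: poly_laguerre l_def cnj_sum mult.commute)
    also have "\<dots> = (\<Sum>i\<le>m. \<Sum>k\<le>n. (of_real (l m i) * of_real (l n k)) * (bessel_weight \<nu> \<alpha> z * (z ^ k * cnj z ^ i)))"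
      unfolding sum_product unfolding sum_distrib_left by (intro sum.cong refl) (simp only: mult_ac)
    finally show ?thesis .
  qed
  show ?I unfolding ex
    by (intro Bochner_Integration.integrable_sum integrable_mult_right bessel_weight_moment(1)[OF \<nu> a])
  define W where "W = (\<lambda>n m. \<Sum>i\<le>m. l m i * (\<Sum>k\<le>n. l n k * weighted_moment \<nu> \<alpha> k i))"
  have int: "(LINT z|area_measure. bessel_weight \<nu> \<alpha> z * (poly (laguerre_poly \<nu> \<kappa> n) z * cnj (poly (laguerre_poly \<nu> \<kappa> m) z))) = of_real (W n m)"
  proof -
    have "(LINT z|area_measure. bessel_weight \<nu> \<alpha> z * (poly (laguerre_poly \<nu> \<kappa> n) z * cnj (poly (laguerre_poly \<nu> \<kappa> m) z))) =
      (\<Sum>i\<le>m. \<Sum>k\<le>n. LINT z|area_measure. (of_real (l m i) * of_real (l n k)) * (bessel_weight \<nu> \<alpha> z * (z ^ k * cnj z ^ i)))"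
      unfolding ex
      by (subst Bochner_Integration.integral_sum, intro Bochner_Integration.integrable_sum integrable_mult_right bessel_weight_moment(1)[OF \<nu> a],
          intro sum.cong refl Bochner_Integration.integral_sum integrable_mult_right bessel_weight_moment(1)[OF \<nu> a])
    also have "\<dots> = of_real (W n m)"
      by (simp only: integral_mult_right_zero bessel_weight_moment(2)[OF \<nu> a] W_def of_real_sum of_real_mult sum_distrib_left mult.assoc)
    finally show ?thesis .
  qed
  have lower: "W n m = (if n = m then laguerre_norm \<nu> \<alpha> n else 0)" if "m \<le> n" for n m
  proof -
    have "W n m = (\<Sum>i\<le>m. if i = n then l m n * ((-1) ^ n * fact n * (4 * (1 - \<alpha>\<^sup>2) powr (- \<nu> - 1) * (2 / (\<alpha> * (1 - \<alpha>\<^sup>2))) ^ n)) else 0)"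
      unfolding W_def l_def \<kappa>_def
      using that by (intro sum.cong refl) (simp only: atMost_iff laguerre_weighted_moment[OF \<nu> \<alpha> order.trans], simp)
    also have "\<dots> = (if m = n then l n n * ((-1) ^ n * fact n * (4 * (1 - \<alpha>\<^sup>2) powr (- \<nu> - 1) * (2 / (\<alpha> * (1 - \<alpha>\<^sup>2))) ^ n)) else 0)"
      using that by (auto simp: sum.delta)
    also have "l n n * ((-1) ^ n * fact n * (4 * (1 - \<alpha>\<^sup>2) powr (- \<nu> - 1) * (2 / (\<alpha> * (1 - \<alpha>\<^sup>2))) ^ n)) = laguerre_norm \<nu> \<alpha> n"
    proof -
      have s: "1 - \<alpha>\<^sup>2 \<noteq> 0" using \<alpha> by (simp add: power2_eq_1_iff)
      have "(- \<kappa>) ^ n * (-1) ^ n * (2 / (\<alpha> * (1 - \<alpha>\<^sup>2))) ^ n = (1 / \<alpha>\<^sup>2) ^ n"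
      proof -
        have "- (S / (2 * \<alpha>)) * - 1 * (2 / (\<alpha> * S)) = 1 / \<alpha>\<^sup>2" if "S \<noteq> 0" for S
          using that \<alpha> by (simp add: field_simps power2_eq_square)
        from this[OF s] show ?thesis unfolding power_mult_distrib[symmetric] \<kappa>_def by (simp only:)
      qed
      then show ?thesis by (simp add: l_def laguerre_coeff_def laguerre_norm_def mult_ac)
    qed
    finally show ?thesis by auto
  qed
  have sym: "W n m = W m n" for n m
    unfolding W_def sum_distrib_left by (subst sum.swap) (simp add: mult_ac weighted_moment_commute)
  have "W n m = (if n = m then laguerre_norm \<nu> \<alpha> n else 0)"
    using lower[of m n] lower[of n m] sym[of n m] by (cases "m \<le> n") auto
  then show ?E by (simp add: int)
qed

section \<open>The large-index limit of the Laguerre polynomials\<close>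

lemma choose_fact_Suc: "real (n choose Suc k) * fact (Suc k) = real (n choose k) * fact k * real (n - k)"
proof -
  have "Suc k * (n choose Suc k) = (n - k) * (n choose k)"
    using times_binomial_minus1_eq[of "Suc k" n] binomial_absorb_comp[of n k] by simp
  then have "real (Suc k) * real (n choose Suc k) = real (n - k) * real (n choose k)"
    by (metis of_nat_mult)
  then show ?thesis by (simp add: mult_ac)
qed

text \<open>
  Induction on \<open>k\<close>: one more factor adds an error \<open>\<epsilon> (k + 1)\<close> times \<open>B\<^sup>k\<close>, and \<open>k\<^sup>2 + k + 1 \<le> (k + 1)\<^sup>2\<close>.
\<close>
lemma scaled_falling_close:
  fixes \<kappa> y B \<epsilon> :: real
  assumes y: "0 \<le> y" "y \<le> B" and B: "1 \<le> B" and \<kappa>: "0 \<le> \<kappa>" "\<kappa> * real n \<le> B" and \<epsilon>: "0 \<le> \<epsilon>"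
    and close: "\<And>k. \<bar>\<kappa> * real (n - k) - y\<bar> \<le> \<epsilon> * (real k + 1)"
  shows "0 \<le> \<kappa> ^ k * (real (n choose k) * fact k) \<and> \<kappa> ^ k * (real (n choose k) * fact k) \<le> B ^ k \<and>
    \<bar>\<kappa> ^ k * (real (n choose k) * fact k) - y ^ k\<bar> \<le> \<epsilon> * (real k)\<^sup>2 * B ^ k"
proof (induction k)
  case (Suc k)
  define a where "a = \<kappa> ^ k * (real (n choose k) * fact k)"
  define b where "b = \<kappa> * real (n - k)"
  have S: "\<kappa> ^ Suc k * (real (n choose Suc k) * fact (Suc k)) = a * b"
    unfolding choose_fact_Suc a_def b_def by (simp add: mult_ac)
  have b: "0 \<le> b" "b \<le> B"
  proof -
    show "0 \<le> b" using \<kappa> by (simp add: b_def)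
    have "b \<le> \<kappa> * real n" unfolding b_def using \<kappa> by (intro mult_left_mono) auto
    then show "b \<le> B" using \<kappa> by simp
  qed
  have a: "0 \<le> a" "a \<le> B ^ k" "\<bar>a - y ^ k\<bar> \<le> \<epsilon> * (real k)\<^sup>2 * B ^ k"
    using Suc.IH by (auto simp: a_def)
  have "\<bar>a * b - y ^ Suc k\<bar> = \<bar>a * (b - y) + y * (a - y ^ k)\<bar>" by (simp add: algebra_simps)
  also have "\<dots> \<le> a * \<bar>b - y\<bar> + y * \<bar>a - y ^ k\<bar>"
    using a(1) y(1) by (intro order.trans[OF abs_triangle_ineq]) (simp add: abs_mult)
  also have "\<dots> \<le> B ^ k * (\<epsilon> * (real k + 1)) + B * (\<epsilon> * (real k)\<^sup>2 * B ^ k)"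
    using a y B close[of k] \<epsilon> unfolding b_def by (intro add_mono mult_mono) auto
  also have "B ^ k * (\<epsilon> * (real k + 1)) \<le> B ^ Suc k * (\<epsilon> * (real k + 1))"
    using B \<epsilon> by (intro mult_right_mono power_increasing) auto
  also have "B ^ Suc k * (\<epsilon> * (real k + 1)) + B * (\<epsilon> * (real k)\<^sup>2 * B ^ k) = \<epsilon> * (real k + 1 + (real k)\<^sup>2) * B ^ Suc k"
    by (simp add: algebra_simps)
  also have "\<dots> \<le> \<epsilon> * (real (Suc k))\<^sup>2 * B ^ Suc k"
    using B \<epsilon> by (intro mult_right_mono mult_left_mono) (auto simp: power2_eq_square algebra_simps)
  finally have "\<bar>a * b - y ^ Suc k\<bar> \<le> \<epsilon> * (real (Suc k))\<^sup>2 * B ^ Suc k" by simp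
  moreover have "a * b \<le> B ^ k * B" using a b B by (intro mult_mono) auto
  ultimately show ?case unfolding S using a(1) b(1) by (simp add: mult.commute)
qed simp

lemma sum_exp_bound:
  fixes f :: "nat \<Rightarrow> complex"
  assumes "\<And>k. norm (f k) \<le> D * (t ^ k / fact k)"
  shows "norm (suminf f) \<le> D * exp t"
proof -
  have s: "(\<lambda>k. D * (t ^ k / fact k)) sums (D * exp t)"
    using sums_mult[OF exp_converges[of t], of D] by (simp add: divide_inverse mult_ac)
  show ?thesis
    using norm_suminf_le[OF assms sums_summable[OF s]] sums_unique[OF s] by simp
qed

text \<open>
  Both functions are power series in \<open>- z\<close>, with the same factors \<open>rGamma (k + \<nu> + 1) / k!\<close>, so the estimate is done
  coefficient by coefficient. The factor \<open>k\<^sup>2\<close> from the comparison of the powers is absorbed by \<open>k\<^sup>2 \<le> 4\<^sup>k\<close>.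
\<close>
lemma laguerre_poly_close:
  fixes \<kappa> y B \<epsilon> C r \<nu> :: real and z :: complex
  assumes C: "\<And>k. 0 \<le> rGamma (real k + \<nu> + 1)" "\<And>k. rGamma (real k + \<nu> + 1) \<le> C"
    and y: "0 \<le> y" "y \<le> B" and B: "1 \<le> B" and \<kappa>: "0 \<le> \<kappa>" "\<kappa> * real n \<le> B" and \<epsilon>: "0 \<le> \<epsilon>"
    and close: "\<And>k. \<bar>\<kappa> * real (n - k) - y\<bar> \<le> \<epsilon> * (real k + 1)"
    and z: "norm z \<le> r"
  shows "norm (poly (laguerre_poly \<nu> \<kappa> n) z) \<le> C * exp (B * r)"
    and "norm (bessel_series \<nu> (- (of_real y * z))) \<le> C * exp (B * r)"
    and "norm (poly (laguerre_poly \<nu> \<kappa> n) z - bessel_series \<nu> (- (of_real y * z))) \<le> \<epsilon> * C * exp (4 * B * r)"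
proof -
  define a where "a = (\<lambda>k. \<kappa> ^ k * (real (n choose k) * fact k))"
  have a: "0 \<le> a k \<and> a k \<le> B ^ k \<and> \<bar>a k - y ^ k\<bar> \<le> \<epsilon> * (real k)\<^sup>2 * B ^ k" for k
    unfolding a_def by (rule scaled_falling_close[OF y B \<kappa> \<epsilon> close])
  define h where "h = (\<lambda>k. rGamma (real k + \<nu> + 1) / fact k)"
  define P where "P = (\<lambda>k. complex_of_real (h k * a k) * (- z) ^ k)"
  define Q where "Q = (\<lambda>k. complex_of_real (h k * y ^ k) * (- z) ^ k)"
  have h: "0 \<le> h k" "h k \<le> C / fact k" for k
    using C by (auto simp: h_def divide_right_mono)
  have C0: "0 \<le> C" using C[of 0] by linarith
  have r: "0 \<le> r" using z norm_ge_zero order.trans by blast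
  have bound: "norm (complex_of_real (h k * x) * (- z) ^ k) \<le> D * ((t * r) ^ k / fact k)" if x: "\<bar>x\<bar> * C \<le> D * t ^ k" "0 \<le> t" for x D t k
  proof -
    have "norm (complex_of_real (h k * x) * (- z) ^ k) = h k * \<bar>x\<bar> * norm z ^ k"
      using h(1)[of k] by (simp add: norm_mult norm_power abs_mult)
    also have "\<dots> \<le> (C / fact k) * \<bar>x\<bar> * r ^ k"
      using h[of k] z C0 by (intro mult_mono power_mono) auto
    also have "\<dots> = (\<bar>x\<bar> * C) * (r ^ k / fact k)" by simp
    also have "\<dots> \<le> (D * t ^ k) * (r ^ k / fact k)" using x r by (intro mult_right_mono) auto
    also have "\<dots> = D * ((t * r) ^ k / fact k)" by (simp add: power_mult_distrib)
    finally show ?thesis .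
  qed
  have Pe: "poly (laguerre_poly \<nu> \<kappa> n) z = suminf P"
  proof -
    have "suminf P = (\<Sum>k\<le>n. P k)"
      by (rule suminf_finite) (auto simp: P_def a_def)
    also have "\<dots> = (\<Sum>k\<le>n. of_real (laguerre_coeff \<nu> \<kappa> n k) * z ^ k)"
      by (intro sum.cong refl) (simp add: P_def h_def a_def laguerre_coeff_def power_minus[of \<kappa>] power_minus[of z] mult_ac)
    finally show ?thesis by (simp add: poly_laguerre)
  qed
  have Qe: "bessel_series \<nu> (- (of_real y * z)) = suminf Q"
  proof -
    have pz: "(- (of_real y * z)) ^ k = complex_of_real (y ^ k) * (- z) ^ k" for k
    proof -
      have "(- (of_real y * z)) ^ k = (of_real y * (- z)) ^ k" by simp
      then show ?thesis by (simp only: power_mult_distrib of_real_power)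
    qed
    show ?thesis unfolding bessel_series_def Q_def h_def pz
      by (intro suminf_cong) (simp only: of_real_mult mult.assoc)
  qed
  have Pb: "norm (P k) \<le> C * ((B * r) ^ k / fact k)" for k
    unfolding P_def using a[of k] C0 B by (intro bound) (auto simp: mult.commute intro: mult_left_mono)
  have Qb: "norm (Q k) \<le> C * ((B * r) ^ k / fact k)" for k
    unfolding Q_def using y C0 B by (intro bound) (auto simp: mult.commute intro!: mult_left_mono power_mono)
  show "norm (poly (laguerre_poly \<nu> \<kappa> n) z) \<le> C * exp (B * r)" unfolding Pe by (rule sum_exp_bound[OF Pb])
  show "norm (bessel_series \<nu> (- (of_real y * z))) \<le> C * exp (B * r)" unfolding Qe by (rule sum_exp_bound[OF Qb])
  have s: "summable (\<lambda>k. C * ((B * r) ^ k / fact k))"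
    using summable_mult[OF sums_summable[OF exp_converges[of "B * r"]], of C] by (simp add: divide_inverse mult_ac)
  have sP: "summable P" using s by (rule summable_comparison_test'[where N = 0]) (rule Pb)
  have sQ: "summable Q" using s by (rule summable_comparison_test'[where N = 0]) (rule Qb)
  have "norm (P k - Q k) \<le> (\<epsilon> * C) * ((4 * B * r) ^ k / fact k)" for k
  proof -
    have "P k - Q k = complex_of_real (h k * (a k - y ^ k)) * (- z) ^ k"
      by (simp add: P_def Q_def algebra_simps)
    also have "norm \<dots> \<le> (\<epsilon> * C) * ((4 * B * r) ^ k / fact k)"
    proof (rule bound)
      have "real k \<le> 2 ^ k" using less_exp[of k] by (metis less_imp_le of_nat_le_iff of_nat_numeral of_nat_power)
      then have "(real k)\<^sup>2 \<le> (2 ^ k)\<^sup>2" by (intro power_mono) auto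
      also have "\<dots> = (4::real) ^ k" by (simp add: power_mult[symmetric] mult.commute[of k]) (simp add: power_mult)
      finally have k: "(real k)\<^sup>2 \<le> 4 ^ k" .
      have "\<bar>a k - y ^ k\<bar> \<le> \<epsilon> * (real k)\<^sup>2 * B ^ k" using a[of k] by simp
      also have "\<dots> \<le> \<epsilon> * 4 ^ k * B ^ k" using k \<epsilon> B by (intro mult_right_mono mult_left_mono) auto
      finally have "\<bar>a k - y ^ k\<bar> * C \<le> \<epsilon> * 4 ^ k * B ^ k * C" using C0 by (rule mult_right_mono)
      then show "\<bar>a k - y ^ k\<bar> * C \<le> \<epsilon> * C * (4 * B) ^ k" by (simp add: power_mult_distrib mult_ac)
    qed (use B in simp)
    finally show ?thesis .
  qed
  then have "norm (\<Sum>k. P k - Q k) \<le> (\<epsilon> * C) * exp (4 * B * r)" by (rule sum_exp_bound)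
  then show "norm (poly (laguerre_poly \<nu> \<kappa> n) z - bessel_series \<nu> (- (of_real y * z))) \<le> \<epsilon> * C * exp (4 * B * r)"
    unfolding Pe Qe by (simp only: suminf_diff[OF sP sQ, symmetric])
qed

lemma bessel_series_isCont: "isCont (bessel_series \<nu> :: complex \<Rightarrow> complex) y"
proof -
  have "summable (\<lambda>k. complex_of_real (rGamma (of_nat k + \<nu> + 1) / fact k) * x ^ k)" for x
    by (rule summable_norm_cancel[OF bessel_series_summable])
  then show ?thesis unfolding bessel_series_def[abs_def] by (rule isCont_powser_converges_everywhere)
qed

section \<open>The sum over the degrees as an integral\<close>

lemma step_function_integral:
  fixes f :: "nat \<Rightarrow> real"
  assumes N: "N > 0"
  shows "integrable lborel (\<lambda>x. indicator {0<..<1} x * f (nat \<lfloor>real N * x\<rfloor>))"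
    and "(LINT x|lborel. indicator {0<..<1} x * f (nat \<lfloor>real N * x\<rfloor>)) = (\<Sum>n<N. f n) / real N"
proof -
  define I where "I = (\<lambda>n. {real n / real N..<(real n + 1) / real N})"
  have mem: "x \<in> I n \<longleftrightarrow> nat \<lfloor>real N * x\<rfloor> = n" if "0 \<le> x" for x n
  proof -
    have "x \<in> I n \<longleftrightarrow> real n \<le> real N * x \<and> real N * x < real n + 1"
      using N by (simp add: I_def field_simps)
    also have "\<dots> \<longleftrightarrow> \<lfloor>real N * x\<rfloor> = int n" by (simp add: floor_eq_iff)
    also have "\<dots> \<longleftrightarrow> nat \<lfloor>real N * x\<rfloor> = n" using that by (auto simp: nat_eq_iff)
    finally show ?thesis .
  qed
  have step: "(\<Sum>n<N. f n * indicator (I n) x) = indicator {0<..<1} x * f (nat \<lfloor>real N * x\<rfloor>)" if x0: "x \<noteq> 0" for x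
  proof (cases "0 < x \<and> x < 1")
    case True
    have "nat \<lfloor>real N * x\<rfloor> < N"
    proof -
      have "real N * x < real N * 1" using True N by (intro mult_strict_left_mono) auto
      then have "\<lfloor>real N * x\<rfloor> < int N" by (simp add: floor_less_iff)
      then show ?thesis using N by linarith
    qed
    moreover have "f n * indicator (I n) x = (if nat \<lfloor>real N * x\<rfloor> = n then f n else 0)" for n
      using mem[of x n] True by (simp add: indicator_def)
    ultimately show ?thesis using True by (simp add: sum.delta)
  next
    case False
    have "x \<notin> I n" if "n < N" for n
    proof -
      have "(real n + 1) / real N \<le> 1" "0 \<le> real n / real N" using that N by (auto simp: divide_le_eq)
      note ends = this
      show ?thesis
      proof
        assume "x \<in> I n"
        then have "real n / real N \<le> x" "x < (real n + 1) / real N" by (auto simp: I_def)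
        with ends have "0 \<le> x" "x < 1" by linarith+
        then show False using False x0 by simp
      qed
    qed
    then show ?thesis using False by (auto intro!: sum.neutral)
  qed
  have AE: "AE x in lborel. (\<Sum>n<N. f n * indicator (I n) x) = indicator {0<..<1} x * f (nat \<lfloor>real N * x\<rfloor>)"
    using AE_lborel_singleton[of 0] by eventually_elim (rule step)
  have m1: "(\<lambda>x. indicator {0<..<1} x * f (nat \<lfloor>real N * x\<rfloor>)) \<in> borel_measurable lborel" by measurable
  have i: "integrable lborel (\<lambda>x. f n * indicator (I n) x)" for n
    unfolding I_def by (intro integrable_mult_right integrable_real_indicator) (auto simp: emeasure_lborel_Ico divide_right_mono)
  have i2: "integrable lborel (\<lambda>x. \<Sum>n<N. f n * indicator (I n) x)" using i by (rule Bochner_Integration.integrable_sum)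
  then have m2: "(\<lambda>x. \<Sum>n<N. f n * indicator (I n) x) \<in> borel_measurable lborel" by (rule borel_measurable_integrable)
  show "integrable lborel (\<lambda>x. indicator {0<..<1} x * f (nat \<lfloor>real N * x\<rfloor>))"
    using i2 by (subst (asm) integrable_cong_AE[OF m2 m1 AE])
  have "(LINT x|lborel. indicator {0<..<1} x * f (nat \<lfloor>real N * x\<rfloor>)) = (LINT x|lborel. (\<Sum>n<N. f n * indicator (I n) x))"
    by (rule integral_cong_AE[OF m1 m2]) (use AE in \<open>eventually_elim, simp\<close>)
  also have "\<dots> = (\<Sum>n<N. f n * (LINT x|lborel. indicator (I n) x))"
    using i by (subst Bochner_Integration.integral_sum) auto
  also have "\<dots> = (\<Sum>n<N. f n * (1 / real N))"
  proof (intro sum.cong refl)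
    fix n
    have "(real n + 1) / real N - real n / real N = 1 / real N" by (simp add: diff_divide_distrib[symmetric])
    moreover have "real n / real N \<le> (real n + 1) / real N" by (simp add: divide_right_mono)
    ultimately show "f n * (LINT x|lborel. indicator (I n) x) = f n * (1 / real N)"
      by (simp add: I_def)
  qed
  also have "\<dots> = (\<Sum>n<N. f n) / real N" by (simp add: sum_divide_distrib)
  finally show "(LINT x|lborel. indicator {0<..<1} x * f (nat \<lfloor>real N * x\<rfloor>)) = (\<Sum>n<N. f n) / real N" .
qed

lemma powr_integrable_unit:
  assumes "\<nu> > -1"
  shows "integrable lborel (\<lambda>x::real. indicator {0<..<1} x * (x powr \<nu> + 1))"
proof -
  have g: "integrable lborel (\<lambda>t. indicator {0<..} t * (t powr ((\<nu> + 1) - 1) * exp (- t)))"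
    using assms by (intro gamma_integral) auto
  have "integrable lborel (\<lambda>x::real. exp 1 * (indicator {0<..} x * (x powr \<nu> * exp (- x))) + indicator {0<..<1} x)"
    using g by (intro Bochner_Integration.integrable_add integrable_mult_right integrable_real_indicator) auto
  then show ?thesis
  proof (rule Bochner_Integration.integrable_bound)
    have "norm (indicator {0<..<1} x * (x powr \<nu> + 1)) \<le> norm (exp 1 * (indicator {0<..} x * (x powr \<nu> * exp (- x))) + indicator {0<..<1} x)" for x :: real
    proof (cases "0 < x \<and> x < 1")
      case True
      have "x powr \<nu> * 1 \<le> x powr \<nu> * (exp 1 * exp (- x))"
        using True by (intro mult_left_mono) (auto simp flip: exp_add)
      then show ?thesis using True by (simp add: mult_ac)
    qed auto
    then show "AE x in lborel. norm (indicator {0<..<1} x * (x powr \<nu> + 1)) \<le> norm (exp 1 * (indicator {0<..} x * (x powr \<nu> * exp (- x))) + indicator {0<..<1} x)"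
      by simp
  qed measurable
qed

definition gamma_ratio :: "real \<Rightarrow> nat \<Rightarrow> real" where "gamma_ratio \<nu> n = Gamma (real n + \<nu> + 1) / fact n"

lemma gamma_ratio_pos: "\<nu> > -1 \<Longrightarrow> gamma_ratio \<nu> n > 0"
  by (simp add: gamma_ratio_def Gamma_real_pos)

text \<open>
  This is Euler's limit formula for the Gamma function at \<open>\<nu> + 1\<close>.
\<close>
lemma gamma_ratio_asymp:
  assumes \<nu>: "\<nu> > -1"
  shows "(\<lambda>n. gamma_ratio \<nu> n / real n powr \<nu>) \<longlonglongrightarrow> 1"
proof -
  have np: "\<nu> + 1 \<notin> \<int>\<^sub>\<le>\<^sub>0" using \<nu> by (metis add.commute less_add_same_cancel1 neg_less_iff_less nonpos_Ints_nonpos not_le add_less_cancel_left add_neg_numeral_special(7) minus_less_iff)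
  have G: "Gamma (\<nu> + 1) > 0" using \<nu> by simp
  have "Gamma_series' (\<nu> + 1) \<longlonglongrightarrow> Gamma (\<nu> + 1)" by (rule Gamma_series'_LIMSEQ)
  then have "(\<lambda>n. Gamma (\<nu> + 1) / Gamma_series' (\<nu> + 1) n) \<longlonglongrightarrow> Gamma (\<nu> + 1) / Gamma (\<nu> + 1)"
    using G by (intro tendsto_intros) auto
  then have L: "(\<lambda>n. Gamma (\<nu> + 1) / Gamma_series' (\<nu> + 1) n) \<longlonglongrightarrow> 1" using G by simp
  show ?thesis
  proof (rule Lim_transform_eventually[OF L])
    show "\<forall>\<^sub>F n in sequentially. Gamma (\<nu> + 1) / Gamma_series' (\<nu> + 1) n = gamma_ratio \<nu> n / real n powr \<nu>"
      using eventually_gt_at_top[of 0]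
    proof eventually_elim
      case (elim n)
      have p: "pochhammer (\<nu> + 1) n = Gamma (real n + \<nu> + 1) / Gamma (\<nu> + 1)"
        using pochhammer_Gamma[OF np, of n] by (simp add: add_ac)
      have e: "exp ((\<nu> + 1) * ln (real n)) = real n powr \<nu> * real n"
        using elim by (simp add: powr_def exp_add[symmetric] algebra_simps exp_add)
      have f: "(fact n :: real) = real n * fact (n - 1)" using elim by (simp add: fact_reduce)
      show ?case using G elim by (simp add: Gamma_series'_def gamma_ratio_def p e f)
    qed
  qed
qed

text \<open>
  The majorant for dominated convergence. The ratio is \<open>(n / N)\<^sup>\<nu>\<close> up to a bounded factor, and \<open>n / N\<close> lies between
  \<open>x / 2\<close> and \<open>x\<close> if \<open>n = \<lfloor>N x\<rfloor>\<close> is not 0. The summand 1 takes care of \<open>n = 0\<close> when \<open>\<nu> \<ge> 0\<close>.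
\<close>
lemma gamma_ratio_bound:
  assumes \<nu>: "\<nu> > -1"
  shows "\<exists>D\<ge>0. \<forall>N x. 0 < x \<longrightarrow> x < 1 \<longrightarrow> N > 0 \<longrightarrow>
     real N powr (- \<nu>) * gamma_ratio \<nu> (nat \<lfloor>real N * x\<rfloor>) \<le> D * (x powr \<nu> + 1)"
proof -
  have "Bseq (\<lambda>n. gamma_ratio \<nu> n / real n powr \<nu>)"
    using gamma_ratio_asymp[OF \<nu>] by (intro convergent_imp_Bseq) (auto simp: convergent_def)
  then obtain K where K: "K > 0" "\<And>n. norm (gamma_ratio \<nu> n / real n powr \<nu>) \<le> K" by (auto simp: Bseq_def)
  define D where "D = K * 2 powr \<bar>\<nu>\<bar> + gamma_ratio \<nu> 0"
  have D: "D \<ge> K * 2 powr \<bar>\<nu>\<bar>" "D \<ge> gamma_ratio \<nu> 0" "D \<ge> 0"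
    using gamma_ratio_pos[OF \<nu>, of 0] K by (auto simp: D_def)
  have "real N powr (- \<nu>) * gamma_ratio \<nu> (nat \<lfloor>real N * x\<rfloor>) \<le> D * (x powr \<nu> + 1)" if x: "0 < x" "x < 1" and N: "N > 0" for N :: nat and x
  proof -
    define n where "n = nat \<lfloor>real N * x\<rfloor>"
    have nx: "real n \<le> real N * x" "real N * x < real n + 1"
      using x N by (auto simp: n_def)
    show ?thesis
    proof (cases "n = 0")
      case True
      then have xN: "x < 1 / real N" using nx N by (simp add: field_simps)
      have "real N powr (- \<nu>) \<le> x powr \<nu> + 1"
      proof (cases "\<nu> \<ge> 0")
        case True
        have "real N powr (- \<nu>) \<le> real N powr 0" using N True by (intro powr_mono) auto
        also have "real N powr 0 = 1" using N by simp
        finally have "real N powr (- \<nu>) \<le> 1" .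
        moreover have "0 \<le> x powr \<nu>" by simp
        ultimately show ?thesis by linarith
      next
        case False
        have "real N powr (- \<nu>) = (1 / real N) powr \<nu>" using N by (simp add: powr_divide powr_minus_divide)
        also have "\<dots> \<le> x powr \<nu>" using False x xN by (intro powr_mono2') auto
        finally show ?thesis by simp
      qed
      then have "real N powr (- \<nu>) * gamma_ratio \<nu> n \<le> (x powr \<nu> + 1) * D"
        using D True gamma_ratio_pos[OF \<nu>, of 0] by (intro mult_mono) (auto intro: add_nonneg_nonneg)
      then show ?thesis by (simp add: n_def mult.commute)
    next
      case False
      then have n1: "real n \<ge> 1" by simp
      have q: "x / 2 \<le> real n / real N" "real n / real N \<le> x"
        using nx n1 N by (auto simp: field_simps)
      have q0: "0 < real n / real N" using n1 N by simp
      have "(real n / real N) powr \<nu> \<le> 2 powr \<bar>\<nu>\<bar> * x powr \<nu>"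
      proof (cases "\<nu> \<ge> 0")
        case True
        have "(real n / real N) powr \<nu> \<le> 1 * x powr \<nu>" using True q q0 by (simp add: powr_mono2)
        also have "\<dots> \<le> 2 powr \<bar>\<nu>\<bar> * x powr \<nu>" by (intro mult_right_mono) (auto simp: ge_one_powr_ge_zero)
        finally show ?thesis .
      next
        case False
        have "(real n / real N) powr \<nu> \<le> (x / 2) powr \<nu>" using False q x by (intro powr_mono2') auto
        also have "\<dots> = 2 powr \<bar>\<nu>\<bar> * x powr \<nu>" using False x by (simp add: powr_divide powr_minus_divide)
        finally show ?thesis .
      qed
      moreover have "gamma_ratio \<nu> n / real n powr \<nu> \<le> K"
        using K(2)[of n] abs_ge_self[of "gamma_ratio \<nu> n / real n powr \<nu>"] unfolding real_norm_def by linarith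
      moreover have "real N powr (- \<nu>) * gamma_ratio \<nu> n = (gamma_ratio \<nu> n / real n powr \<nu>) * (real n / real N) powr \<nu>"
        using n1 N by (simp add: powr_divide powr_minus_divide)
      ultimately have "real N powr (- \<nu>) * gamma_ratio \<nu> n \<le> K * (2 powr \<bar>\<nu>\<bar> * x powr \<nu>)"
        using K(1) by (simp only:) (intro mult_mono; simp)
      also have "\<dots> \<le> D * x powr \<nu>" using D(1) by (simp add: mult_right_mono flip: mult.assoc)
      also have "\<dots> \<le> D * (x powr \<nu> + 1)" using D(3) by (intro mult_left_mono) auto
      finally show ?thesis by (simp add: n_def)
    qed
  qed
  then show ?thesis using D(3) by blast
qed

lemma inverse_laguerre_norm:
  assumes \<nu>: "\<nu> > -1" and \<alpha>: "0 < \<alpha>" "\<alpha> < 1"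
  shows "1 / laguerre_norm \<nu> \<alpha> n = 1 / 4 * (1 - \<alpha>\<^sup>2) powr (\<nu> + 1) * \<alpha> ^ (2 * n) * gamma_ratio \<nu> n" "laguerre_norm \<nu> \<alpha> n > 0"
proof -
  have s: "1 - \<alpha>\<^sup>2 > 0" using \<alpha> by (simp add: abs_square_less_1)
  have G: "Gamma (real n + \<nu> + 1) > 0" using \<nu> by simp
  have p: "(1 - \<alpha>\<^sup>2) powr (- \<nu> - 1) = 1 / (1 - \<alpha>\<^sup>2) powr (\<nu> + 1)" using powr_minus_divide[of "1 - \<alpha>\<^sup>2" "\<nu> + 1"] by simp
  show "1 / laguerre_norm \<nu> \<alpha> n = 1 / 4 * (1 - \<alpha>\<^sup>2) powr (\<nu> + 1) * \<alpha> ^ (2 * n) * gamma_ratio \<nu> n"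
  proof -
    have "(1 / \<alpha>\<^sup>2) ^ n = 1 / \<alpha> ^ (2 * n)" by (simp add: power_one_over power_mult)
    moreover have "rGamma (real n + \<nu> + 1) = 1 / Gamma (real n + \<nu> + 1)" by (simp add: rGamma_inverse_Gamma inverse_eq_divide)
    moreover have "1 / (4 * (1 / S) * (1 / A) * (F * (1 / G))) = 1 / 4 * S * A * (G / F)" for S A F G :: real by simp
    ultimately show ?thesis unfolding laguerre_norm_def p gamma_ratio_def by (simp only:)
  qed
  show "laguerre_norm \<nu> \<alpha> n > 0"
  proof -
    have "rGamma (real n + \<nu> + 1) > 0" using G by (simp add: rGamma_inverse_Gamma)
    then show ?thesis unfolding laguerre_norm_def using s \<alpha>
      by (intro mult_pos_pos zero_less_power) auto
  qed
qed

definition tilt :: "real \<Rightarrow> nat \<Rightarrow> real" where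
  "tilt c N = 1 - c\<^sup>2 / real N"

text \<open>
  Equivalently \<open>\<alpha> + 2 \<kappa> = 1 / \<alpha>\<close> for \<open>\<alpha> = tilt c N\<close>; this is the scale at which the Laguerre polynomials are orthogonal.
\<close>
definition laguerre_scale :: "real \<Rightarrow> nat \<Rightarrow> real" where
  "laguerre_scale c N = (1 - (tilt c N)\<^sup>2) / (2 * tilt c N)"

text \<open>
  The tilt lies strictly between 0 and 1 if \<open>N > c\<^sup>2\<close>. The value 0 for the finitely many other \<open>N\<close> lets the bounds
  below hold for all \<open>N\<close>.
\<close>
definition step_profile :: "real \<Rightarrow> real \<Rightarrow> nat \<Rightarrow> real \<Rightarrow> real" where
  "step_profile c \<nu> N x = (if real N > c\<^sup>2
     then indicator {0<..<1} x * (real N / laguerre_norm \<nu> (tilt c N) (nat \<lfloor>real N * x\<rfloor>)) else 0)"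

definition limit_profile :: "real \<Rightarrow> real \<Rightarrow> real \<Rightarrow> real" where
  "limit_profile c \<nu> x =
     indicator {0<..<1} x * (1 / 4 * (2 * c\<^sup>2) powr (\<nu> + 1) * x powr \<nu> * exp (- 2 * c\<^sup>2 * x))"

definition laguerre_sum :: "real \<Rightarrow> real \<Rightarrow> nat \<Rightarrow> complex \<Rightarrow> real" where
  "laguerre_sum c \<nu> N z = (\<Sum>n<N. (cmod (poly (laguerre_poly \<nu> (laguerre_scale c N) n) z))\<^sup>2 / laguerre_norm \<nu> (tilt c N) n)"

definition laguerre_limit :: "real \<Rightarrow> real \<Rightarrow> complex \<Rightarrow> real" where
  "laguerre_limit c \<nu> z =
     (LINT x|lborel. limit_profile c \<nu> x * (cmod (bessel_series \<nu> (- (of_real (c\<^sup>2 * x) * z))))\<^sup>2)"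

context
  fixes c \<nu> :: real
  assumes c: "c > 0" and \<nu>: "\<nu> > -1"
begin

lemma tilt_bounds:
  assumes "real N > c\<^sup>2" shows "0 < tilt c N" "tilt c N < 1"
proof -
  have "0 < real N" using assms c by (metis less_trans zero_less_power)
  then show "0 < tilt c N" "tilt c N < 1" using assms c by (auto simp: tilt_def field_simps)
qed

lemma step_profile_eq:
  assumes N: "real N > c\<^sup>2" and x: "0 < x" "x < 1"
  shows "step_profile c \<nu> N x = 1 / 4 * (real N * (1 - (tilt c N)\<^sup>2)) powr (\<nu> + 1) * tilt c N ^ (2 * nat \<lfloor>real N * x\<rfloor>) * (real N powr (- \<nu>) * gamma_ratio \<nu> (nat \<lfloor>real N * x\<rfloor>))"
proof -
  have N0: "0 < real N" using N c by (metis less_trans zero_less_power)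
  have "step_profile c \<nu> N x = real N * (1 / laguerre_norm \<nu> (tilt c N) (nat \<lfloor>real N * x\<rfloor>))"
    using N x by (simp add: step_profile_def)
  also have "\<dots> = 1 / 4 * (real N * (1 - (tilt c N)\<^sup>2) powr (\<nu> + 1)) * tilt c N ^ (2 * nat \<lfloor>real N * x\<rfloor>) * gamma_ratio \<nu> (nat \<lfloor>real N * x\<rfloor>)"
    by (simp only: inverse_laguerre_norm(1)[OF \<nu> tilt_bounds[OF N]] mult_ac)
  also have "real N * (1 - (tilt c N)\<^sup>2) powr (\<nu> + 1) = (real N * (1 - (tilt c N)\<^sup>2)) powr (\<nu> + 1) * real N powr (- \<nu>)"
  proof -
    have "real N powr (\<nu> + 1) * real N powr (- \<nu>) = real N" using N0 by (simp flip: powr_add)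
    then show ?thesis by (simp add: powr_mult mult_ac)
  qed
  finally show ?thesis by (simp only: mult_ac)
qed

lemma scaled_gap_limit: "(\<lambda>N. real N * (1 - (tilt c N)\<^sup>2)) \<longlonglongrightarrow> 2 * c\<^sup>2"
  unfolding tilt_def by real_asymp

lemma scaled_gap_bounds: assumes "real N > c\<^sup>2" shows "real N * (1 - (tilt c N)\<^sup>2) \<le> 2 * c\<^sup>2" "0 < real N * (1 - (tilt c N)\<^sup>2)"
proof -
  have N0: "0 < real N" using assms c by (metis less_trans zero_less_power)
  have "real N * (1 - (tilt c N)\<^sup>2) = 2 * c\<^sup>2 - c ^ 4 / real N"
    using N0 by (simp add: tilt_def power2_eq_square power4_eq_xxxx field_simps)
  then show "real N * (1 - (tilt c N)\<^sup>2) \<le> 2 * c\<^sup>2" using N0 by simp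
  show "0 < real N * (1 - (tilt c N)\<^sup>2)" using N0 tilt_bounds[OF assms] by (simp add: abs_square_less_1)
qed

text \<open>
  With \<open>n = \<lfloor>N x\<rfloor>\<close>: \<open>N (1 - \<alpha>\<^sup>2)\<close> tends to \<open>2 c\<^sup>2\<close>, the Gamma ratio divided by \<open>N\<^sup>\<nu>\<close> tends to \<open>x\<^sup>\<nu>\<close>, and
  \<open>\<alpha>\<^sup>2\<^sup>n = exp (2 (n / N) (N ln \<alpha>))\<close> tends to \<open>exp (- 2 c\<^sup>2 x)\<close>.
\<close>
lemma step_profile_limit:
  assumes x: "0 < x" "x < 1" shows "(\<lambda>N. step_profile c \<nu> N x) \<longlonglongrightarrow> limit_profile c \<nu> x"
proof -
  define n where "n = (\<lambda>N. nat \<lfloor>real N * x\<rfloor>)"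
  have nx: "real (n N) \<le> real N * x" "real N * x < real (n N) + 1" for N
    using x by (auto simp: n_def)
  have inf: "filterlim n at_top sequentially"
  proof -
    have "filterlim (\<lambda>N. real N * x - 1) at_top sequentially" using x by real_asymp
    then have "filterlim (\<lambda>N. real (n N)) at_top sequentially"
      by (rule filterlim_at_top_mono) (use nx(2) in \<open>auto intro!: always_eventually simp: algebra_simps less_imp_le\<close>)
    then show ?thesis by (simp add: filterlim_sequentially_iff_filterlim_real)
  qed
  have t1: "(\<lambda>N. real (n N) / real N) \<longlonglongrightarrow> x"
  proof (rule Lim_null[THEN iffD2], rule Lim_null_comparison)
    show "(\<lambda>N. 1 / real N) \<longlonglongrightarrow> 0" by real_asymp
    show "\<forall>\<^sub>F N in sequentially. norm (real (n N) / real N - x) \<le> 1 / real N"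
      using eventually_gt_at_top[of 0]
    proof eventually_elim
      case (elim N)
      have "real (n N) / real N - x = (real (n N) - real N * x) / real N"
        using elim by (simp add: diff_divide_distrib)
      then have "norm (real (n N) / real N - x) = \<bar>real (n N) - real N * x\<bar> / real N"
        by (simp only: real_norm_def abs_divide abs_of_nat)
      also have "\<dots> \<le> 1 / real N" using nx[of N] by (intro divide_right_mono) auto
      finally show ?case .
    qed
  qed
  have t3: "(\<lambda>N. gamma_ratio \<nu> (n N) / real (n N) powr \<nu>) \<longlonglongrightarrow> 1"
    using gamma_ratio_asymp[OF \<nu>] inf by (rule filterlim_compose)
  have t5: "(\<lambda>N. exp (2 * (real (n N) / real N) * (real N * ln (tilt c N)))) \<longlonglongrightarrow> exp (2 * x * (- c\<^sup>2))"
  proof (intro tendsto_intros t1)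
    show "(\<lambda>N. real N * ln (tilt c N)) \<longlonglongrightarrow> - c\<^sup>2" unfolding tilt_def by real_asymp
  qed
  have lim: "(\<lambda>N. 1 / 4 * (real N * (1 - (tilt c N)\<^sup>2)) powr (\<nu> + 1) * exp (2 * (real (n N) / real N) * (real N * ln (tilt c N))) *
      ((real (n N) / real N) powr \<nu> * (gamma_ratio \<nu> (n N) / real (n N) powr \<nu>))) \<longlonglongrightarrow>
      1 / 4 * (2 * c\<^sup>2) powr (\<nu> + 1) * exp (2 * x * (- c\<^sup>2)) * (x powr \<nu> * 1)"
    using c x by (intro tendsto_mult tendsto_const tendsto_powr scaled_gap_limit t5 t1 t3) auto
  have "(\<lambda>N. step_profile c \<nu> N x) \<longlonglongrightarrow> 1 / 4 * (2 * c\<^sup>2) powr (\<nu> + 1) * exp (2 * x * (- c\<^sup>2)) * (x powr \<nu> * 1)"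
  proof (rule Lim_transform_eventually[OF lim])
    have e1: "\<forall>\<^sub>F N in sequentially. real N > c\<^sup>2" by real_asymp
    have e2: "\<forall>\<^sub>F N in sequentially. n N > 0" by (rule eventually_compose_filterlim[OF eventually_gt_at_top inf])
    show "\<forall>\<^sub>F N in sequentially. 1 / 4 * (real N * (1 - (tilt c N)\<^sup>2)) powr (\<nu> + 1) * exp (2 * (real (n N) / real N) * (real N * ln (tilt c N))) *
      ((real (n N) / real N) powr \<nu> * (gamma_ratio \<nu> (n N) / real (n N) powr \<nu>)) = step_profile c \<nu> N x"
      using e1 e2
    proof eventually_elim
      case (elim N)
      have N0: "0 < real N" using elim(1) c by (metis less_trans zero_less_power)
      have a: "tilt c N > 0" using tilt_bounds[OF elim(1)] by simp
      have "exp (2 * (real (n N) / real N) * (real N * ln (tilt c N))) = exp (real (2 * n N) * ln (tilt c N))" using N0 by simp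
      also have "\<dots> = tilt c N ^ (2 * n N)" using a by (simp only: exp_of_nat_mult exp_ln)
      finally have "exp (2 * (real (n N) / real N) * (real N * ln (tilt c N))) = tilt c N ^ (2 * n N)" .
      moreover have "(real (n N) / real N) powr \<nu> * (gamma_ratio \<nu> (n N) / real (n N) powr \<nu>) = real N powr (- \<nu>) * gamma_ratio \<nu> (n N)"
        using elim(2) N0 by (simp add: powr_divide powr_minus_divide)
      ultimately show ?case unfolding step_profile_eq[OF elim(1) x] n_def by (simp only:)
    qed
  qed
  moreover have "1 / 4 * (2 * c\<^sup>2) powr (\<nu> + 1) * exp (2 * x * (- c\<^sup>2)) * (x powr \<nu> * 1) = limit_profile c \<nu> x"
    using x by (simp add: limit_profile_def mult_ac)
  ultimately show ?thesis by simp
qed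

lemma step_profile_measurable [measurable]: "step_profile c \<nu> N \<in> borel_measurable borel" "limit_profile c \<nu> \<in> borel_measurable borel"
  unfolding step_profile_def[abs_def] limit_profile_def[abs_def] by measurable

lemma limit_profile_nonneg: "0 \<le> limit_profile c \<nu> x" by (simp add: limit_profile_def)

lemma limit_profile_le: "limit_profile c \<nu> x \<le> 1 / 4 * (2 * c\<^sup>2) powr (\<nu> + 1) * (indicator {0<..<1} x * (x powr \<nu> + 1))"
proof (cases "0 < x \<and> x < 1")
  case True
  have "x powr \<nu> * exp (- 2 * c\<^sup>2 * x) \<le> x powr \<nu> * 1" using True by (intro mult_left_mono) auto
  also have "\<dots> \<le> x powr \<nu> + 1" by simp
  finally have "1 / 4 * (2 * c\<^sup>2) powr (\<nu> + 1) * (x powr \<nu> * exp (- 2 * c\<^sup>2 * x)) \<le> 1 / 4 * (2 * c\<^sup>2) powr (\<nu> + 1) * (x powr \<nu> + 1)"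
    by (intro mult_left_mono) auto
  then show ?thesis using True by (simp add: limit_profile_def mult.assoc)
qed (auto simp: limit_profile_def)

lemma limit_profile_integrable: "integrable lborel (limit_profile c \<nu>)"
proof (rule Bochner_Integration.integrable_bound)
  show "integrable lborel (\<lambda>x. 1 / 4 * (2 * c\<^sup>2) powr (\<nu> + 1) * (indicator {0<..<1} x * (x powr \<nu> + 1)))"
    by (intro integrable_mult_right powr_integrable_unit \<nu>)
  show "AE x in lborel. norm (limit_profile c \<nu> x) \<le> norm (1 / 4 * (2 * c\<^sup>2) powr (\<nu> + 1) * (indicator {0<..<1} x * (x powr \<nu> + 1)))"
    using limit_profile_le limit_profile_nonneg by (intro AE_I2) (simp only: real_norm_def, metis abs_ge_self abs_of_nonneg order.trans)
qed measurable

lemma step_profile_nonneg: "0 \<le> step_profile c \<nu> N x"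
proof (cases "real N > c\<^sup>2")
  case True
  then show ?thesis using inverse_laguerre_norm(2)[OF \<nu> tilt_bounds[OF True], of "nat \<lfloor>real N * x\<rfloor>"] by (simp add: step_profile_def)
qed (simp add: step_profile_def)

lemma step_profile_L1: "(\<lambda>N. LINT x|lborel. \<bar>step_profile c \<nu> N x - limit_profile c \<nu> x\<bar>) \<longlonglongrightarrow> 0"
proof -
  obtain D where D: "D \<ge> 0" "\<And>N x. 0 < x \<Longrightarrow> x < 1 \<Longrightarrow> N > 0 \<Longrightarrow>
     real N powr (- \<nu>) * gamma_ratio \<nu> (nat \<lfloor>real N * x\<rfloor>) \<le> D * (x powr \<nu> + 1)"
    using gamma_ratio_bound[OF \<nu>] by blast
  define A where "A = 1 / 4 * (2 * c\<^sup>2) powr (\<nu> + 1)"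
  have A: "A \<ge> 0" by (simp add: A_def)
  let ?w = "\<lambda>x. indicator {0<..<1} x * (x powr \<nu> + 1)"
  have step_profile_le: "step_profile c \<nu> N x \<le> A * D * ?w x" for N x
  proof (cases "real N > c\<^sup>2 \<and> 0 < x \<and> x < 1")
    case True
    then have N: "real N > c\<^sup>2" and x: "0 < x" "x < 1" by auto
    have N0: "0 < real N" using N c by (metis less_trans zero_less_power)
    note al = tilt_bounds[OF N]
    have p1: "1 / 4 * (real N * (1 - (tilt c N)\<^sup>2)) powr (\<nu> + 1) \<le> 1 / 4 * (2 * c\<^sup>2) powr (\<nu> + 1)"
      using scaled_gap_bounds[OF N] \<nu> by (intro mult_left_mono powr_mono2) auto
    have p2: "tilt c N ^ (2 * nat \<lfloor>real N * x\<rfloor>) \<le> 1" using al by (intro power_le_one) auto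
    have p3: "real N powr (- \<nu>) * gamma_ratio \<nu> (nat \<lfloor>real N * x\<rfloor>) \<le> D * (x powr \<nu> + 1)"
      using N0 by (intro D(2) x) auto
    have "step_profile c \<nu> N x \<le> 1 / 4 * (2 * c\<^sup>2) powr (\<nu> + 1) * 1 * (D * (x powr \<nu> + 1))"
      unfolding step_profile_eq[OF N x]
      by (rule mult_mono[OF mult_mono[OF p1 p2] p3]) (use gamma_ratio_pos[OF \<nu>, of "nat \<lfloor>real N * x\<rfloor>"] al in auto)
    then show ?thesis using x by (simp add: A_def)
  next
    case False
    then show ?thesis using A D(1) by (auto simp: step_profile_def indicator_def)
  qed
  have "(\<lambda>N. LINT x|lborel. \<bar>step_profile c \<nu> N x - limit_profile c \<nu> x\<bar>) \<longlonglongrightarrow> (LINT x|lborel. (\<lambda>_. 0) (x::real))"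
  proof (rule integral_dominated_convergence)
    show "integrable lborel (\<lambda>x. (A * D + A) * ?w x)"
      by (intro integrable_mult_right powr_integrable_unit \<nu>)
    show "AE x in lborel. (\<lambda>N. \<bar>step_profile c \<nu> N x - limit_profile c \<nu> x\<bar>) \<longlonglongrightarrow> 0"
    proof (rule AE_I2)
      fix x
      show "(\<lambda>N. \<bar>step_profile c \<nu> N x - limit_profile c \<nu> x\<bar>) \<longlonglongrightarrow> 0"
      proof (cases "0 < x \<and> x < 1")
        case True
        then have "(\<lambda>N. step_profile c \<nu> N x) \<longlonglongrightarrow> limit_profile c \<nu> x" by (intro step_profile_limit) auto
        then show ?thesis by (intro tendsto_rabs_zero) (simp add: LIM_zero)
      next
        case False
        then have "step_profile c \<nu> N x = 0" "limit_profile c \<nu> x = 0" for N by (auto simp: step_profile_def limit_profile_def indicator_def)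
        then show ?thesis by simp
      qed
    qed
    show "AE x in lborel. norm \<bar>step_profile c \<nu> N x - limit_profile c \<nu> x\<bar> \<le> (A * D + A) * ?w x" for N
    proof (rule AE_I2)
      fix x
      have "\<bar>step_profile c \<nu> N x - limit_profile c \<nu> x\<bar> \<le> step_profile c \<nu> N x + limit_profile c \<nu> x" using step_profile_nonneg[of N x] limit_profile_nonneg[of x] by linarith
      also have "\<dots> \<le> A * D * ?w x + A * ?w x" using step_profile_le[of N x] limit_profile_le[of x] unfolding A_def by linarith
      finally show "norm \<bar>step_profile c \<nu> N x - limit_profile c \<nu> x\<bar> \<le> (A * D + A) * ?w x" by (simp add: distrib_right)
    qed
  qed measurable
  then show ?thesis by simp
qed

lemma laguerre_scale_pos: "real N > c\<^sup>2 \<Longrightarrow> laguerre_scale c N > 0"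
  using tilt_bounds[of N] by (simp add: laguerre_scale_def abs_square_less_1)

lemma laguerre_scale_limit: "laguerre_scale c \<longlonglongrightarrow> 0" "(\<lambda>N. laguerre_scale c N * real N) \<longlonglongrightarrow> c\<^sup>2"
  unfolding laguerre_scale_def tilt_def using c by real_asymp+

text \<open>
  Write \<open>p\<close>, \<open>L\<close> for the step profile and the Laguerre polynomial of degree \<open>\<lfloor>N x\<rfloor>\<close>, and \<open>q\<close>, \<open>E\<close> for their limits.
  In \<open>p \<bar>L\<bar>\<^sup>2 - q \<bar>E\<bar>\<^sup>2 = (p - q) \<bar>L\<bar>\<^sup>2 + q (\<bar>L\<bar>\<^sup>2 - \<bar>E\<bar>\<^sup>2)\<close> the first part is small in \<open>L\<^sup>1\<close>, the second one
  uniformly in \<open>x\<close>, and the bounds depend on \<open>z\<close> only through the radius \<open>r\<close>.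
\<close>
lemma laguerre_sum_uniform:
  assumes r: "r > 0"
  shows "uniform_limit (cball 0 r) (laguerre_sum c \<nu>) (laguerre_limit c \<nu>) sequentially" "bounded (laguerre_limit c \<nu> ` cball 0 r)"
proof -
  obtain C0 where C0: "\<And>k. \<bar>rGamma (real k + \<nu> + 1)\<bar> \<le> C0" using rGamma_bound[of \<nu>] by auto
  have rg: "0 \<le> rGamma (real k + \<nu> + 1)" "rGamma (real k + \<nu> + 1) \<le> C0" for k
    using \<nu> C0[of k] by (auto simp: rGamma_inverse_Gamma less_imp_le)
  have C0': "C0 \<ge> 0" using rg[of 0] by linarith
  \<comment> \<open>A bound for \<open>c\<^sup>2 x\<close> and, for large \<open>N\<close>, for \<open>\<kappa> N\<close>, which tends to \<open>c\<^sup>2\<close>.\<close>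
  define B where "B = c\<^sup>2 + 1"
  have B: "1 \<le> B" "c\<^sup>2 \<le> B" by (auto simp: B_def)
  define K where "K = C0 * exp (B * r)"
  define M where "M = C0 * exp (4 * B * r)"
  have KM: "K \<ge> 0" "M \<ge> 0" using C0' by (auto simp: K_def M_def)
  define \<epsilon> where "\<epsilon> = (\<lambda>N. laguerre_scale c N + \<bar>laguerre_scale c N * real N - c\<^sup>2\<bar>)"
  have \<epsilon>_lim: "\<epsilon> \<longlonglongrightarrow> 0"
  proof -
    have "(\<lambda>N. laguerre_scale c N + \<bar>laguerre_scale c N * real N - c\<^sup>2\<bar>) \<longlonglongrightarrow> 0 + \<bar>c\<^sup>2 - c\<^sup>2\<bar>" by (intro tendsto_intros laguerre_scale_limit)
    then show ?thesis by (simp add: \<epsilon>_def)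
  qed
  have Eb: "cmod (bessel_series \<nu> (- (of_real y * z))) \<le> K" if y: "0 \<le> y" "y \<le> B" and z: "cmod z \<le> r" for y z
    unfolding K_def
  proof (rule laguerre_poly_close(2)[OF rg y B(1) _ _ _ _ z])
    show "\<bar>0 * real (0 - k) - y\<bar> \<le> B * (real k + 1)" for k :: nat
    proof -
      have "B * 1 \<le> B * (real k + 1)" using B by (intro mult_left_mono) auto
      then show ?thesis using y by simp
    qed
  qed (use B in auto)
  have Em [measurable]: "(\<lambda>x. bessel_series \<nu> (- (of_real (c\<^sup>2 * x) * z))) \<in> borel_measurable borel" for z :: complex
  proof -
    have "isCont (\<lambda>x. bessel_series \<nu> (- (of_real (c\<^sup>2 * x) * z))) x" for x :: real
      by (rule isCont_o2[where g = "bessel_series \<nu>", OF _ bessel_series_isCont]) (intro continuous_intros)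
    then show ?thesis by (intro borel_measurable_continuous_onI continuous_at_imp_continuous_on ballI)
  qed
  have dom: "limit_profile c \<nu> x * (cmod (bessel_series \<nu> (- (of_real (c\<^sup>2 * x) * z))))\<^sup>2 \<le> limit_profile c \<nu> x * K\<^sup>2" if z: "cmod z \<le> r" for x z
  proof (cases "0 < x \<and> x < 1")
    case True
    then have "0 \<le> c\<^sup>2 * x" "c\<^sup>2 * x \<le> B" using mult_left_mono[of x 1 "c\<^sup>2"] by (auto simp: B_def)
    then have b: "cmod (bessel_series \<nu> (- (of_real (c\<^sup>2 * x) * z))) \<le> K" by (rule Eb[OF _ _ z])
    show ?thesis by (intro mult_left_mono power_mono b limit_profile_nonneg norm_ge_zero)
  qed (auto simp: limit_profile_def)
  have i0: "integrable lborel (\<lambda>x. limit_profile c \<nu> x * (cmod (bessel_series \<nu> (- (of_real (c\<^sup>2 * x) * z))))\<^sup>2)" if z: "cmod z \<le> r" for z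
  proof (rule Bochner_Integration.integrable_bound)
    show "integrable lborel (\<lambda>x. limit_profile c \<nu> x * K\<^sup>2)" by (intro integrable_mult_left limit_profile_integrable)
    show "AE x in lborel. norm (limit_profile c \<nu> x * (cmod (bessel_series \<nu> (- (of_real (c\<^sup>2 * x) * z))))\<^sup>2) \<le> norm (limit_profile c \<nu> x * K\<^sup>2)"
      using dom[OF z] limit_profile_nonneg by (intro AE_I2) (simp add: abs_mult)
  qed measurable
  show "bounded (laguerre_limit c \<nu> ` cball 0 r)"
  proof (rule boundedI)
    fix s assume "s \<in> laguerre_limit c \<nu> ` cball 0 r"
    then obtain z where z: "cmod z \<le> r" "s = laguerre_limit c \<nu> z" by auto
    have "0 \<le> laguerre_limit c \<nu> z" unfolding laguerre_limit_def using limit_profile_nonneg by (intro integral_nonneg_AE AE_I2) auto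
    moreover have "laguerre_limit c \<nu> z \<le> (LINT x|lborel. limit_profile c \<nu> x * K\<^sup>2)"
      unfolding laguerre_limit_def using i0[OF z(1)] limit_profile_integrable dom[OF z(1)] by (intro integral_mono) auto
    ultimately show "norm s \<le> (LINT x|lborel. limit_profile c \<nu> x * K\<^sup>2)" using z by simp
  qed
  define err where "err = (\<lambda>N. K\<^sup>2 * (LINT x|lborel. \<bar>step_profile c \<nu> N x - limit_profile c \<nu> x\<bar>) + 2 * K * (\<epsilon> N * M) * (LINT x|lborel. limit_profile c \<nu> x))"
  have err_lim: "err \<longlonglongrightarrow> 0"
  proof -
    have "err \<longlonglongrightarrow> K\<^sup>2 * 0 + 2 * K * (0 * M) * (LINT x|lborel. limit_profile c \<nu> x)"
      unfolding err_def by (intro tendsto_intros step_profile_L1 \<epsilon>_lim)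
    then show ?thesis by simp
  qed
  have key: "\<bar>laguerre_sum c \<nu> N z - laguerre_limit c \<nu> z\<bar> \<le> err N" if N: "real N > c\<^sup>2" and kN: "laguerre_scale c N * real N \<le> B" and z: "cmod z \<le> r" for N z
  proof -
    have N0: "0 < N" using N c by (metis less_trans of_nat_0_less_iff zero_less_power)
    define L where "L = (\<lambda>x. poly (laguerre_poly \<nu> (laguerre_scale c N) (nat \<lfloor>real N * x\<rfloor>)) z)"
    define E where "E = (\<lambda>x. bessel_series \<nu> (- (of_real (c\<^sup>2 * x) * z)))"
    have kp: "laguerre_scale c N > 0" by (rule laguerre_scale_pos[OF N])
    have \<epsilon>0: "\<epsilon> N \<ge> 0" using kp by (simp add: \<epsilon>_def)
    have lag: "cmod (L x) \<le> K" "cmod (E x) \<le> K" "cmod (L x - E x) \<le> \<epsilon> N * M" if x: "0 < x" "x < 1" for x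
    proof -
      define n where "n = nat \<lfloor>real N * x\<rfloor>"
      have nx: "real n \<le> real N * x" "real N * x < real n + 1" using x by (auto simp: n_def)
      have xb: "0 \<le> c\<^sup>2 * x" "c\<^sup>2 * x \<le> B" using x mult_left_mono[of x 1 "c\<^sup>2"] by (auto simp: B_def)
      have "real N * x \<le> real N" using x by (simp add: mult_left_le)
      then have knB: "laguerre_scale c N * real n \<le> B" using nx(1) kp kN mult_left_mono[of "real n" "real N" "laguerre_scale c N"] by linarith
      have close: "\<bar>laguerre_scale c N * real (n - k) - c\<^sup>2 * x\<bar> \<le> \<epsilon> N * (real k + 1)" for k
      proof -
        have "\<bar>real (n - k) - real N * x\<bar> \<le> real k + 1" using nx by (cases "k \<le> n") (auto simp: of_nat_diff)
        then have "laguerre_scale c N * \<bar>real (n - k) - real N * x\<bar> \<le> laguerre_scale c N * (real k + 1)" using kp by (intro mult_left_mono) auto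
        moreover have "\<bar>laguerre_scale c N * real N - c\<^sup>2\<bar> * x \<le> \<bar>laguerre_scale c N * real N - c\<^sup>2\<bar> * (real k + 1)" using x by (intro mult_left_mono) auto
        moreover have "laguerre_scale c N * real (n - k) - c\<^sup>2 * x = laguerre_scale c N * (real (n - k) - real N * x) + (laguerre_scale c N * real N - c\<^sup>2) * x"
          by (simp add: algebra_simps)
        then have "\<bar>laguerre_scale c N * real (n - k) - c\<^sup>2 * x\<bar> \<le> laguerre_scale c N * \<bar>real (n - k) - real N * x\<bar> + \<bar>laguerre_scale c N * real N - c\<^sup>2\<bar> * x"
          using kp x by (simp only:) (rule order.trans[OF abs_triangle_ineq], simp add: abs_mult)
        ultimately show ?thesis by (simp add: \<epsilon>_def distrib_right)
      qed
      note * = laguerre_poly_close[OF rg xb B(1) less_imp_le[OF kp] knB \<epsilon>0 close z]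
      show "cmod (L x) \<le> K" "cmod (E x) \<le> K" "cmod (L x - E x) \<le> \<epsilon> N * M"
        using * by (simp_all add: L_def E_def K_def M_def n_def mult.assoc)
    qed
    have SNe: "laguerre_sum c \<nu> N z = (LINT x|lborel. step_profile c \<nu> N x * (cmod (L x))\<^sup>2)" and iN: "integrable lborel (\<lambda>x. step_profile c \<nu> N x * (cmod (L x))\<^sup>2)"
    proof -
      define f where "f = (\<lambda>n. real N * ((cmod (poly (laguerre_poly \<nu> (laguerre_scale c N) n) z))\<^sup>2 / laguerre_norm \<nu> (tilt c N) n))"
      have eq: "step_profile c \<nu> N x * (cmod (L x))\<^sup>2 = indicator {0<..<1} x * f (nat \<lfloor>real N * x\<rfloor>)" for x
        using N by (simp add: step_profile_def f_def L_def)
      show "integrable lborel (\<lambda>x. step_profile c \<nu> N x * (cmod (L x))\<^sup>2)" unfolding eq by (rule step_function_integral(1)[OF N0])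
      show "laguerre_sum c \<nu> N z = (LINT x|lborel. step_profile c \<nu> N x * (cmod (L x))\<^sup>2)"
      proof -
        have "(\<Sum>n<N. f n) = real N * laguerre_sum c \<nu> N z" by (simp only: f_def laguerre_sum_def sum_distrib_left)
        then show ?thesis unfolding eq step_function_integral(2)[OF N0] using N0 by simp
      qed
    qed
    have phiN_int: "integrable lborel (step_profile c \<nu> N)"
    proof -
      have "step_profile c \<nu> N = (\<lambda>x. indicator {0<..<1} x * (real N / laguerre_norm \<nu> (tilt c N) (nat \<lfloor>real N * x\<rfloor>)))"
        by (rule ext) (simp add: step_profile_def N)
      then show ?thesis using step_function_integral(1)[OF N0, of "\<lambda>n. real N / laguerre_norm \<nu> (tilt c N) n"] by (simp only:)
    qed
    have "\<bar>laguerre_sum c \<nu> N z - laguerre_limit c \<nu> z\<bar> = \<bar>LINT x|lborel. step_profile c \<nu> N x * (cmod (L x))\<^sup>2 - limit_profile c \<nu> x * (cmod (E x))\<^sup>2\<bar>"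
      unfolding SNe laguerre_limit_def E_def using iN i0[OF z] by simp
    also have "\<dots> \<le> (LINT x|lborel. K\<^sup>2 * \<bar>step_profile c \<nu> N x - limit_profile c \<nu> x\<bar> + 2 * K * (\<epsilon> N * M) * limit_profile c \<nu> x)"
    proof (rule Bochner_Integration.integral_abs_bound_integral)
      show "integrable lborel (\<lambda>x. step_profile c \<nu> N x * (cmod (L x))\<^sup>2 - limit_profile c \<nu> x * (cmod (E x))\<^sup>2)"
        using iN i0[OF z] unfolding E_def by (rule Bochner_Integration.integrable_diff)
      show "integrable lborel (\<lambda>x. K\<^sup>2 * \<bar>step_profile c \<nu> N x - limit_profile c \<nu> x\<bar> + 2 * K * (\<epsilon> N * M) * limit_profile c \<nu> x)"
        by (intro Bochner_Integration.integrable_add integrable_mult_right integrable_abs Bochner_Integration.integrable_diff phiN_int limit_profile_integrable)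
      fix x :: real
      show "\<bar>step_profile c \<nu> N x * (cmod (L x))\<^sup>2 - limit_profile c \<nu> x * (cmod (E x))\<^sup>2\<bar> \<le> K\<^sup>2 * \<bar>step_profile c \<nu> N x - limit_profile c \<nu> x\<bar> + 2 * K * (\<epsilon> N * M) * limit_profile c \<nu> x"
      proof (cases "0 < x \<and> x < 1")
        case True
        then have x: "0 < x" "x < 1" by auto
        have "(cmod (L x))\<^sup>2 \<le> K\<^sup>2" using lag(1)[OF x] by (intro power_mono) auto
        then have 1: "\<bar>step_profile c \<nu> N x - limit_profile c \<nu> x\<bar> * (cmod (L x))\<^sup>2 \<le> \<bar>step_profile c \<nu> N x - limit_profile c \<nu> x\<bar> * K\<^sup>2" by (intro mult_left_mono) auto
        have "\<bar>(cmod (L x))\<^sup>2 - (cmod (E x))\<^sup>2\<bar> = \<bar>cmod (L x) - cmod (E x)\<bar> * (cmod (L x) + cmod (E x))"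
          by (simp add: power2_eq_square square_diff_square_factored abs_mult mult.commute)
        also have "\<dots> \<le> (\<epsilon> N * M) * (2 * K)"
          using lag[OF x] \<epsilon>0 KM norm_triangle_ineq3[of "L x" "E x"] by (intro mult_mono) auto
        finally have 2: "limit_profile c \<nu> x * \<bar>(cmod (L x))\<^sup>2 - (cmod (E x))\<^sup>2\<bar> \<le> limit_profile c \<nu> x * ((\<epsilon> N * M) * (2 * K))"
          using limit_profile_nonneg[of x] by (intro mult_left_mono)
        have "\<bar>step_profile c \<nu> N x * (cmod (L x))\<^sup>2 - limit_profile c \<nu> x * (cmod (E x))\<^sup>2\<bar> =
          \<bar>(step_profile c \<nu> N x - limit_profile c \<nu> x) * (cmod (L x))\<^sup>2 + limit_profile c \<nu> x * ((cmod (L x))\<^sup>2 - (cmod (E x))\<^sup>2)\<bar>" by (simp add: algebra_simps)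
        also have "\<dots> \<le> \<bar>step_profile c \<nu> N x - limit_profile c \<nu> x\<bar> * (cmod (L x))\<^sup>2 + limit_profile c \<nu> x * \<bar>(cmod (L x))\<^sup>2 - (cmod (E x))\<^sup>2\<bar>"
          using limit_profile_nonneg[of x] by (intro order.trans[OF abs_triangle_ineq]) (simp add: abs_mult)
        finally show ?thesis using 1 2 by (simp add: mult_ac)
      next
        case False
        then have "step_profile c \<nu> N x = 0" "limit_profile c \<nu> x = 0" by (auto simp: step_profile_def limit_profile_def indicator_def)
        then show ?thesis by simp
      qed
    qed
    also have "\<dots> = err N"
      unfolding err_def using phiN_int limit_profile_integrable
      by (subst Bochner_Integration.integral_add) auto
    finally show ?thesis .
  qed
  show "uniform_limit (cball 0 r) (laguerre_sum c \<nu>) (laguerre_limit c \<nu>) sequentially"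
  proof (rule uniform_limitI)
    fix e :: real assume e: "e > 0"
    have e1: "\<forall>\<^sub>F N in sequentially. real N > c\<^sup>2" by real_asymp
    have e2: "\<forall>\<^sub>F N in sequentially. laguerre_scale c N * real N < B"
      using laguerre_scale_limit(2) by (rule order_tendstoD) (simp add: B_def)
    have e3: "\<forall>\<^sub>F N in sequentially. err N < e" using err_lim e by (rule order_tendstoD)
    show "\<forall>\<^sub>F N in sequentially. \<forall>z\<in>cball 0 r. dist (laguerre_sum c \<nu> N z) (laguerre_limit c \<nu> z) < e"
      using e1 e2 e3
    proof eventually_elim
      case (elim N)
      show ?case
      proof
        fix z :: complex assume "z \<in> cball 0 r"
        then have "\<bar>laguerre_sum c \<nu> N z - laguerre_limit c \<nu> z\<bar> \<le> err N" using elim by (intro key) auto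
        then show "dist (laguerre_sum c \<nu> N z) (laguerre_limit c \<nu> z) < e" using elim by (simp add: dist_real_def)
      qed
    qed
  qed
qed

section \<open>The rescaled one-point function\<close>

lemma bessel_potential_measurable [measurable]: "bessel_potential c \<nu> N \<in> borel_measurable borel"
proof -
  have "bessel_K \<nu> ((real N)\<^sup>2 * cmod \<zeta> / c\<^sup>2) = (if (real N)\<^sup>2 * cmod \<zeta> / c\<^sup>2 = 0 then bessel_K \<nu> 0 else bessel_K_integral \<nu> ((real N)\<^sup>2 * cmod \<zeta> / c\<^sup>2))" for \<zeta>
  proof (cases "(real N)\<^sup>2 * cmod \<zeta> / c\<^sup>2 = 0")
    case False
    moreover have "(real N)\<^sup>2 * cmod \<zeta> / c\<^sup>2 \<ge> 0" by simp
    ultimately have "(real N)\<^sup>2 * cmod \<zeta> / c\<^sup>2 > 0" by linarith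
    then show ?thesis using False by (simp add: bessel_K_eq_integral)
  next
    case True
    then show ?thesis by (simp only: simp_thms if_True)
  qed
  then show ?thesis unfolding bessel_potential_def[abs_def] bessel_K_integral_def by simp
qed

text \<open>
  The linear term of the potential has the coefficient \<open>N (N / c\<^sup>2 - 1) = l \<alpha>\<close>, so in the variable \<open>l \<zeta>\<close> it is the
  tilt \<open>\<alpha> = 1 - c\<^sup>2 / N\<close>.
\<close>
lemma exp_bessel_potential:
  assumes N: "N > 0" and z: "\<zeta> \<noteq> 0"
  defines "l \<equiv> (real N)\<^sup>2 / c\<^sup>2"
  shows "exp (- real N * bessel_potential c \<nu> N \<zeta>) = 2 powr (\<nu> - 1) * l powr (- \<nu>) * bessel_weight \<nu> (tilt c N) (of_real l * \<zeta>)"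
proof -
  have l: "l > 0" using N c by (simp add: l_def)
  have r: "cmod \<zeta> > 0" using z by simp
  have arg: "(real N)\<^sup>2 * cmod \<zeta> / c\<^sup>2 = l * cmod \<zeta>" by (simp add: l_def)
  have pos: "bessel_K \<nu> (l * cmod \<zeta>) * cmod \<zeta> powr \<nu> > 0" using l r bessel_K_pos[of "l * cmod \<zeta>" \<nu>] by simp
  have co: "real N * (real N / c\<^sup>2 - 1) = l * tilt c N" using N c by (simp add: l_def tilt_def power2_eq_square field_simps)
  have "- real N * bessel_potential c \<nu> N \<zeta> = ln (bessel_K \<nu> (l * cmod \<zeta>) * cmod \<zeta> powr \<nu>) + (real N * (real N / c\<^sup>2 - 1)) * Re \<zeta>"
    unfolding bessel_potential_def arg using N by (simp add: right_diff_distrib)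
  then have "exp (- real N * bessel_potential c \<nu> N \<zeta>) = bessel_K \<nu> (l * cmod \<zeta>) * cmod \<zeta> powr \<nu> * exp (tilt c N * Re (of_real l * \<zeta>))"
    unfolding co using pos by (simp add: exp_add mult_ac)
  then show ?thesis unfolding bessel_K_scaled[OF r l] bessel_weight_def using l by (simp add: norm_mult)
qed

lemma bessel_potential_isCont:
  assumes N: "N > 0" and z: "\<zeta> \<noteq> 0"
  shows "isCont (bessel_potential c \<nu> N) \<zeta>"
proof -
  have pos: "(real N)\<^sup>2 * cmod \<xi> / c\<^sup>2 > 0" if "\<xi> \<noteq> 0" for \<xi> :: complex using that N c by simp
  define Q where "Q = (\<lambda>\<zeta>. - (1 / real N) * ln (bessel_K_integral \<nu> ((real N)\<^sup>2 * cmod \<zeta> / c\<^sup>2) * cmod \<zeta> powr \<nu>) - (real N / c\<^sup>2 - 1) * Re \<zeta>)"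
  have gp: "bessel_K_integral \<nu> ((real N)\<^sup>2 * cmod \<zeta> / c\<^sup>2) > 0" using bessel_K_pos[OF pos[OF z], of \<nu>] bessel_K_eq_integral[OF pos[OF z], of \<nu>] by simp
  have gc: "isCont (\<lambda>\<zeta>. bessel_K_integral \<nu> ((real N)\<^sup>2 * cmod \<zeta> / c\<^sup>2)) \<zeta>"
  proof (rule isCont_o2[where g = "bessel_K_integral \<nu>"])
    show "isCont (\<lambda>\<zeta>. (real N)\<^sup>2 * cmod \<zeta> / c\<^sup>2) \<zeta>" using c by (intro continuous_intros) auto
    show "isCont (bessel_K_integral \<nu>) ((real N)\<^sup>2 * cmod \<zeta> / c\<^sup>2)"
      by (rule bessel_K_integral_isCont[OF pos[OF z]])
  qed
  have "isCont Q \<zeta>" unfolding Q_def using gc gp z by (intro continuous_intros) auto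
  moreover have "\<forall>\<^sub>F \<xi> in nhds \<zeta>. bessel_potential c \<nu> N \<xi> = Q \<xi>"
    using t1_space_nhds[OF z]
  proof eventually_elim
    case (elim \<xi>)
    then show ?case using bessel_K_eq_integral[OF pos[OF elim], of \<nu>] by (simp add: bessel_potential_def Q_def)
  qed
  ultimately show ?thesis by (subst isCont_cong)
qed

text \<open>
  All powers of \<open>l\<close> cancel: the weight contributes a constant that the norms \<open>H n\<close> undo, and the factor
  \<open>l\<^sup>2\<close> from the change of variables in the norms cancels against the prefactor of the rescaling.
\<close>
lemma rescaled_one_point:
  assumes N: "real N > c\<^sup>2" and z: "z \<noteq> 0"
  shows "rescaled_one_point_function c \<nu> N z = bessel_weight \<nu> (tilt c N) z * laguerre_sum c \<nu> N z"
proof -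
  have N0: "N > 0" using N c by (metis less_trans of_nat_0_less_iff zero_less_power)
  define l where "l = (real N)\<^sup>2 / c\<^sup>2"
  have l: "l > 0" using N0 c by (simp add: l_def)
  note al = tilt_bounds[OF N]
  have scale: "laguerre_scale c N = (1 - (tilt c N)\<^sup>2) / (2 * tilt c N)" by (simp add: laguerre_scale_def)
  define A where "A = 2 powr (\<nu> - 1) * l powr (- \<nu>)"
  have A: "A > 0" using l by (simp add: A_def)
  define H where "H = (\<lambda>n. A * laguerre_norm \<nu> (tilt c N) n / l\<^sup>2)"
  have H: "H n > 0" for n using A l inverse_laguerre_norm(2)[OF \<nu> al] by (simp add: H_def)
  \<comment> \<open>Multiplying the scale by \<open>l\<close> evaluates the Laguerre polynomial at \<open>l \<zeta>\<close>.\<close>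
  define p where "p = (\<lambda>n. Polynomial.smult (of_real (1 / sqrt (H n))) (laguerre_poly \<nu> (laguerre_scale c N * l) n))"
  have lagscale: "poly (laguerre_poly \<nu> (laguerre_scale c N * l) n) \<zeta> = poly (laguerre_poly \<nu> (laguerre_scale c N) n) (of_real l * \<zeta>)" for n \<zeta>
  proof -
    have "laguerre_coeff \<nu> (laguerre_scale c N * l) n k = laguerre_coeff \<nu> (laguerre_scale c N) n k * l ^ k" for k
    proof -
      have "(- (laguerre_scale c N * l)) ^ k = (- laguerre_scale c N) ^ k * l ^ k" by (simp flip: power_mult_distrib)
      then show ?thesis by (simp add: laguerre_coeff_def)
    qed
    then show ?thesis unfolding poly_laguerre by (simp add: power_mult_distrib mult.assoc)
  qed
  have pp: "poly (p n) \<zeta> = of_real (1 / sqrt (H n)) * poly (laguerre_poly \<nu> (laguerre_scale c N) n) (of_real l * \<zeta>)" for n \<zeta>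
    by (simp add: p_def lagscale)
  define F where "F = (\<lambda>m n z. complex_of_real (bessel_weight \<nu> (tilt c N) z) * (poly (laguerre_poly \<nu> (laguerre_scale c N) m) z * cnj (poly (laguerre_poly \<nu> (laguerre_scale c N) n) z)))"
  have wm [measurable]: "bessel_weight \<nu> (tilt c N) \<in> borel_measurable borel" unfolding bessel_weight_def[abs_def] by measurable
  have pm [measurable]: "poly q \<in> borel_measurable borel" "cnj \<in> borel_measurable borel" for q :: "complex poly"
    by (intro borel_measurable_continuous_onI continuous_intros)+
  have Fm [measurable]: "F m n \<in> borel_measurable borel" for m n unfolding F_def by measurable
  have Fi: "integrable area_measure (F m n)" and Fe: "(LINT z|area_measure. F m n z) = (if m = n then of_real (laguerre_norm \<nu> (tilt c N) m) else 0)" for m n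
    using laguerre_orthogonal[OF \<nu> al, of m n] unfolding F_def scale by auto
  define E where "E = (\<lambda>m n \<zeta>. complex_of_real (exp (- real N * bessel_potential c \<nu> N \<zeta>)) * (poly (p m) \<zeta> * cnj (poly (p n) \<zeta>)))"
  have Em: "E m n \<in> borel_measurable area_measure" for m n unfolding E_def by measurable
  define k where "k = (\<lambda>m n. complex_of_real (A * (1 / sqrt (H m)) * (1 / sqrt (H n))))"
  have EF: "AE \<zeta> in area_measure. E m n \<zeta> = k m n * F m n (of_real l * \<zeta>)" for m n
  proof -
    have "AE \<zeta> in area_measure. \<zeta> \<notin> {0::complex}"
      by (rule AE_not_in) (simp add: null_sets_def emeasure_area)
    then show ?thesis
    proof eventually_elim
      case (elim \<zeta>)
      then have "exp (- real N * bessel_potential c \<nu> N \<zeta>) = A * bessel_weight \<nu> (tilt c N) (of_real l * \<zeta>)"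
        using exp_bessel_potential[OF N0] by (simp add: A_def l_def)
      then show ?case by (simp add: E_def F_def k_def pp)
    qed
  qed
  have Ei: "integrable area_measure (E m n)" for m n
  proof -
    have "integrable area_measure (\<lambda>\<zeta>. k m n * F m n (of_real l * \<zeta>))"
      by (intro integrable_mult_right area_scale(2) Fm l Fi)
    then show ?thesis by (subst integrable_cong_AE[OF Em _ EF]) auto
  qed
  have Ee: "(LINT \<zeta>|area_measure. E m n \<zeta>) = of_bool (m = n)" for m n
  proof -
    have "(LINT \<zeta>|area_measure. E m n \<zeta>) = (LINT \<zeta>|area_measure. k m n * F m n (of_real l * \<zeta>))"
      by (rule integral_cong_AE[OF Em _ EF]) auto
    also have "\<dots> = k m n * ((if m = n then of_real (laguerre_norm \<nu> (tilt c N) m) else 0) / of_real (l\<^sup>2))"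
      by (simp only: integral_mult_right_zero area_scale(1)[OF Fm l] Fe)
    also have "\<dots> = of_bool (m = n)"
    proof (cases "m = n")
      case True
      have "A * (1 / sqrt (H m)) * (1 / sqrt (H m)) * (laguerre_norm \<nu> (tilt c N) m / l\<^sup>2) = (A * laguerre_norm \<nu> (tilt c N) m / l\<^sup>2) / (sqrt (H m) * sqrt (H m))"
        by simp
      also have "sqrt (H m) * sqrt (H m) = H m" using H[of m] by simp
      also have "A * laguerre_norm \<nu> (tilt c N) m / l\<^sup>2 = H m" by (simp only: H_def)
      also have "H m / H m = 1" using H[of m] by simp
      finally have "complex_of_real (A * (1 / sqrt (H m)) * (1 / sqrt (H m)) * (laguerre_norm \<nu> (tilt c N) m / l\<^sup>2)) = 1" by (simp only: of_real_1)
      then show ?thesis using True by (simp only: k_def of_real_mult of_real_divide if_True of_bool_eq simp_thms)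
    qed simp
    finally show ?thesis .
  qed
  define \<zeta> where "\<zeta> = of_real ((c / real N)\<^sup>2) * z"
  have lz: "of_real l * \<zeta> = z"
  proof -
    have "l * (c / real N)\<^sup>2 = 1" using N0 c by (simp add: l_def power_divide)
    then have "complex_of_real (l * (c / real N)\<^sup>2) = 1" by (simp only: of_real_1)
    then show ?thesis by (simp add: \<zeta>_def mult.assoc[symmetric])
  qed
  have \<zeta>0: "\<zeta> \<noteq> 0" using lz z by auto
  have "one_point_function N (bessel_potential c \<nu> N) \<zeta> = exp (- real N * bessel_potential c \<nu> N \<zeta>) * (\<Sum>k<N. (cmod (poly (p k) \<zeta>))\<^sup>2)"
  proof (rule one_point_function_orthonormal)
    show "isCont (bessel_potential c \<nu> N) \<zeta>" by (rule bessel_potential_isCont[OF N0 \<zeta>0])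
    show "degree (p i) \<le> i" for i
      using degree_smult_le[of "of_real (1 / sqrt (H i))" "laguerre_poly \<nu> (laguerre_scale c N * l) i"] degree_laguerre[of \<nu> "laguerre_scale c N * l" i] by (simp add: p_def)
    show "coeff (p i) i \<noteq> 0" for i
    proof -
      have "laguerre_scale c N > 0" by (rule laguerre_scale_pos[OF N])
      moreover have "rGamma (real i + \<nu> + 1) > 0" using \<nu> by (simp add: rGamma_inverse_Gamma)
      ultimately show ?thesis using H[of i] l by (simp add: p_def coeff_laguerre laguerre_coeff_def)
    qed
    show "integrable area_measure (\<lambda>x. complex_of_real (exp (- real N * bessel_potential c \<nu> N x)) * (poly (p m) x * cnj (poly (p n) x)))" for m n
      using Ei[of m n] by (simp add: E_def)
    show "(LINT x|area_measure. complex_of_real (exp (- real N * bessel_potential c \<nu> N x)) * (poly (p m) x * cnj (poly (p n) x))) = of_bool (m = n)" for m n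
      using Ee[of m n] by (simp add: E_def)
  qed (rule bessel_potential_measurable)
  also have "exp (- real N * bessel_potential c \<nu> N \<zeta>) = A * bessel_weight \<nu> (tilt c N) z"
    using exp_bessel_potential[OF N0 \<zeta>0] by (simp add: A_def l_def[symmetric] lz)
  also have "(\<Sum>k<N. (cmod (poly (p k) \<zeta>))\<^sup>2) = (\<Sum>k<N. (l\<^sup>2 / A) * ((cmod (poly (laguerre_poly \<nu> (laguerre_scale c N) k) z))\<^sup>2 / laguerre_norm \<nu> (tilt c N) k))"
  proof (intro sum.cong refl)
    fix k
    have "(cmod (poly (p k) \<zeta>))\<^sup>2 = (1 / sqrt (H k))\<^sup>2 * (cmod (poly (laguerre_poly \<nu> (laguerre_scale c N) k) z))\<^sup>2"
      unfolding pp lz norm_mult power_mult_distrib norm_of_real power2_abs ..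
    also have "(1 / sqrt (H k))\<^sup>2 = 1 / H k" using H[of k] by (simp add: power_divide)
    finally show "(cmod (poly (p k) \<zeta>))\<^sup>2 = (l\<^sup>2 / A) * ((cmod (poly (laguerre_poly \<nu> (laguerre_scale c N) k) z))\<^sup>2 / laguerre_norm \<nu> (tilt c N) k)"
      by (simp add: H_def)
  qed
  also have "\<dots> = (l\<^sup>2 / A) * laguerre_sum c \<nu> N z" by (simp add: laguerre_sum_def sum_distrib_left)
  finally have R: "one_point_function N (bessel_potential c \<nu> N) \<zeta> = l\<^sup>2 * (bessel_weight \<nu> (tilt c N) z * laguerre_sum c \<nu> N z)"
    using A by (simp add: mult_ac)
  have "(c / real N) ^ 4 * l\<^sup>2 = 1"
    using N0 c by (simp add: l_def power_divide power2_eq_square power4_eq_xxxx)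
  then show ?thesis unfolding rescaled_one_point_function_def \<zeta>_def[symmetric] R by (simp add: mult.assoc[symmetric])
qed

lemma bessel_J_series:
  assumes "s > 0" "z \<noteq> 0"
  shows "(cmod (bessel_J \<nu> (of_real s * csqrt z)))\<^sup>2 = (s / 2) powr (2 * \<nu>) * cmod z powr \<nu> * (cmod (bessel_series \<nu> (- (of_real (s\<^sup>2 / 4) * z))))\<^sup>2"
proof -
  define w where "w = of_real s * csqrt z / 2"
  have w: "w \<noteq> 0" using assms by (simp add: w_def)
  have w2: "w\<^sup>2 = of_real (s\<^sup>2 / 4) * z" by (simp add: w_def power_mult_distrib power_divide)
  have cw: "cmod w = (s / 2) * sqrt (cmod z)" using assms by (simp add: w_def norm_mult norm_divide)
  have series: "(\<Sum>k. (-1) ^ k * rGamma (of_nat k + of_real \<nu> + 1) / fact k * w ^ (2 * k)) = bessel_series \<nu> (- (of_real (s\<^sup>2 / 4) * z))"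
    unfolding bessel_series_def
  proof (intro suminf_cong)
    fix k
    have r: "rGamma (of_nat k + of_real \<nu> + 1) = complex_of_real (rGamma (real k + \<nu> + 1))"
      by (simp add: rGamma_complex_of_real[symmetric])
    have "(- (of_real (s\<^sup>2 / 4) * z)) ^ k = (-1) ^ k * w ^ (2 * k)"
      unfolding w2[symmetric] power_mult by (rule power_minus)
    then show "(-1) ^ k * rGamma (of_nat k + of_real \<nu> + 1) / fact k * w ^ (2 * k) = complex_of_real (rGamma (of_nat k + \<nu> + 1) / fact k) * (- (of_real (s\<^sup>2 / 4) * z)) ^ k"
      by (simp add: r)
  qed
  have "cmod (w powr of_real \<nu>) = cmod w powr \<nu>"
    using w by (simp add: powr_def norm_exp_eq_Re)
  then have "(cmod (bessel_J \<nu> (of_real s * csqrt z)))\<^sup>2 = (cmod w powr \<nu>)\<^sup>2 * (cmod (bessel_series \<nu> (- (of_real (s\<^sup>2 / 4) * z))))\<^sup>2"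
    unfolding bessel_J_def w_def[symmetric] series by (simp add: norm_mult power_mult_distrib)
  also have "(cmod w powr \<nu>)\<^sup>2 = (s / 2) powr (2 * \<nu>) * cmod z powr \<nu>"
  proof -
    have "(cmod w powr \<nu>)\<^sup>2 = cmod w powr (2 * \<nu>)" by (simp only: power2_eq_square mult_2 powr_add)
    also have "\<dots> = (s / 2) powr (2 * \<nu>) * sqrt (cmod z) powr (2 * \<nu>)" unfolding cw by (rule powr_mult)
    also have "sqrt (cmod z) powr (2 * \<nu>) = cmod z powr \<nu>"
    proof -
      have "sqrt (cmod z) powr (2 * \<nu>) = (cmod z powr (1 / 2)) powr (2 * \<nu>)" by (simp only: powr_half_sqrt norm_ge_zero)
      then show ?thesis by (simp add: powr_powr)
    qed
    finally show ?thesis .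
  qed
  finally show ?thesis .
qed

text \<open>
  The substitution \<open>s = 2 c \<surd>x\<close>, under which \<open>c\<^sup>2 x = s\<^sup>2 / 4\<close>.
\<close>
lemma limit_density_eq:
  assumes z: "z \<noteq> 0"
  shows "limit_density c \<nu> z = bessel_weight \<nu> 1 z * laguerre_limit c \<nu> z"
proof -
  have r: "cmod z > 0" using z by simp
  define e where "e = (\<lambda>x. (cmod (bessel_series \<nu> (- (of_real (c\<^sup>2 * x) * z))))\<^sup>2)"
  \<comment> \<open>The limit profile vanishes at 1. With this end point included, the two
     integrands of the substitution agree at every \<open>s\<close>, not only almost everywhere.\<close>
  define f where "f = (\<lambda>x. indicator {0<..1} x * (1 / 4 * (2 * c\<^sup>2) powr (\<nu> + 1) * x powr \<nu> * exp (- 2 * c\<^sup>2 * x)) * e x)"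
  define g where "g = (\<lambda>s::real. s\<^sup>2 / (4 * c\<^sup>2))"
  have g: "g 0 = 0" "g (2 * c) = 1" using c by (simp_all add: g_def power2_eq_square)
  have ec: "isCont e x" for x
    unfolding e_def by (intro continuous_intros isCont_o2[where g = "bessel_series \<nu>", OF _ bessel_series_isCont])
  have em [measurable]: "e \<in> borel_measurable borel"
    by (intro borel_measurable_continuous_onI continuous_at_imp_continuous_on ballI ec)
  have fm [measurable]: "f \<in> borel_measurable borel" unfolding f_def by measurable
  have pm [measurable]: "limit_profile c \<nu> \<in> borel_measurable borel" by (rule step_profile_measurable)
  have AEf: "AE x in lborel. limit_profile c \<nu> x * e x = f x"
    using AE_lborel_singleton[of 1] by eventually_elim (auto simp: f_def limit_profile_def indicator_def)
  have fi: "integrable lborel f"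
  proof -
    have "bounded (e ` {0..1})"
      by (intro compact_imp_bounded compact_continuous_image continuous_at_imp_continuous_on ballI ec) auto
    then obtain K where "\<forall>y\<in>e ` {0..1}. norm y \<le> K"
      unfolding bounded_iff by blast
    then have K: "\<bar>e x\<bar> \<le> K" if "x \<in> {0..1}" for x using that by auto
    have "norm (limit_profile c \<nu> x * e x) \<le> norm (limit_profile c \<nu> x * K)" for x
    proof (cases "0 < x \<and> x < 1")
      case True
      then have "\<bar>e x\<bar> \<le> \<bar>K\<bar>" using K[of x] by force
      then show ?thesis unfolding real_norm_def abs_mult by (rule mult_left_mono) simp
    qed (auto simp: limit_profile_def)
    then have "integrable lborel (\<lambda>x. limit_profile c \<nu> x * e x)"
      by (intro Bochner_Integration.integrable_bound[OF integrable_mult_left[OF limit_profile_integrable, of K]] AE_I2) auto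
    then show ?thesis by (subst (asm) integrable_cong_AE[OF _ _ AEf]) auto
  qed
  have sub: "(LINT x|lborel. f x * indicator {g 0..g (2 * c)} x) = (LINT s|lborel. f (g s) * (s / (2 * c\<^sup>2)) * indicator {0..2 * c} s)"
  proof (rule integral_substitution(2))
    show "set_integrable lborel {g 0..g (2 * c)} f"
      unfolding set_integrable_def using integrable_mult_indicator[OF _ fi, of "{g 0..g (2 * c)}"] by simp
    show "(g has_real_derivative s / (2 * c\<^sup>2)) (at s)" for s
    proof -
      have "((\<lambda>s. s\<^sup>2) has_real_derivative 2 * s) (at s)" by (auto intro!: derivative_eq_intros)
      from DERIV_cdivide[OF this, of "4 * c\<^sup>2"] show ?thesis by (simp add: g_def)
    qed
    show "continuous_on {0..2 * c} (\<lambda>s. s / (2 * c\<^sup>2))" using c by (intro continuous_intros) auto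
  qed (use c in auto)
  have SLe: "laguerre_limit c \<nu> z = (LINT x|lborel. f x * indicator {g 0..g (2 * c)} x)"
  proof -
    have "laguerre_limit c \<nu> z = (LINT x|lborel. limit_profile c \<nu> x * e x)" by (simp add: laguerre_limit_def e_def)
    also have "\<dots> = (LINT x|lborel. f x)" by (rule integral_cong_AE[OF _ _ AEf]) auto
    also have "\<dots> = (LINT x|lborel. f x * indicator {g 0..g (2 * c)} x)"
      unfolding g by (intro Bochner_Integration.integral_cong refl) (auto simp: f_def indicator_def)
    finally show ?thesis .
  qed
  have pt: "indicator {0..2 * c} s *\<^sub>R (s * exp (- s\<^sup>2 / 2) * (cmod (bessel_J \<nu> (of_real s * csqrt z)))\<^sup>2) =
      (2 powr (2 - \<nu>) * cmod z powr \<nu>) * (f (g s) * (s / (2 * c\<^sup>2)) * indicator {0..2 * c} s)" for s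
  proof (cases "0 < s \<and> s \<le> 2 * c")
    case True
    then have s: "0 < s" "s \<le> 2 * c" by auto
    have gs: "0 < g s" "g s \<le> 1" "c\<^sup>2 * g s = s\<^sup>2 / 4"
    proof -
      have "s\<^sup>2 \<le> (2 * c)\<^sup>2" using s by (intro power_mono) auto
      then show "0 < g s" "g s \<le> 1" "c\<^sup>2 * g s = s\<^sup>2 / 4" using s c by (auto simp: g_def field_simps power2_eq_square)
    qed
    have const: "1 / 4 * (2 * c\<^sup>2) powr (\<nu> + 1) * g s powr \<nu> * (s / (2 * c\<^sup>2)) * 2 powr (2 - \<nu>) = s * (s / 2) powr (2 * \<nu>)"
    proof -
      have 1: "(2 * c\<^sup>2) powr (\<nu> + 1) = (2 * c\<^sup>2) powr \<nu> * (2 * c\<^sup>2)" using c by (simp add: powr_add)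
      have "(2 * c\<^sup>2) powr \<nu> * g s powr \<nu> = ((2 * c\<^sup>2) * g s) powr \<nu>" by (rule powr_mult[symmetric])
      also have "(2 * c\<^sup>2) * g s = 2 * (s / 2)\<^sup>2" using gs(3) by (simp add: power_divide)
      also have "(2 * (s / 2)\<^sup>2) powr \<nu> = 2 powr \<nu> * (s / 2) powr (2 * \<nu>)"
      proof -
        have "(s / 2)\<^sup>2 = (s / 2) powr 2" using s by simp
        then show ?thesis unfolding powr_mult by (simp add: powr_powr)
      qed
      finally have 2: "(2 * c\<^sup>2) powr \<nu> * g s powr \<nu> = 2 powr \<nu> * (s / 2) powr (2 * \<nu>)" .
      have 3: "2 powr (2 - \<nu>) = 4 / 2 powr \<nu>" by (simp add: powr_diff)
      have "1 / 4 * (X * d) * Y * (s / d) * (4 / T) = s * Z" if "X * Y = T * Z" "d \<noteq> 0" "T \<noteq> 0" for X Y T Z d :: real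
      proof -
        have "1 / 4 * (X * d) * Y * (s / d) * (4 / T) = s * (X * Y) / T" using that(2) by simp
        then show ?thesis using that by simp
      qed
      from this[OF 2, of "2 * c\<^sup>2"] show ?thesis unfolding 1 3 using c by simp
    qed
    have ex: "exp (- 2 * c\<^sup>2 * g s) = exp (- s\<^sup>2 / 2)" using gs(3) by (simp add: mult.assoc)
    have ph: "f (g s) = 1 / 4 * (2 * c\<^sup>2) powr (\<nu> + 1) * g s powr \<nu> * exp (- s\<^sup>2 / 2) * (cmod (bessel_series \<nu> (- (of_real (s\<^sup>2 / 4) * z))))\<^sup>2"
      unfolding f_def e_def ex gs(3) using gs by simp
    have "(2 powr (2 - \<nu>) * cmod z powr \<nu>) * (f (g s) * (s / (2 * c\<^sup>2))) =
       (1 / 4 * (2 * c\<^sup>2) powr (\<nu> + 1) * g s powr \<nu> * (s / (2 * c\<^sup>2)) * 2 powr (2 - \<nu>)) * exp (- s\<^sup>2 / 2) * cmod z powr \<nu> * (cmod (bessel_series \<nu> (- (of_real (s\<^sup>2 / 4) * z))))\<^sup>2"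
      unfolding ph by (simp only: mult_ac)
    also have "\<dots> = s * exp (- s\<^sup>2 / 2) * (cmod (bessel_J \<nu> (of_real s * csqrt z)))\<^sup>2"
      unfolding const bessel_J_series[OF s(1) z] by (simp only: mult_ac)
    finally show ?thesis using s by simp
  next
    case False
    then show ?thesis by (auto simp: indicator_def)
  qed
  have "(LBINT s:{0..2 * c}. s * exp (- s\<^sup>2 / 2) * (cmod (bessel_J \<nu> (of_real s * csqrt z)))\<^sup>2)
     = (2 powr (2 - \<nu>) * cmod z powr \<nu>) * laguerre_limit c \<nu> z"
  proof -
    have "(LBINT s:{0..2 * c}. s * exp (- s\<^sup>2 / 2) * (cmod (bessel_J \<nu> (of_real s * csqrt z)))\<^sup>2) =
      (LINT s|lborel. (2 powr (2 - \<nu>) * cmod z powr \<nu>) * (f (g s) * (s / (2 * c\<^sup>2)) * indicator {0..2 * c} s))"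
      unfolding set_lebesgue_integral_def by (intro Bochner_Integration.integral_cong refl pt)
    also have "\<dots> = (2 powr (2 - \<nu>) * cmod z powr \<nu>) * laguerre_limit c \<nu> z"
      unfolding SLe sub by (rule integral_mult_right_zero)
    finally show ?thesis .
  qed
  then have "limit_density c \<nu> z = 1 / 2 * 2 powr (2 - \<nu>) * (bessel_K \<nu> (1 * cmod z) * cmod z powr \<nu>) * exp (Re z) * laguerre_limit c \<nu> z"
    by (simp add: limit_density_def)
  also have "\<dots> = (1 / 2 * 2 powr (2 - \<nu>) * 2 powr (\<nu> - 1)) * (bessel_integral \<nu> ((cmod z)\<^sup>2 / 4) * exp (Re z)) * laguerre_limit c \<nu> z"
    using bessel_K_scaled[OF r, of 1 \<nu>] by simp
  also have "1 / 2 * 2 powr (2 - \<nu>) * 2 powr (\<nu> - 1) = (1::real)"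
  proof -
    have "2 powr (2 - \<nu>) * 2 powr (\<nu> - 1) = (2::real) powr 1" by (simp flip: powr_add)
    then show ?thesis by simp
  qed
  finally show ?thesis by (simp add: bessel_weight_def)
qed

end

theorem theorem1p8:
  fixes c \<nu> :: real and S :: "complex set"
  assumes "c > 0" and "\<nu> > -1"
    and "compact S" and "S \<subseteq> - \<real>\<^sub>\<le>\<^sub>0"
  shows "uniform_limit S (rescaled_one_point_function c \<nu>) (limit_density c \<nu>) sequentially"
proof -
  note c = assms(1) and \<nu> = assms(2)
  have nz: "z \<noteq> 0" if "z \<in> S" for z using that assms(4) by auto
  obtain r where "r > 0" "\<forall>z\<in>S. norm z \<le> r"
    using compact_imp_bounded[OF assms(3)] unfolding bounded_pos by blast
  then have r: "r > 0" "S \<subseteq> cball 0 r" by auto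
  have SN: "uniform_limit S (laguerre_sum c \<nu>) (laguerre_limit c \<nu>) sequentially"
    using laguerre_sum_uniform(1)[OF c \<nu> r(1)] r(2) by (rule uniform_limit_on_subset)
  have bSL: "bounded (laguerre_limit c \<nu> ` S)"
    using laguerre_sum_uniform(2)[OF c \<nu> r(1)] r(2) by (meson bounded_subset image_mono)
  have Fc: "continuous_on S (\<lambda>z. bessel_integral \<nu> ((cmod z)\<^sup>2 / 4))"
  proof (intro continuous_at_imp_continuous_on ballI)
    fix z assume "z \<in> S"
    then have "(cmod z)\<^sup>2 / 4 > 0" using nz by simp
    then show "isCont (\<lambda>z. bessel_integral \<nu> ((cmod z)\<^sup>2 / 4)) z"
      by (intro isCont_o2[OF _ bessel_integral_isCont] continuous_intros) auto
  qed
  have bF: "bounded ((\<lambda>z. bessel_integral \<nu> ((cmod z)\<^sup>2 / 4)) ` S)"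
    by (intro compact_imp_bounded compact_continuous_image Fc assms(3))
  have bE: "bounded ((\<lambda>z. exp (Re z)) ` S)"
    by (intro compact_imp_bounded compact_continuous_image assms(3) continuous_intros)
  have alp1: "tilt c \<longlonglongrightarrow> 1" unfolding tilt_def[abs_def] by real_asymp
  have E: "uniform_limit S (\<lambda>N z. exp (tilt c N * Re z)) (\<lambda>z. exp (Re z)) sequentially"
  proof -
    have eq: "exp (tilt c N * Re z) = exp ((tilt c N - 1) * Re z) * exp (Re z)" for N z
      by (simp add: algebra_simps flip: exp_add)
    have "uniform_limit S (\<lambda>N z. exp ((tilt c N - 1) * Re z)) (\<lambda>z. 1) sequentially"
    proof (rule uniform_limitI)
      fix e :: real assume "e > 0"
      have "(\<lambda>N. exp (\<bar>tilt c N - 1\<bar> * r) - exp (- \<bar>tilt c N - 1\<bar> * r)) \<longlonglongrightarrow> exp (\<bar>1 - 1\<bar> * r) - exp (- \<bar>1 - 1\<bar> * r)"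
        by (intro tendsto_intros alp1)
      then have "\<forall>\<^sub>F N in sequentially. exp (\<bar>tilt c N - 1\<bar> * r) - exp (- \<bar>tilt c N - 1\<bar> * r) < e"
        using \<open>e > 0\<close> by (intro order_tendstoD(2)) auto
      then show "\<forall>\<^sub>F N in sequentially. \<forall>z\<in>S. dist (exp ((tilt c N - 1) * Re z)) 1 < e"
      proof eventually_elim
        case (elim N)
        show ?case
        proof
          fix z assume "z \<in> S"
          then have "\<bar>Re z\<bar> \<le> r" using r(2) abs_Re_le_cmod[of z] by auto
          then have "\<bar>(tilt c N - 1) * Re z\<bar> \<le> \<bar>tilt c N - 1\<bar> * r" unfolding abs_mult by (intro mult_left_mono) auto
          then have 1: "(tilt c N - 1) * Re z \<le> \<bar>tilt c N - 1\<bar> * r" "- \<bar>tilt c N - 1\<bar> * r \<le> (tilt c N - 1) * Re z" by auto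
          have 2: "0 \<le> \<bar>tilt c N - 1\<bar> * r" using r by simp
          have "exp ((tilt c N - 1) * Re z) \<le> exp (\<bar>tilt c N - 1\<bar> * r)" "exp (- \<bar>tilt c N - 1\<bar> * r) \<le> exp ((tilt c N - 1) * Re z)"
            using 1 by simp_all
          moreover have "1 \<le> exp (\<bar>tilt c N - 1\<bar> * r)" "exp (- \<bar>tilt c N - 1\<bar> * r) \<le> 1" using 2 by simp_all
          ultimately show "dist (exp ((tilt c N - 1) * Re z)) 1 < e" unfolding dist_real_def using elim by linarith
        qed
      qed
    qed
    then have "uniform_limit S (\<lambda>N z. exp ((tilt c N - 1) * Re z) * exp (Re z)) (\<lambda>z. 1 * exp (Re z)) sequentially"
      by (rule uniform_lim_mult[OF _ uniform_limit_const _ bE]) (auto simp: bounded_iff)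
    then show ?thesis by (simp add: eq)
  qed
  have W: "uniform_limit S (\<lambda>N z. bessel_weight \<nu> (tilt c N) z) (\<lambda>z. bessel_weight \<nu> 1 z) sequentially"
    unfolding bessel_weight_def using uniform_lim_mult[OF uniform_limit_const E bF bE]
    by simp
  have bW: "bounded (bessel_weight \<nu> 1 ` S)"
    unfolding bessel_weight_def[abs_def] by (intro compact_imp_bounded compact_continuous_image assms(3) continuous_intros Fc)
  have lim: "uniform_limit S (\<lambda>N z. bessel_weight \<nu> (tilt c N) z * laguerre_sum c \<nu> N z) (\<lambda>z. bessel_weight \<nu> 1 z * laguerre_limit c \<nu> z) sequentially"
    by (rule uniform_lim_mult[OF W SN bW bSL])
  have ev: "\<forall>\<^sub>F N in sequentially. \<forall>z\<in>S. bessel_weight \<nu> (tilt c N) z * laguerre_sum c \<nu> N z = rescaled_one_point_function c \<nu> N z"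
  proof -
    have "\<forall>\<^sub>F N in sequentially. real N > c\<^sup>2" by real_asymp
    then show ?thesis by eventually_elim (use rescaled_one_point[OF c \<nu>] nz in simp)
  qed
  have "uniform_limit S (\<lambda>N z. bessel_weight \<nu> (tilt c N) z * laguerre_sum c \<nu> N z) (\<lambda>z. bessel_weight \<nu> 1 z * laguerre_limit c \<nu> z) sequentially \<longleftrightarrow>
      uniform_limit S (rescaled_one_point_function c \<nu>) (limit_density c \<nu>) sequentially"
    by (rule uniform_limit_cong[OF ev]) (use limit_density_eq[OF c \<nu>] nz in simp)
  then show ?thesis using lim by simp
qed

end
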